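(* Let $d>2$, $\Omega\subseteq\mathbb{R}^d$ open, $2\le k\le d-1$ an odd integer, $p\ge1$, and $r$ an integer with $k<r\le d$. Let $f\in W^{1,p}(\Omega,\mathbb{R}^d)$ and suppose that the a.e.-defined map $x\mapsto\bigwedge^kdf_x$ has a smooth representative $\Omega\to\operatorname{End}(\bigwedge^k\mathbb{R}^d)$ taking values in $\tilde H_{\binom rk}$ at every point. Then $f$ is smooth.
   Context: $\bigwedge^kA$ is the endomorphism of $\bigwedge^k\mathbb{R}^d$ given by $v_1\wedge\dots\wedge v_k\mapsto Av_1\wedge\dots\wedge Av_k$. For an integer $s$, $\tilde H_s=\{B\in\operatorname{End}(\bigwedge^k\mathbb{R}^d):\operatorname{rank}B=s\}$. *)

theory Defs
  imports "HOL-Analysis.Analysis" "HOL-Library.Function_Algebras"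
begin

fun Ck_on :: "nat \<Rightarrow> 'a::euclidean_space set \<Rightarrow> ('a \<Rightarrow> 'b::real_normed_vector) \<Rightarrow> bool" where
  "Ck_on 0 U f = continuous_on U f"
| "Ck_on (Suc n) U f =
     (\<exists>f'. (\<forall>x\<in>U. (f has_derivative f' x) (at x)) \<and> (\<forall>i\<in>Basis. Ck_on n U (\<lambda>x. f' x i)))"

definition Cinf_on :: "'a::euclidean_space set \<Rightarrow> ('a \<Rightarrow> 'b::real_normed_vector) \<Rightarrow> bool" where
  "Cinf_on U f \<longleftrightarrow> (\<forall>n. Ck_on n U f)"

definition test_fun :: "(real^'n::finite) set \<Rightarrow> (real^'n \<Rightarrow> real) \<Rightarrow> bool" where
  "test_fun \<Omega> \<phi> \<longleftrightarrow> Cinf_on UNIV \<phi> \<and> compact (closure {x. \<phi> x \<noteq> 0})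
      \<and> closure {x. \<phi> x \<noteq> 0} \<subseteq> \<Omega>"

definition Lp_on :: "real \<Rightarrow> (real^'n::finite) set \<Rightarrow> (real^'n \<Rightarrow> real^'m::finite) \<Rightarrow> bool" where
  "Lp_on p \<Omega> f \<longleftrightarrow> f \<in> borel_measurable (lebesgue_on \<Omega>)
      \<and> integrable (lebesgue_on \<Omega>) (\<lambda>x. norm (f x) powr p)"

definition weak_partial :: "(real^'n::finite) set \<Rightarrow> (real^'n \<Rightarrow> real^'m::finite) \<Rightarrow> 'n \<Rightarrow> (real^'n \<Rightarrow> real^'m) \<Rightarrow> bool" where
  "weak_partial \<Omega> f i g \<longleftrightarrow>
     (\<forall>\<phi>. test_fun \<Omega> \<phi> \<longrightarrow>
        (\<integral>x. frechet_derivative \<phi> (at x) (axis i 1) *\<^sub>R f x \<partial>lebesgue_on \<Omega>)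
          = - (\<integral>x. \<phi> x *\<^sub>R g x \<partial>lebesgue_on \<Omega>))"

definition sobolev_W1p :: "real \<Rightarrow> (real^'n::finite) set \<Rightarrow> (real^'n \<Rightarrow> real^'m::finite) \<Rightarrow> ('n \<Rightarrow> real^'n \<Rightarrow> real^'m) \<Rightarrow> bool" where
  "sobolev_W1p p \<Omega> f g \<longleftrightarrow> Lp_on p \<Omega> f \<and> (\<forall>i. Lp_on p \<Omega> (g i) \<and> weak_partial \<Omega> f i (g i))"

definition weak_jacobian :: "('n::finite \<Rightarrow> real^'n \<Rightarrow> real^'m::finite) \<Rightarrow> real^'n \<Rightarrow> real^'n^'m" where
  "weak_jacobian g x = (\<chi> a b. g b x $ a)"

text \<open>We realise \<open>\<bigwedge>^k R^d\<close> canonically as the space of alternating k-tensors on R^d: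
  functions T on index words of length k (zero on words of other length) that change sign
  when two positions are swapped.  \<open>\<bigwedge>^k A\<close> is the restriction of \<open>A^{\<otimes>k}\<close>, i.e. it sends
  \<open>v_1 \<and> ... \<and> v_k\<close> to \<open>Av_1 \<and> ... \<and> Av_k\<close>.\<close>

definition alt_tensors :: "nat \<Rightarrow> ('n::finite list \<Rightarrow> real) set" where
  "alt_tensors k = {T. (\<forall>xs. length xs \<noteq> k \<longrightarrow> T xs = 0) \<and>
      (\<forall>xs i j. length xs = k \<and> i < k \<and> j < k \<and> i \<noteq> j \<longrightarrow>
          T (xs[i := xs ! j, j := xs ! i]) = - T xs)}"

definition ext_pow :: "nat \<Rightarrow> real^'n^'n \<Rightarrow> ('n::finite list \<Rightarrow> real) \<Rightarrow> ('n list \<Rightarrow> real)" where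
  "ext_pow k A T = (\<lambda>xs. if length xs = k then
      (\<Sum>ys\<in>{ys. length ys = k}. (\<Prod>m<k. A $ (xs ! m) $ (ys ! m)) * T ys) else 0)"

definition fscale :: "real \<Rightarrow> ('a \<Rightarrow> real) \<Rightarrow> ('a \<Rightarrow> real)" where
  "fscale c f = (\<lambda>x. c * f x)"

definition is_endo :: "('a \<Rightarrow> real) set \<Rightarrow> (('a \<Rightarrow> real) \<Rightarrow> ('a \<Rightarrow> real)) \<Rightarrow> bool" where
  "is_endo V L \<longleftrightarrow> L ` V \<subseteq> V \<and>
     (\<forall>u\<in>V. \<forall>v\<in>V. \<forall>a b. L (fscale a u + fscale b v) = fscale a (L u) + fscale b (L v))"

definition op_rank :: "('a \<Rightarrow> real) set \<Rightarrow> (('a \<Rightarrow> real) \<Rightarrow> ('a \<Rightarrow> real)) \<Rightarrow> nat" where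
  "op_rank V L = vector_space.dim fscale (L ` V)"

end

(* Since k is odd and every relevant matrix has rank r > k, a matrix A can be recovered smoothly from its
   k-minors: for a nonsingular (k+1) x (k+1) compression S of A the k-minors form the adjugate of S, with
   determinant (det S)^k; an odd root gives det S, hence S, and perturbing the compression gives all
   entries of A. At an exceptional point x0 a nonsingular compression still exists, because x0 is a limit
   of points where Psi is the k-th exterior power of a matrix: the ranks agree, so no product of k nonzero
   singular values can degenerate in the limit, even if the singular values themselves diverge. Thus the
   weak Jacobian has a smooth representative G near x0. A function with continuous weak gradient G satisfies
   f(x+v) - f(x) = int_0^1 G(x+tv).v dt for all small v and almost all x, and so agrees almost everywhere
   with a C^1 function of gradient G; the local representatives agree on overlaps and glue. *)
theory Submission
  imports Defs "Jordan_Normal_Form.Determinant"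
begin

no_notation Matrix.vec_index (infixl "$" 100)
no_notation Matrix.scalar_prod (infix "\<bullet>" 70)
hide_const (open) Matrix.mat


section \<open>Functions of class $C^k$\<close>

text \<open>Parity fixes the sign: A and -A have the same k-th exterior power when k is even. The
  condition r > k makes several nonzero products of k singular values available; a rank-k matrix has
  only one, from which the individual singular values cannot be read. The recovery formula returns
  one fixed entry \<open>w 0 \<bullet> (A *v u 0)\<close> of the compression, in directions dictated
  by limiting singular frames and unrelated to the coordinate axes; moving only \<open>w 0\<close>
  and \<open>u 0\<close> and taking a mixed second difference isolates a coordinate entry. All
  determinants evaluated at x0 are built from \<open>\<Psi>\<close> alone, so they are defined and
  smooth even where \<open>\<Psi>\<close> is not known to be an exterior power. The matrices along
  the approximating sequence have no a priori bound, so compactness is applied to orthonormal frames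
  and normalised images instead. On the analytic side no mollification is used: averaging a test
  function over a segment of direction -v gives a test function whose derivative along v is a
  difference of translates, which turns the weak gradient equation into the difference formula for f
  itself.\<close>

lemma Ck_on_SucI:
  assumes "\<And>x. x \<in> U \<Longrightarrow> (f has_derivative f' x) (at x)"
    and "\<And>i. i \<in> Basis \<Longrightarrow> Ck_on n U (\<lambda>x. f' x i)"
  shows "Ck_on (Suc n) U f"
  using assms by auto

lemma Ck_on_SucE:
  assumes "Ck_on (Suc n) U f"
  obtains f' where "\<And>x. x \<in> U \<Longrightarrow> (f has_derivative f' x) (at x)"
    and "\<And>i. i \<in> Basis \<Longrightarrow> Ck_on n U (\<lambda>x. f' x i)"
  using assms by auto

lemma Ck_on_subset: "Ck_on n U f \<Longrightarrow> V \<subseteq> U \<Longrightarrow> Ck_on n V f"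
proof (induction n arbitrary: f)
  case 0 then show ?case by (auto intro: continuous_on_subset)
next
  case (Suc n)
  obtain f' where "\<And>x. x \<in> U \<Longrightarrow> (f has_derivative f' x) (at x)"
    "\<And>i. i \<in> Basis \<Longrightarrow> Ck_on n U (\<lambda>x. f' x i)" using Suc.prems(1) by (rule Ck_on_SucE) blast
  then show ?case using Suc by (intro Ck_on_SucI[where f'=f']) auto
qed

lemma Ck_on_cong:
  assumes "open U" "\<And>x. x \<in> U \<Longrightarrow> f x = h x" "Ck_on n U f"
  shows "Ck_on n U h"
proof (cases n)
  case 0 then show ?thesis using assms by (simp cong: continuous_on_cong)
next
  case (Suc m)
  then obtain f' where f': "\<And>x. x \<in> U \<Longrightarrow> (f has_derivative f' x) (at x)"
    "\<And>i. i \<in> Basis \<Longrightarrow> Ck_on m U (\<lambda>x. f' x i)" using assms(3) Ck_on_SucE by metis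
  show ?thesis unfolding Suc
  proof (rule Ck_on_SucI[where f'=f'])
    fix x assume "x \<in> U"
    then show "(h has_derivative f' x) (at x)"
      using has_derivative_transform_within_open[OF f'(1) assms(1) _ assms(2)] by blast
  qed (use f' in auto)
qed

lemma Ck_on_Suc_continuous: "Ck_on (Suc n) U f \<Longrightarrow> continuous_on U f"
  by (meson Ck_on_SucE continuous_at_imp_continuous_on has_derivative_continuous)

lemma Ck_on_SucD: "Ck_on (Suc n) U f \<Longrightarrow> Ck_on n U f"
proof (induction n arbitrary: f)
  case 0 then show ?case using Ck_on_Suc_continuous[of 0 U f] by simp
next
  case (Suc n)
  obtain f' where "\<And>x. x \<in> U \<Longrightarrow> (f has_derivative f' x) (at x)"
    "\<And>i. i \<in> Basis \<Longrightarrow> Ck_on (Suc n) U (\<lambda>x. f' x i)" using Suc.prems(1) by (rule Ck_on_SucE) blast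
  then show ?case using Suc.IH by (intro Ck_on_SucI[where f'=f']) auto
qed

lemma Ck_on_continuous: "Ck_on n U f \<Longrightarrow> continuous_on U f"
  by (cases n) (use Ck_on_Suc_continuous in auto)

lemma Ck_on_const: "Ck_on n U (\<lambda>x. c)"
proof (induction n arbitrary: c)
  case (Suc n) then show ?case by (intro Ck_on_SucI[where f'="\<lambda>x h. 0"]) auto
qed auto

lemma Ck_on_bounded_linear:
  assumes L: "bounded_linear L"
  shows "Ck_on n U f \<Longrightarrow> Ck_on n U (\<lambda>x. L (f x))"
proof (induction n arbitrary: f)
  case 0 then show ?case using bounded_linear.continuous_on[OF L] by simp
next
  case (Suc n)
  obtain f' where "\<And>x. x \<in> U \<Longrightarrow> (f has_derivative f' x) (at x)"
    "\<And>i. i \<in> Basis \<Longrightarrow> Ck_on n U (\<lambda>x. f' x i)" using Suc.prems(1) by (rule Ck_on_SucE) blast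
  then show ?case using Suc.IH
    by (intro Ck_on_SucI[where f'="\<lambda>x h. L (f' x h)"]) (auto intro: bounded_linear.has_derivative[OF L])
qed

lemma Ck_on_linear:
  assumes "bounded_linear L"
  shows "Ck_on n U L"
proof (cases n)
  case 0 then show ?thesis using assms linear_continuous_on by auto
next
  case (Suc m)
  show ?thesis unfolding Suc
    by (intro Ck_on_SucI[where f'="\<lambda>x h. L h"] bounded_linear_imp_has_derivative assms Ck_on_const)
qed

lemma Ck_on_add: "Ck_on n U f \<Longrightarrow> Ck_on n U h \<Longrightarrow> Ck_on n U (\<lambda>x. f x + h x)"
proof (induction n arbitrary: f h)
  case 0 then show ?case by (auto intro: continuous_on_add)
next
  case (Suc n)
  obtain f' where f': "\<And>x. x \<in> U \<Longrightarrow> (f has_derivative f' x) (at x)"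
    "\<And>i. i \<in> Basis \<Longrightarrow> Ck_on n U (\<lambda>x. f' x i)" using Suc.prems(1) by (rule Ck_on_SucE) blast
  obtain h' where h': "\<And>x. x \<in> U \<Longrightarrow> (h has_derivative h' x) (at x)"
    "\<And>i. i \<in> Basis \<Longrightarrow> Ck_on n U (\<lambda>x. h' x i)" using Suc.prems(2) by (rule Ck_on_SucE) blast
  show ?case using f' h' Suc.IH
    by (intro Ck_on_SucI[where f'="\<lambda>x v. f' x v + h' x v"]) (auto intro: has_derivative_add)
qed

lemma Ck_on_mult:
  fixes f h :: "'a::euclidean_space \<Rightarrow> real"
  shows "Ck_on n U f \<Longrightarrow> Ck_on n U h \<Longrightarrow> Ck_on n U (\<lambda>x. f x * h x)"
proof (induction n arbitrary: f h)
  case 0 then show ?case by (auto intro: continuous_on_mult)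
next
  case (Suc n)
  obtain f' where f': "\<And>x. x \<in> U \<Longrightarrow> (f has_derivative f' x) (at x)"
    "\<And>i. i \<in> Basis \<Longrightarrow> Ck_on n U (\<lambda>x. f' x i)" using Suc.prems(1) by (rule Ck_on_SucE) blast
  obtain h' where h': "\<And>x. x \<in> U \<Longrightarrow> (h has_derivative h' x) (at x)"
    "\<And>i. i \<in> Basis \<Longrightarrow> Ck_on n U (\<lambda>x. h' x i)" using Suc.prems(2) by (rule Ck_on_SucE) blast
  show ?case
  proof (rule Ck_on_SucI[where f'="\<lambda>x v. f x * h' x v + f' x v * h x"])
    show "((\<lambda>x. f x * h x) has_derivative (\<lambda>v. f x * h' x v + f' x v * h x)) (at x)" if "x \<in> U" for x
      using f'(1)[OF that] h'(1)[OF that] by (rule has_derivative_mult)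
    show "Ck_on n U (\<lambda>x. f x * h' x i + f' x i * h x)" if "i \<in> Basis" for i
      using f'(2)[OF that] h'(2)[OF that] Suc.prems[THEN Ck_on_SucD]
      by (intro Ck_on_add Suc.IH) auto
  qed
qed

lemma Ck_on_cmult:
  fixes f :: "'a::euclidean_space \<Rightarrow> real"
  shows "Ck_on n U f \<Longrightarrow> Ck_on n U (\<lambda>x. c * f x)"
  by (intro Ck_on_mult Ck_on_const)

lemma Ck_on_sum:
  assumes "\<And>i. i \<in> I \<Longrightarrow> Ck_on n U (f i)"
  shows "Ck_on n U (\<lambda>x. \<Sum>i\<in>I. f i x)"
  using assms by (induction I rule: infinite_finite_induct) (auto intro: Ck_on_const Ck_on_add)

lemma Ck_on_prod:
  fixes f :: "'i \<Rightarrow> 'a::euclidean_space \<Rightarrow> real"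
  assumes "\<And>i. i \<in> I \<Longrightarrow> Ck_on n U (f i)"
  shows "Ck_on n U (\<lambda>x. \<Prod>i\<in>I. f i x)"
  using assms by (induction I rule: infinite_finite_induct) (auto intro: Ck_on_const Ck_on_mult)

lemma Ck_on_inverse:
  fixes f :: "'a::euclidean_space \<Rightarrow> real"
  assumes "\<And>x. x \<in> U \<Longrightarrow> f x \<noteq> 0"
  shows "Ck_on n U f \<Longrightarrow> Ck_on n U (\<lambda>x. inverse (f x))"
proof (induction n)
  case 0 then show ?case using assms by (auto intro: continuous_on_inverse)
next
  case (Suc n)
  obtain f' where f': "\<And>x. x \<in> U \<Longrightarrow> (f has_derivative f' x) (at x)"
    "\<And>i. i \<in> Basis \<Longrightarrow> Ck_on n U (\<lambda>x. f' x i)" using Suc.prems(1) by (rule Ck_on_SucE) blast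
  show ?case
  proof (rule Ck_on_SucI[where f'="\<lambda>x v. (-1) * (inverse (f x) * f' x v * inverse (f x))"])
    show "((\<lambda>x. inverse (f x)) has_derivative (\<lambda>v. (-1) * (inverse (f x) * f' x v * inverse (f x)))) (at x)" if "x \<in> U" for x
      using Deriv.has_derivative_inverse[OF assms f'(1)] that by simp
    show "Ck_on n U (\<lambda>x. (-1) * (inverse (f x) * f' x i * inverse (f x)))" if "i \<in> Basis" for i
      using f'(2)[OF that] Suc.prems[THEN Ck_on_SucD] Suc.IH
      by (intro Ck_on_mult Ck_on_const) auto
  qed
qed

text \<open>Written as root(f) / (k f), the derivative of the root is a product of the root itself
  with functions already treated, so the induction on the order closes. Odd k admits negative values
  of f.\<close>

lemma Ck_on_odd_root:
  fixes f :: "'a::euclidean_space \<Rightarrow> real"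
  assumes "\<And>x. x \<in> U \<Longrightarrow> f x \<noteq> 0" and k: "odd k"
  shows "Ck_on n U f \<Longrightarrow> Ck_on n U (\<lambda>x. root k (f x))"
proof (induction n)
  case 0 then show ?case using assms by (auto intro: continuous_on_real_root)
next
  case (Suc n)
  have "k > 0" using k odd_pos by blast
  obtain f' where f': "\<And>x. x \<in> U \<Longrightarrow> (f has_derivative f' x) (at x)"
    "\<And>i. i \<in> Basis \<Longrightarrow> Ck_on n U (\<lambda>x. f' x i)" using Suc.prems(1) by (rule Ck_on_SucE) blast
  show ?case
  proof (rule Ck_on_SucI[where f'="\<lambda>x v. inverse k * root k (f x) * inverse (f x) * f' x v"])
    fix x assume x: "x \<in> U"
    let ?y = "f x"
    have "?y \<noteq> 0" using assms x by auto
    have "root k ?y ^ k = ?y" using k by (simp add: odd_real_root_pow)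
    then have e: "inverse (real k * root k ?y ^ (k - Suc 0)) = inverse k * root k ?y * inverse ?y"
      using \<open>?y \<noteq> 0\<close> \<open>k > 0\<close> power_minus_mult[of k "root k ?y"] by (auto simp: field_simps)
    have "DERIV (root k) ?y :> inverse (real k * root k ?y ^ (k - Suc 0))"
      using k \<open>?y \<noteq> 0\<close> by (intro DERIV_odd_real_root)
    then have "(root k has_derivative (*) (inverse k * root k ?y * inverse ?y)) (at ?y)"
      unfolding e by (simp add: has_field_derivative_def)
    then show "((\<lambda>x. root k (f x)) has_derivative (\<lambda>v. inverse k * root k (f x) * inverse (f x) * f' x v)) (at x)"
      using has_derivative_compose[OF f'(1)[OF x], of "root k"] by simp
  next
    show "Ck_on n U (\<lambda>x. inverse k * root k (f x) * inverse (f x) * f' x i)" if "i \<in> Basis" for i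
      by (rule Ck_on_mult Ck_on_const Ck_on_inverse f'(2)[OF that] Suc.prems[THEN Ck_on_SucD]
          Suc.IH assms(1) | assumption)+
  qed
qed

lemma Ck_on_compose_real:
  fixes f :: "'a::euclidean_space \<Rightarrow> real" and \<phi> :: "real \<Rightarrow> real"
  shows "Ck_on n UNIV \<phi> \<Longrightarrow> Ck_on n U f \<Longrightarrow> Ck_on n U (\<lambda>x. \<phi> (f x))"
proof (induction n arbitrary: \<phi>)
  case 0 then show ?case using continuous_on_compose2[of UNIV \<phi> U f] by simp
next
  case (Suc n)
  obtain f' where f': "\<And>x. x \<in> U \<Longrightarrow> (f has_derivative f' x) (at x)"
    "\<And>i. i \<in> Basis \<Longrightarrow> Ck_on n U (\<lambda>x. f' x i)" using Suc.prems(2) by (rule Ck_on_SucE) blast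
  obtain p' where p': "\<And>x. (\<phi> has_derivative p' x) (at x)" "Ck_on n UNIV (\<lambda>x. p' x 1)"
    using Suc.prems(1) by (auto elim!: Ck_on_SucE)
  \<comment> \<open>A linear map on the real line is multiplication by its value at 1, so the chain
    rule becomes a product of real functions.\<close>
  have lin: "p' y v = v * p' y 1" for y v
    using linear_cmul[OF has_derivative_linear[OF p'(1)[of y]], of v 1] by simp
  show ?case
  proof (rule Ck_on_SucI[where f'="\<lambda>x v. f' x v * p' (f x) 1"])
    show "((\<lambda>x. \<phi> (f x)) has_derivative (\<lambda>v. f' x v * p' (f x) 1)) (at x)" if "x \<in> U" for x
      using has_derivative_compose[OF f'(1)[OF that] p'(1)[of "f x"]] unfolding lin[of "f x" "f' x _"] .
    show "Ck_on n U (\<lambda>x. f' x i * p' (f x) 1)" if "i \<in> Basis" for i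
      using f'(2)[OF that] Suc.IH[OF p'(2) Ck_on_SucD[OF Suc.prems(2)]] by (intro Ck_on_mult)
  qed
qed

lemma Ck_on_vec:
  fixes f :: "'a::euclidean_space \<Rightarrow> real^'m::finite"
  assumes "\<And>a. Ck_on n U (\<lambda>x. f x $ a)"
  shows "Ck_on n U f"
proof -
  have e: "f = (\<lambda>x. \<Sum>a\<in>UNIV. f x $ a *\<^sub>R axis a (1::real))"
    by (simp add: fun_eq_iff Finite_Cartesian_Product.vec_eq_iff axis_def if_distrib cong: if_cong)
  show ?thesis
    by (subst e) (intro Ck_on_sum Ck_on_bounded_linear[of "\<lambda>c. c *\<^sub>R axis _ 1"] assms
        bounded_linear_scaleR_left)
qed

section \<open>Test functions and the fundamental lemma\<close>

text \<open>For m = 0 this is the classical exp(-1/t) extended by 0; the extra powers of 1/t make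
  the family closed under differentiation up to linear combinations, which is all an induction on
  the order needs.\<close>

definition flat :: "nat \<Rightarrow> real \<Rightarrow> real" where
  "flat m t = (if t > 0 then exp (- inverse t) * inverse t ^ m else 0)"

lemma flat_tendsto_0: "(flat m \<longlongrightarrow> 0) (at 0)"
proof -
  have "((\<lambda>t. exp (- inverse t) * inverse t ^ m) \<longlongrightarrow> (0::real)) (at_right 0)"
  proof -
    have "((\<lambda>z. z ^ m / exp z) \<longlongrightarrow> (0::real)) at_top" by (rule tendsto_power_div_exp_0)
    then have "((\<lambda>t. inverse t ^ m / exp (inverse t)) \<longlongrightarrow> (0::real)) (at_right 0)"
      using filterlim_compose filterlim_inverse_at_top_right by blast
    then show ?thesis by (simp add: exp_minus divide_inverse mult.commute)
  qed
  then have "(flat m \<longlongrightarrow> 0) (at_right 0)"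
    by (rule Lim_transform_eventually) (auto simp: eventually_at_filter flat_def)
  moreover have "(flat m \<longlongrightarrow> 0) (at_left 0)"
    by (rule Lim_transform_eventually[of "\<lambda>_. 0"]) (auto simp: eventually_at_filter flat_def)
  ultimately show ?thesis by (simp add: filterlim_split_at)
qed

lemma DERIV_flat: "DERIV (flat m) t :> flat (m+2) t - m * flat (m+1) t"
proof (cases "t = 0")
  case True
  \<comment> \<open>The difference quotient of \<open>flat m\<close> at 0 is
    \<open>flat (m+1)\<close>, which tends to 0.\<close>
  have "((\<lambda>h. flat m h / h) \<longlongrightarrow> 0) (at 0)"
    by (rule Lim_transform_eventually[OF flat_tendsto_0[of "Suc m"]])
      (auto simp: eventually_at_filter flat_def divide_inverse)
  then show ?thesis using True by (simp add: DERIV_def flat_def)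
next
  case False
  show ?thesis
  proof (cases "t > 0")
    case True
    let ?D = "exp (- inverse t) * (inverse t * inverse t) * inverse t ^ m
        + (real m * inverse t ^ (m - 1) * (- (inverse t * inverse t))) * exp (- inverse t)"
    have p: "real m * inverse t ^ (m - 1) * (- (inverse t * inverse t)) = - real m * inverse t ^ (m+1)"
      by (cases m) (auto simp: algebra_simps)
    have e: "?D = flat (m+2) t - m * flat (m+1) t"
      unfolding p using True by (simp add: flat_def)
    have "DERIV (\<lambda>t. exp (- inverse t) * inverse t ^ m) t :> ?D"
      using True by (auto intro!: derivative_eq_intros)
    then have "DERIV (\<lambda>t. exp (- inverse t) * inverse t ^ m) t :> flat (m+2) t - m * flat (m+1) t"
      unfolding e .
    then show ?thesis
      by (rule has_field_derivative_transform_within_open[where S="{0<..}"]) (use True in \<open>auto simp: flat_def\<close>)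
  next
    case F: False
    with False have "t < 0" by auto
    have "DERIV (\<lambda>t. 0) t :> flat (m+2) t - m * flat (m+1) t" using F by (simp add: flat_def)
    then show ?thesis
      by (rule has_field_derivative_transform_within_open[where S="{..<0}"]) (use \<open>t < 0\<close> in \<open>auto simp: flat_def\<close>)
  qed
qed

lemma Ck_on_flat: "Ck_on n UNIV (flat m)"
proof (induction n arbitrary: m)
  case 0
  then show ?case by (simp add: continuous_at_imp_continuous_on DERIV_isCont[OF DERIV_flat])
next
  case (Suc n)
  show ?case
  proof (rule Ck_on_SucI[where f'="\<lambda>t h. (flat (m+2) t - m * flat (m+1) t) * h"])
    show "(flat m has_derivative (\<lambda>h. (flat (m+2) t - m * flat (m+1) t) * h)) (at t)" for t
      using DERIV_flat[of m t] unfolding has_field_derivative_def .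
    have "Ck_on n UNIV (\<lambda>t. (flat (m+2) t + (- real m) * flat (m+1) t))"
      by (intro Ck_on_add Ck_on_cmult Suc)
    then show "Ck_on n UNIV (\<lambda>t. (flat (m+2) t - m * flat (m+1) t) * i)" if "i \<in> Basis" for i
      using that by simp
  qed
qed

text \<open>Scaling by n drives every factor exp(-1/(n s)) with s > 0 to 1 while the factors with s
  \<le> 0 stay 0: a sequence bounded by 1 that converges pointwise to the indicator of the open
  box.\<close>

definition box_bump :: "real^'n \<Rightarrow> real^'n \<Rightarrow> nat \<Rightarrow> real^'n::finite \<Rightarrow> real" where
  "box_bump a b n x = (\<Prod>i\<in>UNIV. flat 0 (n * (x$i - a$i)) * flat 0 (n * (b$i - x$i)))"

lemma box_bump_Cinf: "Cinf_on UNIV (box_bump a b n)"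
proof -
  have "Ck_on m UNIV (\<lambda>x. \<Prod>i\<in>UNIV. flat 0 (n * (x$i + (- a$i))) * flat 0 (n * (b$i + (-1) * x$i)))" for m
    by (intro Ck_on_prod Ck_on_mult Ck_on_compose_real[OF Ck_on_flat] Ck_on_add Ck_on_const
        Ck_on_linear bounded_linear_vec_nth)
  then show ?thesis unfolding Cinf_on_def box_bump_def[abs_def] by simp
qed

lemma flat_0_bounds: "0 \<le> flat 0 t" "flat 0 t \<le> 1"
  by (simp_all add: flat_def)

lemma box_bump_bounds: "0 \<le> box_bump a b n x" "box_bump a b n x \<le> 1"
  unfolding box_bump_def
  by (intro prod_nonneg mult_nonneg_nonneg flat_0_bounds)
    (intro prod_le_1 conjI mult_nonneg_nonneg mult_le_one flat_0_bounds)

lemma box_bump_eq_0: "x \<notin> box a b \<Longrightarrow> box_bump a b n x = 0"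
  unfolding box_bump_def by (force simp: mem_box_cart flat_def zero_less_mult_iff)

lemma box_bump_tendsto: "(\<lambda>n. box_bump a b n x) \<longlonglongrightarrow> indicator (box a b) x"
proof (cases "x \<in> box a b")
  case False then show ?thesis by (simp add: box_bump_eq_0)
next
  case True
  have *: "(\<lambda>n. flat 0 (real n * s)) \<longlonglongrightarrow> 1" if "s > 0" for s
  proof -
    have "(\<lambda>n. exp (- (inverse s * inverse (real n)))) \<longlonglongrightarrow> exp (- (inverse s * 0))"
      by (intro tendsto_intros lim_inverse_n)
    then have "(\<lambda>n. exp (- (inverse s * inverse (real n)))) \<longlonglongrightarrow> 1" by simp
    then show ?thesis
      by (rule Lim_transform_eventually)
        (use that in \<open>simp add: flat_def eventually_at_top_linorder, intro exI[of _ 1], simp add: zero_less_mult_iff mult.commute\<close>)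
  qed
  have "(\<lambda>n. box_bump a b n x) \<longlonglongrightarrow> (\<Prod>i\<in>(UNIV::'a set). 1 * 1)"
    unfolding box_bump_def using True by (intro tendsto_prod tendsto_mult *) (auto simp: mem_box_cart)
  then show ?thesis using True by simp
qed

lemma test_fun_box_bump: "cbox a b \<subseteq> U \<Longrightarrow> test_fun U (box_bump a b n)"
proof -
  assume U: "cbox a b \<subseteq> U"
  have "closure {x. box_bump a b n x \<noteq> 0} \<subseteq> cbox a b"
    by (rule closure_minimal) (use box_bump_eq_0[of _ a b n] box_subset_cbox[of a b] in blast, rule closed_cbox)
  moreover from this have "compact (closure {x. box_bump a b n x \<noteq> 0})"
    by (meson bounded_cbox bounded_subset closed_closure compact_eq_bounded_closed)
  ultimately show ?thesis using U box_bump_Cinf unfolding test_fun_def by blast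
qed

lemma integrable_mult_bounded:
  fixes F \<psi> :: "'a \<Rightarrow> real"
  assumes "integrable M F" "\<psi> \<in> borel_measurable M" "\<And>x. \<bar>\<psi> x\<bar> \<le> B"
  shows "integrable M (\<lambda>x. \<psi> x * F x)"
proof (rule Bochner_Integration.integrable_bound)
  show "integrable M (\<lambda>x. B * F x)" using assms by simp
  show "(\<lambda>x. \<psi> x * F x) \<in> borel_measurable M" using assms by simp
  have "\<bar>\<psi> x * F x\<bar> \<le> \<bar>B * F x\<bar>" for x
    using assms(3)[of x] by (auto simp: abs_mult intro!: mult_right_mono)
  then show "AE x in M. norm (\<psi> x * F x) \<le> norm (B * F x)" by simp
qed

text \<open>Open boxes form an intersection-stable generator of the Borel sets, and the sets over
  which F integrates to 0 form a Dynkin system. Hence F has the same set integrals as 0.\<close>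

lemma AE_eq_0_if_integral_box_eq_0:
  fixes F :: "'a::euclidean_space \<Rightarrow> real"
  assumes F: "integrable lborel F" and b: "\<And>a b. (\<integral>x. indicator (box a b) x * F x \<partial>lborel) = 0"
  shows "AE x in lborel. F x = 0"
proof -
  have meas: "F \<in> borel_measurable borel" using F by auto
  have int: "integrable lborel (\<lambda>x. indicator A x * F x)" if "A \<in> sets borel" for A :: "'a set"
    using F that by (intro integrable_mult_bounded[where B=1]) (auto simp: indicator_def)
  \<comment> \<open>Needed for complements in the Dynkin argument: the whole space is not a box, but
    it is exhausted by growing ones.\<close>
  have total: "(\<integral>x. F x \<partial>lborel) = 0"
  proof -
    let ?u = "\<lambda>n x. indicator (box (- real n *\<^sub>R One) (real n *\<^sub>R One)) x * F x"
    have "(\<lambda>n. \<integral>x. ?u n x \<partial>lborel) \<longlonglongrightarrow> (\<integral>x. F x \<partial>lborel)"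
    proof (rule integral_dominated_convergence[where w="\<lambda>x. \<bar>F x\<bar>"])
      show "AE x in lborel. (\<lambda>n. ?u n x) \<longlonglongrightarrow> F x"
      proof (rule AE_I2)
        fix x :: 'a
        obtain N where N: "norm x < real N" using reals_Archimedean2 by blast
        have "?u n x = F x" if "n \<ge> N" for n
        proof -
          have "\<bar>x \<bullet> i\<bar> < real n" if "i \<in> Basis" for i
            using Basis_le_norm[OF that, of x] N \<open>n \<ge> N\<close> by linarith
          then have "x \<in> box (- real n *\<^sub>R One) (real n *\<^sub>R One)"
            by (auto simp: mem_box abs_less_iff) (metis minus_less_iff)
          then show ?thesis by simp
        qed
        then show "(\<lambda>n. ?u n x) \<longlonglongrightarrow> F x"
          by (intro tendsto_eventually) (auto simp: eventually_at_top_linorder)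
      qed
    qed (use F meas in \<open>auto simp: indicator_def\<close>)
    then show ?thesis using b LIMSEQ_unique by (simp add: LIMSEQ_const_iff)
  qed
  have "(\<integral>x. indicator A x * F x \<partial>lborel) = 0" if "A \<in> sets borel" for A :: "'a set"
  proof -
    have "Int_stable (range (\<lambda>(a, b). box a b) :: 'a set set)"
      by (auto simp: Int_stable_def box_Int_box)
    moreover have "(range (\<lambda>(a, b). box a b) :: 'a set set) \<subseteq> Pow UNIV" by auto
    moreover have "A \<in> sigma_sets UNIV (range (\<lambda>(a, b). box a b))"
      using that unfolding borel_eq_box by simp
    ultimately show ?thesis
    proof (induction rule: sigma_sets_induct_disjoint)
      case (basic A) then show ?case using b by auto
    next
      case empty then show ?case by simp
    next
      case (compl A)
      then have A: "A \<in> sets borel" unfolding borel_eq_box by simp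
      have "(\<integral>x. indicator (UNIV - A) x * F x \<partial>lborel) = (\<integral>x. F x - indicator A x * F x \<partial>lborel)"
        by (intro Bochner_Integration.integral_cong) (auto simp: indicator_def)
      also have "\<dots> = 0" using compl total int[OF A] F by (subst Bochner_Integration.integral_diff) auto
      finally show ?case .
    next
      case (union A)
      then have A: "A i \<in> sets borel" for i unfolding borel_eq_box by auto
      have "(LINT x:(\<Union>i. A i)|lborel. F x) = (\<Sum>i. LINT x:A i|lborel. F x)"
      proof (rule lebesgue_integral_countable_add)
        show "set_integrable lborel (\<Union>i. A i) F"
          unfolding set_integrable_def using int[of "\<Union>i. A i"] A by auto
        show "A i \<inter> A j = {}" if "i \<noteq> j" for i j
          using union(1) that by (auto simp: disjoint_family_on_def)
      qed (use A in auto)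
      then show ?case using union by (simp add: set_lebesgue_integral_def)
    qed
  qed
  then have "AE x in lborel. F x = (\<lambda>x. 0) x"
    by (intro density_unique_real) (use F in \<open>auto simp: set_lebesgue_integral_def\<close>)
  then show ?thesis by simp
qed

lemma test_fun_continuous: "test_fun U \<phi> \<Longrightarrow> continuous_on UNIV \<phi>"
  unfolding test_fun_def Cinf_on_def using Ck_on.simps(1) by blast

lemma continuous_vanish_bounded:
  fixes \<psi> :: "'a::real_normed_vector \<Rightarrow> real"
  assumes "continuous_on UNIV \<psi>" "compact K" "\<And>x. x \<notin> K \<Longrightarrow> \<psi> x = 0"
  obtains B where "\<And>x. \<bar>\<psi> x\<bar> \<le> B"
proof -
  have "compact (\<psi> ` K)" using assms compact_continuous_image continuous_on_subset by blast
  then obtain B where "\<And>y. y \<in> \<psi> ` K \<Longrightarrow> norm y \<le> B" 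
    using compact_imp_bounded bounded_iff by metis
  then have "\<bar>\<psi> x\<bar> \<le> max B 0" for x using assms(3)[of x] by (cases "x \<in> K") (auto simp: le_max_iff_disj)
  then show ?thesis using that by blast
qed

text \<open>Bumps pass the hypothesis to boxes whose closure lies in U. Cutting F off outside such a
  box gives a function whose integral over every box vanishes, because boxes intersect in boxes;
  countably many closed boxes then cover U.\<close>

lemma fundamental_lemma_variations:
  fixes F :: "real^'n::finite \<Rightarrow> real"
  assumes F: "integrable lborel F" and U: "open U"
    and t: "\<And>\<phi>. test_fun U \<phi> \<Longrightarrow> (\<integral>x. \<phi> x * F x \<partial>lborel) = 0"
  shows "AE x in lborel. x \<in> U \<longrightarrow> F x = 0"
proof -
  have meas: "F \<in> borel_measurable borel" using F by auto
  have box0: "(\<integral>x. indicator (box a b) x * F x \<partial>lborel) = 0" if "cbox a b \<subseteq> U" for a b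
  proof -
    have "(\<lambda>n. \<integral>x. box_bump a b n x * F x \<partial>lborel) \<longlonglongrightarrow> (\<integral>x. indicator (box a b) x * F x \<partial>lborel)"
    proof (rule integral_dominated_convergence[where w="\<lambda>x. \<bar>F x\<bar>"])
      show "AE x in lborel. (\<lambda>n. box_bump a b n x * F x) \<longlonglongrightarrow> indicator (box a b) x * F x"
        by (intro AE_I2 tendsto_mult box_bump_tendsto tendsto_const)
      have "box_bump a b n \<in> borel_measurable borel" for n
        using test_fun_continuous[OF test_fun_box_bump[OF that]] by (rule borel_measurable_continuous_onI)
      then show "(\<lambda>x. box_bump a b n x * F x) \<in> borel_measurable lborel" for n using meas by simp
      show "AE x in lborel. norm (box_bump a b n x * F x) \<le> \<bar>F x\<bar>" for n
        using box_bump_bounds[of a b n] by (auto simp: abs_mult intro!: AE_I2 mult_left_le_one_le)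
    qed (use F meas in auto)
    then show ?thesis using t[OF test_fun_box_bump[OF that]] by (simp add: LIMSEQ_const_iff)
  qed
  have "AE x in lborel. x \<in> cbox a b \<longrightarrow> F x = 0" if "cbox a b \<subseteq> U" for a b
  proof -
    have "AE x in lborel. indicator (box a b) x * F x = 0"
    proof (rule AE_eq_0_if_integral_box_eq_0)
      show "integrable lborel (\<lambda>x. indicator (box a b) x * F x)"
        using F by (intro integrable_mult_bounded[where B=1]) (auto simp: indicator_def)
      fix c d :: "real^'n"
      obtain p q where pq: "box c d \<inter> box a b = box p q" using box_Int_box by blast
      show "(\<integral>x. indicator (box c d) x * (indicator (box a b) x * F x) \<partial>lborel) = 0"
      \<comment> \<open>The closed box is the closure of the open one only if the latter is
        nonempty; otherwise nothing places \<open>cbox p q\<close> inside U.\<close>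
      proof (cases "box p q = {}")
        case True
        then have "(\<lambda>x. indicator (box c d) x * (indicator (box a b) x * F x)) = (\<lambda>x. 0)"
          using pq by (auto simp: indicator_def fun_eq_iff)
        then show ?thesis by (simp only: Bochner_Integration.integral_zero)
      next
        case False
        then have "cbox p q = closure (box p q)" by simp
        also have "\<dots> \<subseteq> cbox a b" unfolding pq[symmetric]
          by (rule closure_minimal) (use box_subset_cbox[of a b] in blast, rule closed_cbox)
        finally have "(\<integral>x. indicator (box p q) x * F x \<partial>lborel) = 0" using box0 that by blast
        moreover have "(\<lambda>x. indicator (box c d) x * (indicator (box a b) x * F x)) = (\<lambda>x. indicator (box p q) x * F x)"
          unfolding pq[symmetric] by (auto simp: indicator_def fun_eq_iff)
        ultimately show ?thesis by (simp only:)
      qed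
    qed
    moreover have "AE x in lborel. x \<notin> cbox a b - box a b"
    proof (rule AE_not_in)
      have "negligible (cbox a b - box a b)" by (rule negligible_frontier_interval)
      then have "cbox a b - box a b \<in> null_sets lebesgue" by (simp add: negligible_iff_null_sets)
      then show "cbox a b - box a b \<in> null_sets lborel" by (simp add: null_sets_completion_iff)
    qed
    ultimately show ?thesis by eventually_elim (auto simp: indicator_def)
  qed
  note cb = this
  obtain D where D: "countable D" "D \<subseteq> Pow U" "\<And>X. X \<in> D \<Longrightarrow> \<exists>a b. X = cbox a b" "\<Union>D = U"
    using open_countable_Union_open_cbox[OF U] by metis
  have "AE x in lborel. \<forall>X\<in>D. x \<in> X \<longrightarrow> F x = 0"
    unfolding AE_ball_countable[OF D(1)]
  proof
    fix X assume "X \<in> D"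
    then obtain a b where "X = cbox a b" "X \<subseteq> U" using D by blast
    then show "AE x in lborel. x \<in> X \<longrightarrow> F x = 0" using cb by simp
  qed
  then show ?thesis by eventually_elim (use D(4) in auto)
qed

section \<open>Continuous weak gradients\<close>

text \<open>The mean over the segment from x to x + v. It maps a derivative along v to a difference,
  preserves smoothness, and its adjoint is the mean over the opposite segment.\<close>

definition seg_avg :: "'a::euclidean_space \<Rightarrow> ('a \<Rightarrow> real) \<Rightarrow> 'a \<Rightarrow> real" where
  "seg_avg v \<phi> x = integral {0..1} (\<lambda>t. \<phi> (x + t *\<^sub>R v))"

lemma seg_avg_continuous:
  assumes "continuous_on UNIV \<phi>"
  shows "continuous_on UNIV (seg_avg v \<phi>)"
proof -
  have "continuous_on (UNIV \<times> cbox (0::real) 1) (\<lambda>(x, t). \<phi> (x + t *\<^sub>R v))"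
    unfolding split_def by (rule continuous_on_compose2[OF assms]) (auto intro!: continuous_intros)
  then show ?thesis
    unfolding seg_avg_def[abs_def] interval_cbox by (rule integral_continuous_on_param)
qed

lemma seg_avg_has_derivative:
  fixes \<phi> :: "'a::euclidean_space \<Rightarrow> real"
  assumes d: "\<And>x. (\<phi> has_derivative \<phi>' x) (at x)"
    and c: "\<And>i. i \<in> Basis \<Longrightarrow> continuous_on UNIV (\<lambda>x. \<phi>' x i)"
  shows "(seg_avg v \<phi> has_derivative (\<lambda>w. seg_avg v (\<lambda>y. \<phi>' y w) x)) (at x)"
proof -
  \<comment> \<open>The Leibniz rule requires a jointly continuous derivative with values in bounded
    linear maps; in finite dimension continuity of its values on the basis suffices.\<close>
  let ?g = "\<lambda>x t. Blinfun (\<phi>' (x + t *\<^sub>R v))"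
  have bl: "blinfun_apply (?g x t) = \<phi>' (x + t *\<^sub>R v)" for x t
    using has_derivative_bounded_linear[OF d] by (rule bounded_linear_Blinfun_apply)
  have comp: "continuous_on (UNIV \<times> cbox (0::real) 1) (\<lambda>(x, t). \<psi> (x + t *\<^sub>R v))"
    if "continuous_on UNIV \<psi>" for \<psi> :: "'a \<Rightarrow> real"
    unfolding split_def by (rule continuous_on_compose2[OF that]) (auto intro!: continuous_intros)
  have contg: "continuous_on (UNIV \<times> cbox (0::real) 1) (\<lambda>(x, t). ?g x t)"
  proof (rule continuous_on_blinfun_componentwise)
    fix i :: 'a assume "i \<in> Basis"
    show "continuous_on (UNIV \<times> cbox (0::real) 1) (\<lambda>z. blinfun_apply (case z of (x, t) \<Rightarrow> ?g x t) i)"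
      using comp[OF c[OF \<open>i \<in> Basis\<close>]] by (simp add: split_def bl)
  qed
  have cont: "continuous_on UNIV \<phi>"
    using d by (meson continuous_at_imp_continuous_on has_derivative_continuous)
  have "((\<lambda>x. integral (cbox 0 1) (\<lambda>t. \<phi> (x + t *\<^sub>R v))) has_derivative
      blinfun_apply (integral (cbox 0 1) (?g x))) (at x within UNIV)"
  proof (rule leibniz_rule[OF _ _ contg])
    show "((\<lambda>x. \<phi> (x + t *\<^sub>R v)) has_derivative blinfun_apply (?g x t)) (at x within UNIV)" for x t
    proof -
      have "((\<lambda>x. x + t *\<^sub>R v) has_derivative (\<lambda>w. w)) (at x)"
        by (auto intro!: derivative_eq_intros)
      from has_derivative_compose[OF this d] show ?thesis by (simp add: bl)
    qed
    show "(\<lambda>t. \<phi> (x + t *\<^sub>R v)) integrable_on cbox 0 1" for x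
      by (intro integrable_continuous continuous_on_compose2[OF cont]) (auto intro!: continuous_intros)
  qed auto
  moreover have "blinfun_apply (integral (cbox 0 1) (?g x)) w = integral (cbox 0 1) (\<lambda>t. \<phi>' (x + t *\<^sub>R v) w)" for w
  proof -
    have "continuous_on (cbox 0 1) (Pair x)" by (intro continuous_intros)
    from continuous_on_compose2[OF contg this] have "continuous_on (cbox 0 1) (?g x)" by fastforce
    then show ?thesis
      by (subst blinfun_apply_integral) (auto intro: integrable_continuous simp only: bl)
  qed
  then have "blinfun_apply (integral (cbox 0 1) (?g x)) = (\<lambda>w. integral (cbox 0 1) (\<lambda>t. \<phi>' (x + t *\<^sub>R v) w))"
    by (rule ext)
  ultimately show ?thesis unfolding seg_avg_def[abs_def] interval_cbox by simp
qed

lemma Ck_on_seg_avg: "Ck_on n UNIV \<phi> \<Longrightarrow> Ck_on n UNIV (seg_avg v \<phi>)"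
proof (induction n arbitrary: \<phi>)
  case 0 then show ?case using seg_avg_continuous by simp
next
  case (Suc n)
  obtain \<phi>' where "\<And>x. (\<phi> has_derivative \<phi>' x) (at x)" "\<And>i. i \<in> Basis \<Longrightarrow> Ck_on n UNIV (\<lambda>x. \<phi>' x i)"
    using Suc.prems by (rule Ck_on_SucE) blast
  then show ?case using Suc.IH
    by (intro Ck_on_SucI[where f'="\<lambda>x w. seg_avg v (\<lambda>y. \<phi>' y w) x"] seg_avg_has_derivative)
      (auto intro: Ck_on_continuous)
qed

lemma seg_avg_derivative_along:
  fixes \<phi> :: "'a::euclidean_space \<Rightarrow> real"
  assumes "\<And>x. (\<phi> has_derivative \<phi>' x) (at x)"
  shows "seg_avg v (\<lambda>y. \<phi>' y v) x = \<phi> (x + v) - \<phi> x"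
proof -
  have "((\<lambda>t. \<phi>' (x + t *\<^sub>R v) v) has_integral (\<phi> (x + 1 *\<^sub>R v) - \<phi> (x + 0 *\<^sub>R v))) {0..1}"
  proof (rule fundamental_theorem_of_calculus)
    fix t :: real
    have "((\<lambda>t. x + t *\<^sub>R v) has_derivative (\<lambda>h. h *\<^sub>R v)) (at t within {0..1})"
      by (auto intro!: derivative_eq_intros)
    from has_derivative_compose[OF this assms]
    have "((\<lambda>t. \<phi> (x + t *\<^sub>R v)) has_derivative (\<lambda>h. \<phi>' (x + t *\<^sub>R v) (h *\<^sub>R v))) (at t within {0..1})" .
    then show "((\<lambda>t. \<phi> (x + t *\<^sub>R v)) has_vector_derivative \<phi>' (x + t *\<^sub>R v) v) (at t within {0..1})"
      unfolding has_vector_derivative_def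
      using linear_cmul[OF has_derivative_linear[OF assms]] by simp
  qed simp
  then show ?thesis unfolding seg_avg_def by (simp add: integral_unique)
qed

lemma has_derivative_basis_sum:
  fixes f' :: "real^'n::finite \<Rightarrow> real"
  assumes "linear f'"
  shows "f' v = (\<Sum>i\<in>UNIV. v $ i * f' (axis i 1))"
proof -
  have "f' v = f' (\<Sum>i\<in>UNIV. v $ i *\<^sub>R axis i 1)"
    using basis_expansion[of v] by (simp add: scalar_mult_eq_scaleR)
  then show ?thesis using assms by (simp add: linear_sum linear_cmul)
qed

lemma test_fun_derivative:
  fixes \<phi> :: "real^'n::finite \<Rightarrow> real"
  assumes "test_fun U \<phi>"
  shows "(\<phi> has_derivative frechet_derivative \<phi> (at x)) (at x)"
    and "continuous_on UNIV (\<lambda>x. frechet_derivative \<phi> (at x) v)"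
    and "x \<notin> closure {x. \<phi> x \<noteq> 0} \<Longrightarrow> frechet_derivative \<phi> (at x) v = 0"
proof -
  have "Ck_on (Suc 0) UNIV \<phi>" using assms unfolding test_fun_def Cinf_on_def by blast
  then obtain \<phi>' where p: "\<And>x. (\<phi> has_derivative \<phi>' x) (at x)" "\<And>i. i \<in> Basis \<Longrightarrow> Ck_on 0 UNIV (\<lambda>x. \<phi>' x i)"
    by (rule Ck_on_SucE) blast
  have e: "frechet_derivative \<phi> (at x) = \<phi>' x" for x using frechet_derivative_at[OF p(1)] by simp
  show 1: "(\<phi> has_derivative frechet_derivative \<phi> (at x)) (at x)" for x using p e by simp
  have "axis i (1::real) \<in> Basis" for i :: 'n by (auto simp: Basis_vec_def)
  then have c: "continuous_on UNIV (\<lambda>x. \<phi>' x (axis i 1))" for i using p(2) by simp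
  have "(\<lambda>x. \<phi>' x v) = (\<lambda>x. \<Sum>i\<in>UNIV. v $ i * \<phi>' x (axis i 1))"
    using has_derivative_basis_sum[OF has_derivative_linear[OF p(1)]] by (rule ext)
  then show "continuous_on UNIV (\<lambda>x. frechet_derivative \<phi> (at x) v)"
    unfolding e by (simp only:) (intro continuous_intros c)
  show "frechet_derivative \<phi> (at x) v = 0" if "x \<notin> closure {x. \<phi> x \<noteq> 0}"
  proof -
    have "(\<phi> has_derivative (\<lambda>_. 0)) (at x)"
    proof (rule has_derivative_transform_within_open[where f="\<lambda>_. 0"])
      show "open (- closure {x. \<phi> x \<noteq> 0})" by (rule open_Compl[OF closed_closure])
      show "x \<in> - closure {x. \<phi> x \<noteq> 0}" using that by simp
      fix y assume "y \<in> - closure {x. \<phi> x \<noteq> 0}"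
      then have "y \<notin> {x. \<phi> x \<noteq> 0}" using closure_subset[of "{x. \<phi> x \<noteq> 0}"] by blast
      then show "0 = \<phi> y" by simp
    qed (rule has_derivative_const)
    from fun_cong[OF frechet_derivative_at[OF this], of v] show ?thesis by (rule sym)
  qed
qed

text \<open>A segment of length at most \<open>\<rho>\<close> carries the support from the ball of
  radius \<open>\<rho>\<close> into the closed ball of radius 2 \<open>\<rho>\<close>; the radius 3
  \<open>\<rho>\<close> is an open ball with room for it.\<close>

lemma test_fun_seg_avg:
  fixes \<phi> :: "real^'n::finite \<Rightarrow> real"
  assumes t: "test_fun (ball x0 \<rho>) \<phi>" and v: "norm v \<le> \<rho>"
  shows "test_fun (ball x0 (3 * \<rho>)) (seg_avg v \<phi>)"
proof (cases "\<rho> > 0")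
  case False
  then have "ball x0 \<rho> = {}" by simp
  then have "\<phi> x = 0" for x using t closure_subset[of "{x. \<phi> x \<noteq> 0}"] unfolding test_fun_def by blast
  then have "seg_avg v \<phi> = (\<lambda>x. 0)" by (auto simp: seg_avg_def)
  then show ?thesis unfolding test_fun_def Cinf_on_def by (simp add: Ck_on_const)
next
  case True
  have z: "\<phi> y = 0" if "y \<notin> ball x0 \<rho>" for y
    using t closure_subset[of "{x. \<phi> x \<noteq> 0}"] that unfolding test_fun_def by auto
  have "x \<in> cball x0 (2 * \<rho>)" if "seg_avg v \<phi> x \<noteq> 0" for x
  proof (rule ccontr)
    assume n: "x \<notin> cball x0 (2 * \<rho>)"
    have "\<phi> (x + t *\<^sub>R v) = 0" if "t \<in> {0..1}" for t
    proof (rule z)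
      have "norm (t *\<^sub>R v) \<le> norm v" using that by (simp add: mult_left_le_one_le)
      moreover have "dist x0 x \<le> dist x0 (x + t *\<^sub>R v) + norm (t *\<^sub>R v)"
        using dist_triangle[of x0 x "x + t *\<^sub>R v"] by (simp add: dist_norm)
      ultimately show "x + t *\<^sub>R v \<notin> ball x0 \<rho>" using n v by simp
    qed
    then have "seg_avg v \<phi> x = integral {0..1} (\<lambda>t::real. 0)"
      unfolding seg_avg_def by (intro integral_cong) auto
    with that show False by simp
  qed
  then have s: "closure {x. seg_avg v \<phi> x \<noteq> 0} \<subseteq> cball x0 (2 * \<rho>)"
    by (intro closure_minimal) auto
  then have "compact (closure {x. seg_avg v \<phi> x \<noteq> 0})"
    by (meson bounded_cball bounded_subset closed_closure compact_eq_bounded_closed)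
  moreover have "cball x0 (2 * \<rho>) \<subseteq> ball x0 (3 * \<rho>)" using True by auto
  moreover have "Cinf_on UNIV (seg_avg v \<phi>)"
    using t Ck_on_seg_avg unfolding test_fun_def Cinf_on_def by blast
  ultimately show ?thesis using s unfolding test_fun_def by blast
qed

section \<open>Fubini and translation invariance for segment averages\<close>

lemma integrable_unit_interval_compact:
  fixes k :: "'a::euclidean_space \<times> real \<Rightarrow> real"
  assumes c: "continuous_on UNIV k" and S: "compact S"
    and z: "\<And>x t. t \<in> {0..1} \<Longrightarrow> x \<notin> S \<Longrightarrow> k (x, t) = 0"
  shows "integrable (lborel \<Otimes>\<^sub>M lborel) (\<lambda>(x, t). indicator {0..1} t * k (x, t))"
proof -
  have "integrable lborel (\<lambda>z. indicator (S \<times> {0..1}) z *\<^sub>R k z)"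
    using S c by (intro borel_integrable_compact compact_Times continuous_on_subset[OF c]) auto
  moreover have "(\<lambda>z. indicator (S \<times> {0..1}) z *\<^sub>R k z) = (\<lambda>(x, t). indicator {0..1} t * k (x, t))"
    using z by (auto simp: indicator_def fun_eq_iff)
  ultimately show ?thesis by (simp only: lborel_prod)
qed

lemma seg_avg_eq_lebesgue:
  assumes "continuous_on UNIV \<phi>"
  shows "seg_avg v \<phi> x = (\<integral>t. indicator {0..1} t * \<phi> (x + t *\<^sub>R v) \<partial>lborel)"
proof -
  have "set_integrable lborel {0..1} (\<lambda>t. \<phi> (x + t *\<^sub>R v))"
    unfolding set_integrable_def
    by (intro borel_integrable_compact continuous_on_compose2[OF assms]) (auto intro!: continuous_intros)
  from set_borel_integral_eq_integral(2)[OF this] show ?thesis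
    unfolding seg_avg_def set_lebesgue_integral_def by simp
qed

lemma lborel_integral_translate:
  fixes F :: "'a::euclidean_space \<Rightarrow> real"
  assumes "F \<in> borel_measurable borel"
  shows "(\<integral>x. F (x + c) \<partial>lborel) = (\<integral>x. F x \<partial>lborel)"
proof -
  have "(\<integral>x. F x \<partial>lborel) = (\<integral>x. F x \<partial>distr lborel borel ((+) c))"
    by (simp add: lborel_distr_plus)
  also have "\<dots> = (\<integral>x. F (c + x) \<partial>lborel)"
    by (rule integral_distr) (use assms in auto)
  finally show ?thesis by (simp add: add.commute)
qed

lemma lborel_integrable_translate:
  fixes F :: "'a::euclidean_space \<Rightarrow> real"
  assumes "integrable lborel F"
  shows "integrable lborel (\<lambda>x. F (x + c))"
proof -
  have "integrable (distr lborel borel ((+) c)) F" using assms by (simp add: lborel_distr_plus)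
  then have "integrable lborel (\<lambda>x. F (c + x))"
    by (subst (asm) integrable_distr_eq) (use assms in auto)
  then show ?thesis by (simp add: add.commute)
qed

lemma AE_lborel_translate:
  fixes P :: "'a::euclidean_space \<Rightarrow> bool"
  assumes "AE x in lborel. P x"
  shows "AE x in lborel. P (x + c)"
proof -
  obtain N where N: "N \<in> null_sets lborel" "{x. \<not> P x} \<subseteq> N"
    using assms by (auto simp: eventually_ae_filter)
  have meas: "(+) c -` N \<inter> space lborel \<in> sets lborel"
    using N by (intro measurable_sets[of _ lborel borel]) auto
  have "emeasure (distr lborel borel ((+) c)) N = 0" using N by (auto simp: lborel_distr_plus null_sets_def)
  then have "emeasure lborel ((+) c -` N) = 0" using N by (subst (asm) emeasure_distr) auto
  then have "(+) c -` N \<in> null_sets lborel" using meas by (auto simp: null_sets_def)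
  then show ?thesis by (rule AE_I') (use N in \<open>auto simp: add.commute\<close>)
qed

text \<open>For each t translation invariance moves the shift from \<phi> to g, and Fubini
  integrates this over t. Compact support of \<phi> supplies the joint integrability, g being merely
  continuous.\<close>

lemma seg_avg_transpose:
  fixes \<phi> g :: "'a::euclidean_space \<Rightarrow> real"
  assumes \<phi>: "continuous_on UNIV \<phi>" and g: "continuous_on UNIV g"
    and K: "compact K" "\<And>x. x \<notin> K \<Longrightarrow> \<phi> x = 0"
  shows "(\<integral>x. seg_avg (- v) \<phi> x * g x \<partial>lborel) = (\<integral>x. \<phi> x * seg_avg v g x \<partial>lborel)"
proof -
  obtain R where R: "\<And>x::'a. x \<in> K \<Longrightarrow> norm x \<le> R"
    using compact_imp_bounded[OF K(1)] unfolding bounded_iff by blast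
  let ?k = "\<lambda>(x::'a, t::real). \<phi> (x - t *\<^sub>R v) * g x" and ?l = "\<lambda>(x::'a, t::real). \<phi> x * g (x + t *\<^sub>R v)"
  have ik: "integrable (lborel \<Otimes>\<^sub>M lborel) (\<lambda>(x, t). indicator {0..1} t * ?k (x, t))"
  proof (rule integrable_unit_interval_compact)
    show "continuous_on UNIV ?k"
      unfolding split_def
      by (intro continuous_on_mult continuous_on_compose2[OF \<phi>] continuous_on_compose2[OF g])
        (auto intro!: continuous_intros)
    \<comment> \<open>If x - t v lies in K, then x has norm at most R + |v|.\<close>
    show "compact (cball (0::'a) (R + norm v))" by simp
    fix x :: 'a and t assume t: "t \<in> {0..1::real}" and x: "x \<notin> cball 0 (R + norm v)"
    have "norm (t *\<^sub>R v) \<le> norm v" using t by (simp add: mult_left_le_one_le)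
    moreover have "norm x \<le> norm (x - t *\<^sub>R v) + norm (t *\<^sub>R v)" by (metis diff_add_cancel norm_triangle_ineq)
    ultimately have "x - t *\<^sub>R v \<notin> K" using x R[of "x - t *\<^sub>R v"] by auto
    then show "?k (x, t) = 0" using K(2) by simp
  qed
  have il: "integrable (lborel \<Otimes>\<^sub>M lborel) (\<lambda>(x, t). indicator {0..1} t * ?l (x, t))"
  proof (rule integrable_unit_interval_compact[OF _ K(1)])
    show "continuous_on UNIV ?l"
      unfolding split_def
      by (intro continuous_on_mult continuous_on_compose2[OF \<phi>] continuous_on_compose2[OF g])
        (auto intro!: continuous_intros)
  qed (use K(2) in auto)
  have shift: "(\<integral>x. \<phi> (x - t *\<^sub>R v) * g x \<partial>lborel) = (\<integral>x. \<phi> x * g (x + t *\<^sub>R v) \<partial>lborel)" for t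
  proof -
    have "(\<lambda>x. \<phi> x * g (x + t *\<^sub>R v)) \<in> borel_measurable borel"
      by (intro borel_measurable_continuous_onI continuous_on_mult \<phi> continuous_on_compose2[OF g])
        (auto intro!: continuous_intros)
    from lborel_integral_translate[OF this, of "- (t *\<^sub>R v)"] show ?thesis by simp
  qed
  have "(\<integral>x. seg_avg (- v) \<phi> x * g x \<partial>lborel)
      = (\<integral>x. (\<integral>t. indicator {0..1} t * (\<phi> (x - t *\<^sub>R v) * g x) \<partial>lborel) \<partial>lborel)"
    unfolding seg_avg_eq_lebesgue[OF \<phi>] by (simp add: mult.assoc flip: integral_mult_left_zero)
  also have "\<dots> = (\<integral>t. (\<integral>x. indicator {0..1} t * (\<phi> (x - t *\<^sub>R v) * g x) \<partial>lborel) \<partial>lborel)"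
    using lborel_pair.Fubini_integral[of "\<lambda>x t. indicator {0..1} t * (\<phi> (x - t *\<^sub>R v) * g x)"] ik by simp
  also have "\<dots> = (\<integral>t. (\<integral>x. indicator {0..1} t * (\<phi> x * g (x + t *\<^sub>R v)) \<partial>lborel) \<partial>lborel)"
    by (simp add: shift)
  also have "\<dots> = (\<integral>x. (\<integral>t. indicator {0..1} t * (\<phi> x * g (x + t *\<^sub>R v)) \<partial>lborel) \<partial>lborel)"
    using lborel_pair.Fubini_integral[of "\<lambda>x t. indicator {0..1} t * (\<phi> x * g (x + t *\<^sub>R v))"] il by simp
  also have "\<dots> = (\<integral>x. \<phi> x * seg_avg v g x \<partial>lborel)"
    unfolding seg_avg_eq_lebesgue[OF g] by (simp add: mult.left_commute flip: integral_mult_right_zero)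
  finally show ?thesis .
qed

text \<open>The weak equation is tested with \<open>\<psi>\<close>, the mean of \<phi> in direction
  -v, whose derivative along v is \<phi>(x) - \<phi>(x - v). Translating on the left and transposing
  the mean on the right leaves an identity against \<phi> alone, to which the fundamental lemma
  applies. The support of \<open>\<psi>\<close> is the reason for the radius 3 \<open>\<rho>\<close>
  in the hypothesis.\<close>

lemma weak_gradient_difference:
  fixes f :: "real^'n::finite \<Rightarrow> real" and G :: "'n \<Rightarrow> real^'n \<Rightarrow> real"
  assumes f: "integrable lborel f" and G: "\<And>i. continuous_on UNIV (G i)"
    and weak: "\<And>\<phi> i. test_fun (ball x0 (3 * \<rho>)) \<phi> \<Longrightarrow>
        (\<integral>x. frechet_derivative \<phi> (at x) (axis i 1) * f x \<partial>lborel) = - (\<integral>x. \<phi> x * G i x \<partial>lborel)"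
    and v: "norm v \<le> \<rho>"
  shows "AE x in lborel. x \<in> ball x0 \<rho> \<longrightarrow> f (x + v) - f x = seg_avg v (\<lambda>y. \<Sum>i\<in>UNIV. v $ i * G i y) x"
proof -
  let ?g = "\<lambda>y. \<Sum>i\<in>UNIV. v $ i * G i y"
  \<comment> \<open>The cut-off makes the mean integrable over the whole space and is invisible to
    test functions supported in the ball.\<close>
  let ?H = "\<lambda>x. indicator (cball x0 \<rho>) x * seg_avg v ?g x"
  have g: "continuous_on UNIV ?g" by (intro continuous_intros G)
  have fm: "f \<in> borel_measurable borel" using f by auto
  have iH: "integrable lborel ?H"
    using borel_integrable_compact[OF compact_cball continuous_on_subset[OF seg_avg_continuous[OF g]]] by simp
  have iF: "integrable lborel (\<lambda>x. f (x + v) - f x - ?H x)"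
    using f iH lborel_integrable_translate by (intro Bochner_Integration.integrable_diff) auto
  have "AE x in lborel. x \<in> ball x0 \<rho> \<longrightarrow> f (x + v) - f x - ?H x = 0"
  proof (rule fundamental_lemma_variations[OF iF open_ball])
    fix \<phi> assume t: "test_fun (ball x0 \<rho>) \<phi>"
    define \<psi> where "\<psi> = seg_avg (- v) \<phi>"
    define K where "K = closure {x. \<phi> x \<noteq> 0}"
    have K: "compact K" "\<And>x. x \<notin> K \<Longrightarrow> \<phi> x = 0" "K \<subseteq> ball x0 \<rho>"
      using t closure_subset[of "{x. \<phi> x \<noteq> 0}"] unfolding K_def test_fun_def by auto
    have \<phi>c: "continuous_on UNIV \<phi>" using t by (rule test_fun_continuous)
    then have \<phi>m: "\<phi> \<in> borel_measurable borel" by (rule borel_measurable_continuous_onI)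
    obtain B where B: "\<And>x. \<bar>\<phi> x\<bar> \<le> B" using continuous_vanish_bounded[OF \<phi>c K(1,2)] by blast
    have \<psi>t: "test_fun (ball x0 (3 * \<rho>)) \<psi>" unfolding \<psi>_def using t v by (intro test_fun_seg_avg) auto
    define L where "L = closure {x. \<psi> x \<noteq> 0}"
    have L: "compact L" "\<And>x. x \<notin> L \<Longrightarrow> \<psi> x = 0"
      using \<psi>t closure_subset[of "{x. \<psi> x \<noteq> 0}"] unfolding L_def test_fun_def by auto
    note d\<phi> = test_fun_derivative[OF t] and d\<psi> = test_fun_derivative[OF \<psi>t]
    have "axis i (1::real) \<in> Basis" for i :: 'n by (auto simp: Basis_vec_def)
    have "(\<psi> has_derivative (\<lambda>w. seg_avg (- v) (\<lambda>y. frechet_derivative \<phi> (at y) w) x)) (at x)" for x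
      unfolding \<psi>_def by (intro seg_avg_has_derivative d\<phi>)
    then have fd: "frechet_derivative \<psi> (at x) = (\<lambda>w. seg_avg (- v) (\<lambda>y. frechet_derivative \<phi> (at y) w) x)" for x
      by (rule frechet_derivative_at[symmetric])
    have lin: "linear (frechet_derivative \<psi> (at x))" for x by (rule has_derivative_linear[OF d\<psi>(1)])
    have "frechet_derivative \<psi> (at x) (- v) = \<phi> (x - v) - \<phi> x" for x
      unfolding fd using seg_avg_derivative_along[OF d\<phi>(1), of "-v" x] by simp
    then have along: "frechet_derivative \<psi> (at x) v = \<phi> x - \<phi> (x - v)" for x
      using linear_neg[OF lin, of x v] by (metis minus_diff_eq minus_minus)
    have ipart: "integrable lborel (\<lambda>x. frechet_derivative \<psi> (at x) w * f x)" for w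
    proof -
      obtain C where C: "\<And>x. \<bar>frechet_derivative \<psi> (at x) w\<bar> \<le> C"
        using continuous_vanish_bounded[OF d\<psi>(2) L(1)] d\<psi>(3) unfolding L_def by blast
      have "(\<lambda>x. frechet_derivative \<psi> (at x) w) \<in> borel_measurable borel"
        by (rule borel_measurable_continuous_onI[OF d\<psi>(2)])
      then have "(\<lambda>x. frechet_derivative \<psi> (at x) w) \<in> borel_measurable lborel" by simp
      then show ?thesis by (rule integrable_mult_bounded[OF f _ C])
    qed
    have iG: "integrable lborel (\<lambda>x. \<psi> x * G i x)" for i
    proof -
      have "integrable lborel (\<lambda>x. indicator L x *\<^sub>R (\<psi> x * G i x))"
        by (intro borel_integrable_compact L(1) continuous_on_mult
            continuous_on_subset[OF G] continuous_on_subset[OF test_fun_continuous[OF \<psi>t]]) auto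
      moreover have "(\<lambda>x. indicator L x *\<^sub>R (\<psi> x * G i x)) = (\<lambda>x. \<psi> x * G i x)"
        using L(2) by (auto simp: indicator_def fun_eq_iff)
      ultimately show ?thesis by (simp only:)
    qed
    have "(\<phi> x - \<phi> (x - v)) * f x = (\<Sum>i\<in>UNIV. v $ i * (frechet_derivative \<psi> (at x) (axis i 1) * f x))" for x
      unfolding along[symmetric] has_derivative_basis_sum[OF lin[of x], of v] sum_distrib_right mult.assoc ..
    then have "(\<integral>x. (\<phi> x - \<phi> (x - v)) * f x \<partial>lborel)
        = (\<integral>x. (\<Sum>i\<in>UNIV. v $ i * (frechet_derivative \<psi> (at x) (axis i 1) * f x)) \<partial>lborel)"
      by (simp only:)
    also have "\<dots> = (\<Sum>i\<in>UNIV. v $ i * (\<integral>x. frechet_derivative \<psi> (at x) (axis i 1) * f x \<partial>lborel))"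
      by (subst Bochner_Integration.integral_sum) (auto intro: ipart)
    also have "\<dots> = - (\<Sum>i\<in>UNIV. v $ i * (\<integral>x. \<psi> x * G i x \<partial>lborel))"
      by (simp add: weak[OF \<psi>t] sum_negf)
    also have "(\<Sum>i\<in>UNIV. v $ i * (\<integral>x. \<psi> x * G i x \<partial>lborel)) = (\<integral>x. (\<Sum>i\<in>UNIV. v $ i * (\<psi> x * G i x)) \<partial>lborel)"
      by (subst Bochner_Integration.integral_sum) (auto intro: iG)
    also have "\<dots> = (\<integral>x. \<psi> x * ?g x \<partial>lborel)" by (simp add: sum_distrib_left mult.left_commute)
    also have "\<dots> = (\<integral>x. \<phi> x * seg_avg v ?g x \<partial>lborel)"
      unfolding \<psi>_def by (rule seg_avg_transpose[OF \<phi>c g K(1,2)])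
    also have "(\<lambda>x. \<phi> x * seg_avg v ?g x) = (\<lambda>x. \<phi> x * ?H x)"
      using K(2,3) by (force simp: indicator_def fun_eq_iff)
    finally have main: "(\<integral>x. (\<phi> x - \<phi> (x - v)) * f x \<partial>lborel) = - (\<integral>x. \<phi> x * ?H x \<partial>lborel)" .
    have if1: "integrable lborel (\<lambda>x. \<phi> x * f x)" by (rule integrable_mult_bounded[OF f _ B]) (use \<phi>m in simp)
    have if2: "integrable lborel (\<lambda>x. \<phi> x * f (x + v))"
      by (rule integrable_mult_bounded[OF lborel_integrable_translate[OF f] _ B]) (use \<phi>m in simp)
    have if3: "integrable lborel (\<lambda>x. \<phi> (x - v) * f x)"
      by (rule integrable_mult_bounded[OF f _ B]) (use \<phi>m in simp)
    have if4: "integrable lborel (\<lambda>x. \<phi> x * ?H x)" by (rule integrable_mult_bounded[OF iH _ B]) (use \<phi>m in simp)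
    have "(\<lambda>x. \<phi> x * f (x + v)) \<in> borel_measurable borel" using \<phi>m fm by measurable
    from lborel_integral_translate[OF this, of "- v"]
    have tr: "(\<integral>x. \<phi> (x - v) * f x \<partial>lborel) = (\<integral>x. \<phi> x * f (x + v) \<partial>lborel)" by simp
    have "(\<integral>x. (\<phi> x - \<phi> (x - v)) * f x \<partial>lborel) = (\<integral>x. \<phi> x * f x \<partial>lborel) - (\<integral>x. \<phi> (x - v) * f x \<partial>lborel)"
      unfolding left_diff_distrib by (rule Bochner_Integration.integral_diff[OF if1 if3])
    with main tr have "(\<integral>x. \<phi> x * f (x + v) \<partial>lborel) - (\<integral>x. \<phi> x * f x \<partial>lborel) - (\<integral>x. \<phi> x * ?H x \<partial>lborel) = 0"
      by simp
    then show "(\<integral>x. \<phi> x * (f (x + v) - f x - ?H x) \<partial>lborel) = 0"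
      unfolding right_diff_distrib
      by (simp only: Bochner_Integration.integral_diff[OF Bochner_Integration.integrable_diff[OF if2 if1] if4]
          Bochner_Integration.integral_diff[OF if2 if1])
  qed
  then show ?thesis by eventually_elim (auto simp: indicator_def)
qed

section \<open>From almost everywhere to everywhere, and the continuously differentiable
  representative\<close>

lemma AE_lborel_eq_0_continuous:
  fixes F :: "'a::euclidean_space \<Rightarrow> real"
  assumes U: "open U" and c: "continuous_on U F" and ae: "AE x in lebesgue. x \<in> U \<longrightarrow> F x = 0" and x: "x \<in> U"
  shows "F x = 0"
proof (rule ccontr)
  assume n: "F x \<noteq> 0"
  let ?S = "U \<inter> F -` (- {0})"
  have "open ?S" using c U by (intro continuous_open_preimage) auto
  moreover have "?S \<noteq> {}" using n x by auto
  moreover have "negligible ?S"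
  proof -
    obtain N where "N \<in> null_sets lebesgue" "{x. \<not> (x \<in> U \<longrightarrow> F x = 0)} \<subseteq> N"
      using ae by (auto simp: eventually_ae_filter)
    then show ?thesis using negligible_subset[of N ?S] by (auto simp: negligible_iff_null_sets)
  qed
  ultimately show False using open_not_negligible by blast
qed

lemma AE_in_open_ex:
  fixes P :: "'a::euclidean_space \<Rightarrow> bool"
  assumes "open U" "U \<noteq> {}" "AE x in lebesgue. x \<in> U \<longrightarrow> P x"
  shows "\<exists>x\<in>U. P x"
proof (rule ccontr)
  assume n: "\<not> (\<exists>x\<in>U. P x)"
  then have "AE x in lebesgue. x \<in> U \<longrightarrow> (1::real) = 0" using assms(3) by auto
  then show False using AE_lborel_eq_0_continuous[of U "\<lambda>_. 1"] assms by auto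
qed

text \<open>For each v the difference formula fails on a null set of x that depends on v. Fubini
  yields one base point x at which it holds for almost every v, and h is the primitive of G along
  the segments issuing from x. By continuity the formula for h holds for all pairs of points in the
  half-radius ball, and continuity of G turns it into differentiability.\<close>

lemma weak_gradient_C1_ball:
  fixes f :: "real^'n::finite \<Rightarrow> real" and G :: "'n \<Rightarrow> real^'n \<Rightarrow> real"
  assumes f: "integrable lborel f" and G: "\<And>i. continuous_on UNIV (G i)"
    and weak: "\<And>\<phi> i. test_fun (ball x0 (3 * \<rho>)) \<phi> \<Longrightarrow>
        (\<integral>x. frechet_derivative \<phi> (at x) (axis i 1) * f x \<partial>lborel) = - (\<integral>x. \<phi> x * G i x \<partial>lborel)"
    and \<rho>: "\<rho> > 0"
  obtains h where "\<And>y. y \<in> ball x0 (\<rho> / 2) \<Longrightarrow> (h has_derivative (\<lambda>v. \<Sum>i\<in>UNIV. v $ i * G i y)) (at y)"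
    and "AE y in lborel. y \<in> ball x0 (\<rho> / 2) \<longrightarrow> f y = h y"
proof -
  define H where "H v x = seg_avg v (\<lambda>y. \<Sum>i\<in>UNIV. v $ i * G i y) x" for v x
  define D where "D = ball x0 (\<rho> / 2)"
  have "open D" "D \<noteq> {}" unfolding D_def using \<rho> by auto
  have fm[measurable]: "f \<in> borel_measurable borel" using f by auto
  \<comment> \<open>Joint continuity in v and x serves twice: for the measurability that Fubini
    requires and for the continuity of h.\<close>
  have Hc: "continuous_on UNIV (\<lambda>z. H (fst z) (snd z))"
  proof -
    have "continuous_on (UNIV \<times> cbox (0::real) 1) (\<lambda>(z, t). \<Sum>i\<in>UNIV. fst z $ i * G i (snd z + t *\<^sub>R fst z))"
      unfolding split_def
      by (intro continuous_intros continuous_on_compose2[OF G]) auto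
    from integral_continuous_on_param[OF this] show ?thesis
      unfolding H_def seg_avg_def interval_cbox .
  qed
  have Hc2: "continuous_on S (\<lambda>x. H (a x) (b x))" if "continuous_on S a" "continuous_on S b"
    for S :: "(real^'n) set" and a b
    using continuous_on_compose2[OF Hc continuous_on_Pair[OF that]] by simp
  have AE_vx: "AE v in lborel. AE x in lborel. norm v \<le> \<rho> \<longrightarrow> x \<in> ball x0 \<rho> \<longrightarrow> f (x + v) - f x = H v x"
  proof (rule AE_I2)
    fix v :: "real^'n"
    show "AE x in lborel. norm v \<le> \<rho> \<longrightarrow> x \<in> ball x0 \<rho> \<longrightarrow> f (x + v) - f x = H v x"
    proof (cases "norm v \<le> \<rho>")
      case True
      show ?thesis using weak_gradient_difference[OF f G weak True] unfolding H_def by simp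
    qed simp
  qed
  have Hm[measurable]: "(\<lambda>z. H (fst z) (snd z)) \<in> borel_measurable (borel \<Otimes>\<^sub>M borel)"
    unfolding borel_prod by (rule borel_measurable_continuous_onI[OF Hc])
  have "AE x in lborel. AE v in lborel. norm v \<le> \<rho> \<longrightarrow> x \<in> ball x0 \<rho> \<longrightarrow> f (x + v) - f x = H v x"
    by (subst lborel_pair.AE_commute[symmetric]) (use AE_vx in \<open>measurable, auto\<close>)
  then have "AE x in lebesgue. x \<in> D \<longrightarrow> (AE v in lborel. norm v \<le> \<rho> \<longrightarrow> x \<in> ball x0 \<rho> \<longrightarrow> f (x + v) - f x = H v x)"
    by (intro AE_completion) auto
  then have "\<exists>x\<in>D. AE v in lborel. norm v \<le> \<rho> \<longrightarrow> x \<in> ball x0 \<rho> \<longrightarrow> f (x + v) - f x = H v x"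
    by (rule AE_in_open_ex[OF \<open>open D\<close> \<open>D \<noteq> {}\<close>])
  then obtain x where xD: "x \<in> D"
    and x: "AE v in lborel. norm v \<le> \<rho> \<longrightarrow> x \<in> ball x0 \<rho> \<longrightarrow> f (x + v) - f x = H v x"
    by blast
  define h where "h y = f x + H (y - x) x" for y
  \<comment> \<open>Half the radius is chosen so that any two points of D differ by a vector
    admissible in the difference formula.\<close>
  have near: "norm (y - x) \<le> \<rho>" if "y \<in> D" for y
    using that xD dist_triangle[of y x x0] unfolding D_def by (simp add: dist_norm norm_minus_commute)
  have "x \<in> ball x0 \<rho>" using xD \<rho> unfolding D_def by auto
  then have "AE y in lborel. norm (y - x) \<le> \<rho> \<longrightarrow> f y - f x = H (y - x) x"
    using AE_lborel_translate[OF x, of "- x"] by simp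
  then have fh: "AE y in lborel. y \<in> D \<longrightarrow> f y = h y"
    by eventually_elim (use near in \<open>auto simp: h_def\<close>)
  have hc: "continuous_on S h" for S unfolding h_def by (intro continuous_intros Hc2)
  \<comment> \<open>For fixed v both sides are continuous in y on the open set where y and y + v lie
    in D, and they agree there almost everywhere.\<close>
  have diff: "h (y + v) - h y = H v y" if "y \<in> D" "y + v \<in> D" for y v
  proof -
    let ?U = "D \<inter> (\<lambda>y. y + v) -` D"
    have nv: "norm v \<le> \<rho>"
      using that dist_triangle[of y "y + v" x0] unfolding D_def by (simp add: dist_norm norm_minus_commute)
    have "open ?U"
      using \<open>open D\<close> by (intro open_Int open_vimage continuous_intros) auto
    moreover have "AE y in lebesgue. y \<in> ?U \<longrightarrow> h (y + v) - h y - H v y = 0"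
    proof (rule AE_completion)
      have "AE y in lborel. y \<in> ball x0 \<rho> \<longrightarrow> f (y + v) - f y = H v y"
        unfolding H_def by (rule weak_gradient_difference[OF f G weak nv])
      then show "AE y in lborel. y \<in> ?U \<longrightarrow> h (y + v) - h y - H v y = 0"
        using fh AE_lborel_translate[OF fh, of v]
      proof eventually_elim
        case (elim y)
        then show ?case using \<rho> unfolding D_def by auto
      qed
    qed
    moreover have "continuous_on ?U (\<lambda>y. h (y + v) - h y - H v y)"
      by (intro continuous_intros Hc2 continuous_on_compose2[OF hc[of UNIV]]) auto
    ultimately have "h (y + v) - h y - H v y = 0"
      using AE_lborel_eq_0_continuous[of ?U "\<lambda>y. h (y + v) - h y - H v y" y] that by auto
    then show ?thesis by simp
  qed
  have "(h has_derivative (\<lambda>v. \<Sum>i\<in>UNIV. v $ i * G i y)) (at y)" if yD: "y \<in> D" for y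
    unfolding has_derivative_at_alt
  proof (intro conjI allI impI)
    show "bounded_linear (\<lambda>v::real^'n. \<Sum>i\<in>UNIV. v $ i * G i y)"
      by (intro bounded_linear_sum bounded_linear_mult_const bounded_linear_vec_nth)
    fix e :: real assume "e > 0"
    \<comment> \<open>Each of the \<open>CARD('n)\<close> components contributes at most e' |v| to
      the remainder.\<close>
    define e' where "e' = e / CARD('n)"
    have "e' > 0" using \<open>e > 0\<close> by (simp add: e'_def)
    have "\<exists>d>0. \<forall>z. dist z y < d \<longrightarrow> dist (G i z) (G i y) < e'" for i
      using G[of i] \<open>e' > 0\<close> unfolding continuous_on_iff by (metis UNIV_I)
    then obtain d where d: "\<And>i. d i > 0" "\<And>i z. dist z y < d i \<Longrightarrow> dist (G i z) (G i y) < e'" by metis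
    obtain d0 where d0: "d0 > 0" "ball y d0 \<subseteq> D" using \<open>open D\<close> yD openE by blast
    define \<delta> where "\<delta> = min d0 (Min (range d))"
    have "\<delta> > 0" using d0 d(1) by (simp add: \<delta>_def)
    moreover have "norm (h z - h y - (\<Sum>i\<in>UNIV. (z - y) $ i * G i y)) \<le> e * norm (z - y)" if z: "norm (z - y) < \<delta>" for z
    proof -
      define v where "v = z - y"
      have "z \<in> D" using z d0 by (auto simp: \<delta>_def dist_norm norm_minus_commute)
      then have hz: "h z - h y = H v y" using diff[of y v] yD by (simp add: v_def)
      let ?q = "\<lambda>t. \<Sum>i\<in>UNIV. v $ i * G i (y + t *\<^sub>R v)"
      have qc: "continuous_on {0..1} ?q" by (intro continuous_intros continuous_on_compose2[OF G]) auto
      have "H v y - (\<Sum>i\<in>UNIV. v $ i * G i y) = integral {0..1} (\<lambda>t. ?q t - (\<Sum>i\<in>UNIV. v $ i * G i y))"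
        unfolding H_def seg_avg_def
        by (subst Henstock_Kurzweil_Integration.integral_diff) (use qc in \<open>auto intro: integrable_continuous_real\<close>)
      also have "norm \<dots> \<le> (e * norm v) * (1 - 0)"
      proof (rule integral_bound)
        show "continuous_on {0..1} (\<lambda>t. ?q t - (\<Sum>i\<in>UNIV. v $ i * G i y))" by (intro continuous_intros qc)
        fix t :: real assume t: "t \<in> {0..1}"
        have "\<bar>v $ i * (G i (y + t *\<^sub>R v) - G i y)\<bar> \<le> norm v * e'" for i
        proof -
          have "norm (t *\<^sub>R v) \<le> norm v" using t by (simp add: mult_left_le_one_le)
          also have "\<dots> < d i" using z by (simp add: v_def \<delta>_def)
          finally have "dist (y + t *\<^sub>R v) y < d i" by (simp add: dist_norm)
          then have "\<bar>G i (y + t *\<^sub>R v) - G i y\<bar> \<le> e'" using d(2) by (fastforce simp: dist_real_def)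
          then show ?thesis unfolding abs_mult by (intro mult_mono component_le_norm_cart) auto
        qed
        then have "(\<Sum>i\<in>UNIV. \<bar>v $ i * (G i (y + t *\<^sub>R v) - G i y)\<bar>) \<le> (\<Sum>i\<in>(UNIV::'n set). norm v * e')"
          by (intro sum_mono)
        also have "\<dots> = e * norm v" by (simp add: e'_def)
        finally show "norm (?q t - (\<Sum>i\<in>UNIV. v $ i * G i y)) \<le> e * norm v"
          using sum_abs[of "\<lambda>i. v $ i * (G i (y + t *\<^sub>R v) - G i y)" UNIV]
          by (simp add: right_diff_distrib sum_subtractf)
      qed simp
      finally show ?thesis unfolding hz[symmetric] by (simp add: v_def)
    qed
    ultimately show "\<exists>d>0. \<forall>z. norm (z - y) < d \<longrightarrow>
        norm (h z - h y - (\<Sum>i\<in>UNIV. (z - y) $ i * G i y)) \<le> e * norm (z - y)" by blast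
  qed
  then show ?thesis using that fh unfolding D_def by blast
qed

section \<open>Locality of smoothness and gluing of representatives\<close>

text \<open>The neighbourhoods come with unrelated witnesses for the derivative.
  \<open>frechet_derivative\<close> is one global choice agreeing with each of them, so the
  induction can continue on its partial derivatives.\<close>

lemma Ck_on_local:
  assumes "\<And>x. x \<in> \<Omega> \<Longrightarrow> \<exists>U. open U \<and> x \<in> U \<and> Ck_on n U f"
  shows "Ck_on n \<Omega> f"
  using assms
proof (induction n arbitrary: f)
  case 0
  have "isCont f x" if "x \<in> \<Omega>" for x
    using 0[OF that] by (auto simp: continuous_on_eq_continuous_at)
  then show ?case by (auto intro: continuous_at_imp_continuous_on)
next
  case (Suc n)
  let ?f' = "\<lambda>x. frechet_derivative f (at x)"
  have loc: "\<exists>U. open U \<and> x \<in> U \<and> (\<forall>y\<in>U. (f has_derivative ?f' y) (at y)) \<and> (\<forall>i\<in>Basis. Ck_on n U (\<lambda>y. ?f' y i))"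
    if x: "x \<in> \<Omega>" for x
  proof -
    obtain U where U: "open U" "x \<in> U" "Ck_on (Suc n) U f" using Suc.prems[OF x] by blast
    obtain f' where f': "\<And>y. y \<in> U \<Longrightarrow> (f has_derivative f' y) (at y)"
      "\<And>i. i \<in> Basis \<Longrightarrow> Ck_on n U (\<lambda>y. f' y i)" using U(3) by (rule Ck_on_SucE) blast
    have e: "f' y = ?f' y" if "y \<in> U" for y using frechet_derivative_at[OF f'(1)[OF that]] .
    have "Ck_on n U (\<lambda>y. ?f' y i)" if "i \<in> Basis" for i
      by (rule Ck_on_cong[OF U(1) _ f'(2)[OF that]]) (simp add: e)
    then show ?thesis using U f'(1) e by (intro exI[of _ U]) simp
  qed
  show ?case
  proof (rule Ck_on_SucI[where f'="?f'"])
    show "(f has_derivative ?f' x) (at x)" if "x \<in> \<Omega>" for x using loc[OF that] by blast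
    show "Ck_on n \<Omega> (\<lambda>x. ?f' x i)" if "i \<in> Basis" for i
      by (rule Suc.IH) (use loc that in blast)
  qed
qed

text \<open>Two local representatives agree almost everywhere on an overlap, hence everywhere there
  by continuity, so evaluating at x the representative chosen for x is consistent. Lindelof's
  theorem leaves countably many exceptional null sets.\<close>

lemma glue_local_representatives:
  fixes f :: "real^'n::finite \<Rightarrow> real^'m::finite"
  assumes \<Omega>: "open \<Omega>" and loc: "\<And>x0. x0 \<in> \<Omega> \<Longrightarrow> \<exists>\<delta> h. \<delta> > 0 \<and> Cinf_on (ball x0 \<delta>) h
      \<and> (AE x in lebesgue. x \<in> ball x0 \<delta> \<longrightarrow> f x = h x)"
  shows "\<exists>h. Cinf_on \<Omega> h \<and> (AE x in lebesgue. x \<in> \<Omega> \<longrightarrow> f x = h x)"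
proof -
  have "\<forall>x0\<in>\<Omega>. \<exists>z. fst z > 0 \<and> Cinf_on (ball x0 (fst z)) (snd z)
      \<and> (AE x in lebesgue. x \<in> ball x0 (fst z) \<longrightarrow> f x = snd z x)"
    using loc by simp
  from bchoice[OF this] obtain z where
    z: "\<forall>x0\<in>\<Omega>. fst (z x0) > 0 \<and> Cinf_on (ball x0 (fst (z x0))) (snd (z x0))
      \<and> (AE x in lebesgue. x \<in> ball x0 (fst (z x0)) \<longrightarrow> f x = snd (z x0) x)" by blast
  define B where "B x0 = ball x0 (fst (z x0))" for x0
  define H where "H x0 = snd (z x0)" for x0
  have B: "open (B x)" "x \<in> \<Omega> \<Longrightarrow> x \<in> B x" for x using z by (auto simp: B_def)
  have H: "Ck_on n (B x) (H x)" "AE y in lebesgue. y \<in> B x \<longrightarrow> f y = H x y" if "x \<in> \<Omega>" for x n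
    using z that by (auto simp: B_def H_def Cinf_on_def)
  define h where "h x = H x x" for x
  have agree: "H x w = H y w" if xy: "x \<in> \<Omega>" "y \<in> \<Omega>" and w: "w \<in> B x" "w \<in> B y" for x y w
  proof -
    have "H x w $ a - H y w $ a = 0" for a
    proof (rule AE_lborel_eq_0_continuous[where U="B x \<inter> B y" and F="\<lambda>w. H x w $ a - H y w $ a"])
      show "open (B x \<inter> B y)" using B by auto
      have "continuous_on (B x \<inter> B y) (H x)" "continuous_on (B x \<inter> B y) (H y)"
        using Ck_on_continuous[OF H(1)] xy by (meson continuous_on_subset inf_le1 inf_le2)+
      then show "continuous_on (B x \<inter> B y) (\<lambda>w. H x w $ a - H y w $ a)" by (intro continuous_intros)
      show "AE w in lebesgue. w \<in> B x \<inter> B y \<longrightarrow> H x w $ a - H y w $ a = 0"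
        using H(2)[OF xy(1)] H(2)[OF xy(2)] by eventually_elim auto
    qed (use w in auto)
    then show ?thesis by (simp add: Finite_Cartesian_Product.vec_eq_iff)
  qed
  have "Ck_on n \<Omega> h" for n
  proof (rule Ck_on_local)
    fix x assume x: "x \<in> \<Omega>"
    have "Ck_on n (B x \<inter> \<Omega>) h"
    proof (rule Ck_on_cong)
      show "open (B x \<inter> \<Omega>)" using B \<Omega> by auto
      show "H x w = h w" if "w \<in> B x \<inter> \<Omega>" for w
        unfolding h_def using agree[of x w w] x that B(2) by simp
      show "Ck_on n (B x \<inter> \<Omega>) (H x)" by (rule Ck_on_subset[OF H(1)[OF x]]) simp
    qed
    then show "\<exists>U. open U \<and> x \<in> U \<and> Ck_on n U h"
      using x B \<Omega> by (intro exI[of _ "B x \<inter> \<Omega>"]) auto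
  qed
  moreover have "AE x in lebesgue. x \<in> \<Omega> \<longrightarrow> f x = h x"
  proof -
    obtain \<F> where F: "\<F> \<subseteq> B ` \<Omega>" "countable \<F>" "\<Union>\<F> = \<Union>(B ` \<Omega>)"
      using Lindelof[of "B ` \<Omega>"] B(1) by blast
    have "AE x in lebesgue. \<forall>X\<in>\<F>. x \<in> X \<longrightarrow> x \<in> \<Omega> \<longrightarrow> f x = h x"
      unfolding AE_ball_countable[OF F(2)]
    proof
      fix X assume "X \<in> \<F>"
      then obtain y where y: "y \<in> \<Omega>" "X = B y" using F(1) by blast
      show "AE x in lebesgue. x \<in> X \<longrightarrow> x \<in> \<Omega> \<longrightarrow> f x = h x"
        using H(2)[OF y(1)]
      proof eventually_elim
        case (elim x)
        then show ?case unfolding h_def using agree[of y x x] y B(2) by auto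
      qed
    qed
    then show ?thesis
    proof eventually_elim
      case (elim x)
      have "x \<in> \<Union>\<F>" if "x \<in> \<Omega>" unfolding F(3) using B(2) that by blast
      then show ?case using elim by blast
    qed
  qed
  ultimately show ?thesis unfolding Cinf_on_def by blast
qed

text \<open>A substitute for Hoelder's inequality: on a compact set the constant 1 is integrable, so
  L^p functions are integrable there.\<close>

lemma abs_le_one_plus_powr:
  fixes y p :: real
  assumes "p \<ge> 1" "y \<ge> 0"
  shows "y \<le> 1 + y powr p"
proof (cases "y \<le> 1")
  case False
  then have "y powr 1 \<le> y powr p" using assms by (intro powr_mono) auto
  then show ?thesis using False by simp
qed (use powr_ge_zero[of y p] in linarith)

lemma Lp_on_integrable_mult:
  fixes F :: "real^'n::finite \<Rightarrow> real^'m::finite"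
  assumes F: "Lp_on p \<Omega> F" and p: "p \<ge> 1" and \<Omega>: "open \<Omega>" and S: "compact S" "S \<subseteq> \<Omega>"
    and \<psi>: "\<psi> \<in> borel_measurable borel" "\<And>x. \<bar>\<psi> x\<bar> \<le> B" "\<And>x. x \<notin> S \<Longrightarrow> \<psi> x = 0"
  shows "integrable (lebesgue_on \<Omega>) (\<lambda>x. \<psi> x *\<^sub>R F x)"
proof (rule Bochner_Integration.integrable_bound)
  have \<Omega>': "\<Omega> \<inter> space lebesgue \<in> sets lebesgue" using \<Omega> by simp
  have B: "B \<ge> 0" using \<psi>(2)[of 0] by linarith
  have "integrable lebesgue (indicator S :: _ \<Rightarrow> real)"
    using lmeasurable_compact[OF S(1)] by (intro integrable_real_indicator) (auto simp: fmeasurable_def)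
  then have "integrable (lebesgue_on \<Omega>) (indicator S :: _ \<Rightarrow> real)"
    using S(2) by (subst integrable_restrict_space[OF \<Omega>'])
      (simp add: indicator_inter_arith[symmetric] Int_absorb1)
  then show "integrable (lebesgue_on \<Omega>) (\<lambda>x. B * (indicator S x + norm (F x) powr p))"
    using F unfolding Lp_on_def by (intro integrable_mult_right Bochner_Integration.integrable_add) auto
  have "\<psi> \<in> borel_measurable (lebesgue_on \<Omega>)"
    using \<psi>(1) by (intro measurable_restrict_space1 measurable_completion) simp
  then show "(\<lambda>x. \<psi> x *\<^sub>R F x) \<in> borel_measurable (lebesgue_on \<Omega>)"
    using F unfolding Lp_on_def by (intro borel_measurable_scaleR) auto
  show "AE x in lebesgue_on \<Omega>. norm (\<psi> x *\<^sub>R F x) \<le> norm (B * (indicator S x + norm (F x) powr p))"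
  proof (rule AE_I2)
    fix x
    show "norm (\<psi> x *\<^sub>R F x) \<le> norm (B * (indicator S x + norm (F x) powr p))"
    proof (cases "x \<in> S")
      case True
      have "\<bar>\<psi> x\<bar> * norm (F x) \<le> B * (1 + norm (F x) powr p)"
        using \<psi>(2)[of x] B abs_le_one_plus_powr[OF p, of "norm (F x)"] by (intro mult_mono) auto
      also have "\<dots> = norm (B * (indicator S x + norm (F x) powr p))" using True B by simp
      finally show ?thesis by simp
    qed (use \<psi>(3) in simp)
  qed
qed

section \<open>Alternating tensors and determinants\<close>

text \<open>The Leibniz determinant of the leading k-block of an array indexed by naturals. With the
  size as a number, k-minors and the (k+1)-determinant formed from them share one
  definition.\<close>

definition pdet :: "nat \<Rightarrow> (nat \<Rightarrow> nat \<Rightarrow> real) \<Rightarrow> real" where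
  "pdet k a = (\<Sum>p | p permutes {..<k}. of_int (sign p) * (\<Prod>i<k. a i (p i)))"

text \<open>The pairing of T with the elementary tensor of the first k vectors of u.\<close>

definition tens :: "nat \<Rightarrow> (nat \<Rightarrow> real^'n) \<Rightarrow> ('n::finite list \<Rightarrow> real) \<Rightarrow> real" where
  "tens k u T = (\<Sum>xs | length xs = k. (\<Prod>m<k. u m $ (xs ! m)) * T xs)"

text \<open>The coordinates of the wedge product of u 0, ..., u (k-1), as the signed sum over
  permutations without the factor 1/k!; this normalisation is the source of \<open>fact k\<close>
  further on.\<close>

definition wedge :: "nat \<Rightarrow> (nat \<Rightarrow> real^'n) \<Rightarrow> 'n::finite list \<Rightarrow> real" where
  "wedge k u xs = (if length xs = k then pdet k (\<lambda>m j. u j $ (xs ! m)) else 0)"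

lemma pdet_cong: "(\<And>i j. i < k \<Longrightarrow> j < k \<Longrightarrow> a i j = b i j) \<Longrightarrow> pdet k a = pdet k b"
  unfolding pdet_def by (intro sum.cong prod.cong arg_cong2[where f="(*)"]) (auto dest: permutes_in_image)

lemma pdet_permute_rows:
  assumes t: "\<tau> permutes {..<k}"
  shows "pdet k (\<lambda>i. a (\<tau> i)) = of_int (sign \<tau>) * pdet k a"
proof -
  have fin: "permutation \<tau>" using t by (rule permutes_imp_permutation[rotated]) simp
  have "pdet k a = (\<Sum>p | p permutes {..<k}. of_int (sign (p \<circ> inv_into UNIV \<tau>)) * (\<Prod>i<k. a i ((p \<circ> inv_into UNIV \<tau>) i)))"
    unfolding pdet_def by (rule sum_permutations_compose_right[OF permutes_inv[OF t]]) 
  also have "\<dots> = (\<Sum>p | p permutes {..<k}. of_int (sign \<tau>) * (of_int (sign p) * (\<Prod>i<k. a (\<tau> i) (p i))))"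
  proof (rule sum.cong)
    fix p assume "p \<in> {p. p permutes {..<k}}"
    then have p: "permutation p" using permutes_imp_permutation by blast
    have "(\<Prod>i<k. a i ((p \<circ> inv_into UNIV \<tau>) i)) = (\<Prod>i<k. a (\<tau> i) ((p \<circ> inv_into UNIV \<tau>) (\<tau> i)))"
      by (rule prod.permute[OF t, unfolded comp_def])
    also have "\<dots> = (\<Prod>i<k. a (\<tau> i) (p i))" using t by (simp add: permutes_inverses)
    finally show "of_int (sign (p \<circ> inv_into UNIV \<tau>)) * (\<Prod>i<k. a i ((p \<circ> inv_into UNIV \<tau>) i))
        = of_int (sign \<tau>) * (of_int (sign p) * (\<Prod>i<k. a (\<tau> i) (p i)))"
      using p fin by (simp add: sign_compose permutation_inverse sign_inverse)
  qed simp
  finally have "pdet k a = of_int (sign \<tau>) * pdet k (\<lambda>i. a (\<tau> i))"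
    unfolding pdet_def sum_distrib_left .
  then have "of_int (sign \<tau>) * pdet k a = of_int (sign \<tau> * sign \<tau>) * pdet k (\<lambda>i. a (\<tau> i))"
    by (simp only: of_int_mult mult.assoc)
  then show ?thesis by (simp only: sign_idempotent of_int_1 mult_1)
qed

lemma pdet_permute_cols:
  assumes t: "\<tau> permutes {..<k}"
  shows "pdet k (\<lambda>i j. a i (\<tau> j)) = of_int (sign \<tau>) * pdet k a"
proof -
  have fin: "permutation \<tau>" using t by (rule permutes_imp_permutation[rotated]) simp
  have "pdet k a = (\<Sum>p | p permutes {..<k}. of_int (sign (\<tau> \<circ> p)) * (\<Prod>i<k. a i ((\<tau> \<circ> p) i)))"
    unfolding pdet_def by (rule setum_permutations_compose_left[OF t]) 
  also have "\<dots> = (\<Sum>p | p permutes {..<k}. of_int (sign \<tau>) * (of_int (sign p) * (\<Prod>i<k. a i (\<tau> (p i)))))"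
  proof (rule sum.cong)
    fix p assume "p \<in> {p. p permutes {..<k}}"
    then have p: "permutation p" using permutes_imp_permutation by blast
    then show "of_int (sign (\<tau> \<circ> p)) * (\<Prod>i<k. a i ((\<tau> \<circ> p) i))
        = of_int (sign \<tau>) * (of_int (sign p) * (\<Prod>i<k. a i (\<tau> (p i))))"
      using fin by (simp add: sign_compose)
  qed simp
  finally have "pdet k a = of_int (sign \<tau>) * pdet k (\<lambda>i j. a i (\<tau> j))"
    unfolding pdet_def sum_distrib_left .
  then have "of_int (sign \<tau>) * pdet k a = of_int (sign \<tau> * sign \<tau>) * pdet k (\<lambda>i j. a i (\<tau> j))"
    by (simp only: of_int_mult mult.assoc)
  then show ?thesis by (simp only: sign_idempotent of_int_1 mult_1)
qed

lemma pdet_zero_row: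
  assumes "i < k" "\<And>j. j < k \<Longrightarrow> a i j = 0"
  shows "pdet k a = 0"
  unfolding pdet_def
proof (rule sum.neutral, safe)
  fix p assume p: "p permutes {..<k}"
  have "p i < k" using permutes_in_image[OF p, of i] assms(1) by simp
  then have "(\<Prod>i<k. a i (p i)) = 0" using assms by (intro prod_zero) auto
  then show "of_int (sign p) * (\<Prod>i<k. a i (p i)) = 0" by simp
qed

lemma pdet_equal_cols:
  assumes "i < k" "j < k" "i \<noteq> j" "\<And>m. m < k \<Longrightarrow> a m i = a m j"
  shows "pdet k a = 0"
proof -
  have t: "Transposition.transpose i j permutes {..<k}" using assms by (intro permutes_swap_id) auto
  have "pdet k (\<lambda>m l. a m (Transposition.transpose i j l)) = pdet k a"
    using assms(4) by (intro pdet_cong) (auto simp: Transposition.transpose_def)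
  then show ?thesis using pdet_permute_cols[OF t, of a] assms(3) by (simp add: sign_swap_id)
qed

lemma pdet_diagonal:
  assumes "\<And>i j. i < k \<Longrightarrow> j < k \<Longrightarrow> i \<noteq> j \<Longrightarrow> a i j = 0"
  shows "pdet k a = (\<Prod>i<k. a i i)"
proof -
  have "pdet k a = (\<Sum>p\<in>{id}. of_int (sign p) * (\<Prod>i<k. a i (p i)))"
    unfolding pdet_def
  proof (rule sum.mono_neutral_right)
    show "finite {p. p permutes {..<k}}" by (rule finite_permutations) simp
    show "{id} \<subseteq> {p. p permutes {..<k}}" by (simp add: permutes_id)
    show "\<forall>p\<in>{p. p permutes {..<k}} - {id}. of_int (sign p) * (\<Prod>i<k. a i (p i)) = 0"
    proof
      fix p assume p: "p \<in> {p. p permutes {..<k}} - {id}"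
      then obtain i where i: "p i \<noteq> i" by (auto simp: fun_eq_iff)
      then have "i < k" using p permutes_not_in[of p "{..<k}" i] by auto
      moreover have "p i < k" using p permutes_in_image[of p "{..<k}" i] \<open>i < k\<close> by auto
      ultimately have "(\<Prod>i<k. a i (p i)) = 0" using assms[of i "p i"] i by (intro prod_zero) auto
      then show "of_int (sign p) * (\<Prod>i<k. a i (p i)) = 0" by simp
    qed
  qed
  then show ?thesis by simp
qed

lemma pdet_scale_cols: "pdet k (\<lambda>i j. c j * a i j) = (\<Prod>j<k. c j) * pdet k a"
  unfolding pdet_def sum_distrib_left
proof (rule sum.cong)
  fix p assume "p \<in> {p. p permutes {..<k}}"
  then have "(\<Prod>i<k. c (p i)) = (\<Prod>i<k. c i)" using prod.permute[of p "{..<k}" c] by (simp add: comp_def)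
  then show "of_int (sign p) * (\<Prod>i<k. c (p i) * a i (p i))
      = (\<Prod>j<k. c j) * (of_int (sign p) * (\<Prod>i<k. a i (p i)))"
    by (simp add: prod.distrib mult.left_commute)
qed simp

lemma finite_length_eq: "finite {xs::'a::finite list. length xs = k}"
  using finite_lists_length_eq[of "UNIV::'a set" k] by simp

text \<open>Expanding a product of k sums means choosing one letter per factor, that is, a word of
  length k.\<close>

lemma sum_prod_lists:
  fixes F :: "nat \<Rightarrow> 'a::finite \<Rightarrow> 'b::comm_semiring_1"
  shows "(\<Sum>xs | length xs = k. \<Prod>m<k. F m (xs ! m)) = (\<Prod>m<k. \<Sum>i\<in>UNIV. F m i)"
proof (induction k arbitrary: F)
  case (Suc k)
  have e: "{xs::'a list. length xs = Suc k} = (\<lambda>(x, xs). x # xs) ` (UNIV \<times> {xs. length xs = k})"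
    by (force simp: length_Suc_conv)
  have "(\<Sum>xs | length xs = Suc k. \<Prod>m<Suc k. F m (xs ! m))
      = (\<Sum>(x, xs)\<in>UNIV \<times> {xs. length xs = k}. \<Prod>m<Suc k. F m ((x # xs) ! m))"
    unfolding e by (subst sum.reindex) (auto simp: inj_on_def split_def)
  also have "\<dots> = (\<Sum>x\<in>UNIV. \<Sum>xs | length xs = k. F 0 x * (\<Prod>m<k. F (Suc m) (xs ! m)))"
    by (simp add: sum.cartesian_product prod.lessThan_Suc_shift del: prod.lessThan_Suc)
  also have "\<dots> = (\<Sum>x\<in>UNIV. F 0 x) * (\<Prod>m<k. \<Sum>i\<in>UNIV. F (Suc m) i)"
    by (simp add: Suc[of "\<lambda>m. F (Suc m)"] sum_distrib_right flip: sum_distrib_left)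
  finally show ?case by (simp add: prod.lessThan_Suc_shift del: prod.lessThan_Suc)
qed simp

text \<open>For each permutation the sum over words factors into inner products, so the pairing is a
  mixed Gram determinant.\<close>

lemma tens_wedge: "tens k w (wedge k u) = pdet k (\<lambda>i j. w i \<bullet> u j)"
proof -
  have "tens k w (wedge k u) = (\<Sum>xs | length xs = k. \<Sum>p | p permutes {..<k}.
      of_int (sign p) * (\<Prod>m<k. w m $ (xs ! m) * u (p m) $ (xs ! m)))"
    unfolding tens_def wedge_def pdet_def
    by (intro sum.cong) (auto simp: sum_distrib_left prod.distrib mult.left_commute)
  also have "\<dots> = (\<Sum>p | p permutes {..<k}. of_int (sign p) *
      (\<Sum>xs | length xs = k. \<Prod>m<k. w m $ (xs ! m) * u (p m) $ (xs ! m)))"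
    by (subst sum.swap) (simp add: sum_distrib_left)
  also have "\<dots> = pdet k (\<lambda>i j. w i \<bullet> u j)"
    unfolding sum_prod_lists[where k=k and F="\<lambda>m i. w m $ i * u (_ m) $ i"] pdet_def by (simp add: inner_vec_def)
  finally show ?thesis .
qed

text \<open>Ties the coordinate formula for the exterior power to its usual description on
  decomposable vectors.\<close>

lemma ext_pow_wedge: "ext_pow k A (wedge k u) = wedge k (\<lambda>i. A *v u i)"
proof
  fix xs :: "'a list"
  show "ext_pow k A (wedge k u) xs = wedge k (\<lambda>i. A *v u i) xs"
  proof (cases "length xs = k")
    case True
    have "ext_pow k A (wedge k u) xs = (\<Sum>ys | length ys = k. \<Sum>p | p permutes {..<k}.
      of_int (sign p) * (\<Prod>m<k. A $ (xs ! m) $ (ys ! m) * u (p m) $ (ys ! m)))"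
      unfolding ext_pow_def wedge_def pdet_def using True
      by (auto simp: sum_distrib_left prod.distrib mult.left_commute intro!: sum.cong)
    also have "\<dots> = (\<Sum>p | p permutes {..<k}. of_int (sign p) *
        (\<Sum>ys | length ys = k. \<Prod>m<k. A $ (xs ! m) $ (ys ! m) * u (p m) $ (ys ! m)))"
      by (subst sum.swap) (simp add: sum_distrib_left)
    also have "\<dots> = wedge k (\<lambda>i. A *v u i) xs"
      unfolding sum_prod_lists[where k=k and F="\<lambda>m i. A $ (xs ! m) $ i * u (_ m) $ i"] wedge_def pdet_def
      using True by (simp add: matrix_vector_mult_def)
    finally show ?thesis .
  qed (simp add: ext_pow_def wedge_def)
qed

lemma wedge_alt: "wedge k u \<in> alt_tensors k"
proof -
  have "wedge k u (xs[i := xs ! j, j := xs ! i]) = - wedge k u xs"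
    if "length xs = k" "i < k" "j < k" "i \<noteq> j" for xs i j
  proof -
    have t: "Transposition.transpose i j permutes {..<k}" using that by (intro permutes_swap_id) auto
    have "pdet k (\<lambda>m l. u l $ (xs[i := xs ! j, j := xs ! i] ! m)) = pdet k (\<lambda>m l. u l $ (xs ! Transposition.transpose i j m))"
      using that by (intro pdet_cong) (auto simp: nth_list_update Transposition.transpose_def)
    also have "\<dots> = - pdet k (\<lambda>m l. u l $ (xs ! m))"
      using pdet_permute_rows[OF t, of "\<lambda>m l. u l $ (xs ! m)"] that by (simp add: sign_swap_id)
    finally show ?thesis using that by (simp add: wedge_def)
  qed
  then show ?thesis unfolding alt_tensors_def by (auto simp: wedge_def)
qed

text \<open>Alternation is only postulated for swaps of two positions; induction over transpositions
  reaches every permutation.\<close>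

lemma alt_tensors_permute:
  assumes T: "T \<in> alt_tensors k" and p: "p permutes {..<k}" and "length xs = k"
  shows "T (map (\<lambda>i. xs ! p i) [0..<k]) = of_int (sign p) * T xs"
proof -
  \<comment> \<open>The word is quantified inside the induction because the hypothesis is applied to
    the swapped word.\<close>
  have "\<forall>xs. length xs = k \<longrightarrow> T (map (\<lambda>i. xs ! p i) [0..<k]) = of_int (sign p) * T xs"
    using p finite_lessThan[of k]
  proof (induction p rule: permutes_induct)
    case id
    have "map (\<lambda>i. xs ! id i) [0..<k] = xs" if "length xs = k" for xs :: "'a list"
      using that by (intro nth_equalityI) auto
    then show ?case by (simp add: sign_id)
  next
    case (swap a b p)
    have pp: "permutation p" using swap by (meson finite_lessThan permutes_imp_permutation)
    show ?case
    proof (intro allI impI)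
      fix xs :: "'a list" assume len: "length xs = k"
      let ?ys = "map (\<lambda>i. xs ! Transposition.transpose a b i) [0..<k]"
      have "p i < k" if "i < k" for i using permutes_in_image[of p "{..<k}" i] swap that by simp
      then have "map (\<lambda>i. xs ! (Transposition.transpose a b \<circ> p) i) [0..<k] = map (\<lambda>i. ?ys ! p i) [0..<k]"
        by (auto simp: comp_def)
      then have e: "T (map (\<lambda>i. xs ! (Transposition.transpose a b \<circ> p) i) [0..<k]) = of_int (sign p) * T ?ys"
        using swap.IH by (simp only: length_map length_upt diff_zero simp_thms)
      have "?ys = xs[a := xs ! b, b := xs ! a]"
        using swap len by (intro nth_equalityI) (auto simp: nth_list_update Transposition.transpose_def)
      moreover have "T (xs[a := xs ! b, b := xs ! a]) = - T xs"
        using T swap len unfolding alt_tensors_def by auto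
      ultimately have "T ?ys = - T xs" by (simp only:)
      then show "T (map (\<lambda>i. xs ! (Transposition.transpose a b \<circ> p) i) [0..<k])
          = of_int (sign (Transposition.transpose a b \<circ> p)) * T xs"
        unfolding e using \<open>a \<noteq> b\<close> pp by (simp add: sign_compose sign_swap_id permutation_swap_id)
    qed
  qed
  then show ?thesis using assms by blast
qed

text \<open>Completeness of the v c in each slot resolves T into elementary tensors. In the
  antisymmetrised sum each permutation p selects the word xs rearranged by the inverse of p, and
  alternation cancels the sign of p; thus every one of the k! permutations contributes T xs. All
  words are summed, in every order and with repetitions, not only k-subsets.\<close>

lemma alt_tensor_expansion:
  fixes v :: "'n::finite \<Rightarrow> real^'n"
  assumes T: "T \<in> alt_tensors k"
    and v: "\<And>i j. (\<Sum>c\<in>UNIV. v c $ i * v c $ j) = of_bool (i = j)"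
  shows "fact k * T xs = (\<Sum>cs | length cs = k. tens k (\<lambda>m. v (cs ! m)) T * wedge k (\<lambda>m. v (cs ! m)) xs)"
proof (cases "length xs = k")
  case False
  then show ?thesis using T by (simp add: wedge_def alt_tensors_def)
next
  case True
  have inner: "(\<Sum>cs | length cs = k. (\<Prod>m<k. v (cs ! m) $ (ys ! m)) * (\<Prod>m<k. v (cs ! p m) $ (xs ! m)))
      = of_bool (ys = map (\<lambda>i. xs ! inv_into UNIV p i) [0..<k])"
    if p: "p permutes {..<k}" and ys: "length ys = k" for p ys
  proof -
    have "(\<Prod>m<k. v (cs ! p m) $ (xs ! m)) = (\<Prod>m<k. v (cs ! m) $ (xs ! inv_into UNIV p m))" for cs
      using prod.permute[OF permutes_inv[OF p], of "\<lambda>m. v (cs ! p m) $ (xs ! m)"] p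
      by (simp add: comp_def permutes_inverses)
    then have "(\<Sum>cs | length cs = k. (\<Prod>m<k. v (cs ! m) $ (ys ! m)) * (\<Prod>m<k. v (cs ! p m) $ (xs ! m)))
        = (\<Sum>cs | length cs = k. \<Prod>m<k. v (cs ! m) $ (ys ! m) * v (cs ! m) $ (xs ! inv_into UNIV p m))"
      by (simp add: prod.distrib)
    also have "\<dots> = (\<Prod>m<k. of_bool (ys ! m = xs ! inv_into UNIV p m))"
      by (subst sum_prod_lists[where k=k and F="\<lambda>m c. v c $ (ys ! m) * v c $ (xs ! inv_into UNIV p m)"]) (simp add: v)
    also have "\<dots> = of_bool (\<forall>m<k. ys ! m = xs ! inv_into UNIV p m)"
      by (auto intro!: prod_zero)
    also have "(\<forall>m<k. ys ! m = xs ! inv_into UNIV p m) \<longleftrightarrow> ys = map (\<lambda>i. xs ! inv_into UNIV p i) [0..<k]"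
      using ys by (auto simp: list_eq_iff_nth_eq)
    finally show ?thesis .
  qed
  have "(\<Sum>cs | length cs = k. tens k (\<lambda>m. v (cs ! m)) T * wedge k (\<lambda>m. v (cs ! m)) xs)
      = (\<Sum>cs | length cs = k. \<Sum>p | p permutes {..<k}. \<Sum>ys | length ys = k.
          of_int (sign p) * (T ys * ((\<Prod>m<k. v (cs ! m) $ (ys ! m)) * (\<Prod>m<k. v (cs ! p m) $ (xs ! m)))))"
    unfolding tens_def wedge_def pdet_def using True
    by (simp add: sum_distrib_left sum_distrib_right mult_ac)
  also have "\<dots> = (\<Sum>p | p permutes {..<k}. \<Sum>cs | length cs = k. \<Sum>ys | length ys = k.
          of_int (sign p) * (T ys * ((\<Prod>m<k. v (cs ! m) $ (ys ! m)) * (\<Prod>m<k. v (cs ! p m) $ (xs ! m)))))"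
    by (rule sum.swap)
  also have "\<dots> = (\<Sum>p | p permutes {..<k}. \<Sum>ys | length ys = k. \<Sum>cs | length cs = k.
          of_int (sign p) * (T ys * ((\<Prod>m<k. v (cs ! m) $ (ys ! m)) * (\<Prod>m<k. v (cs ! p m) $ (xs ! m)))))"
    by (intro sum.cong refl sum.swap)
  also have "\<dots> = (\<Sum>p | p permutes {..<k}. \<Sum>ys | length ys = k.
          of_int (sign p) * (T ys * of_bool (ys = map (\<lambda>i. xs ! inv_into UNIV p i) [0..<k])))"
    by (intro sum.cong refl) (simp add: inner flip: sum_distrib_left)
  also have "\<dots> = (\<Sum>p | p permutes {..<k}. T xs)"
  proof (rule sum.cong, simp)
    fix p assume "p \<in> {p. p permutes {..<k}}"
    then have p: "p permutes {..<k}" by simp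
    have perm: "permutation p" using p permutes_imp_permutation by blast
    have "(\<Sum>ys | length ys = k. of_int (sign p) * (T ys * of_bool (ys = map (\<lambda>i. xs ! inv_into UNIV p i) [0..<k])))
        = (\<Sum>ys\<in>{map (\<lambda>i. xs ! inv_into UNIV p i) [0..<k]}. of_int (sign p) * T ys)"
      by (rule sum.mono_neutral_cong_right) (auto simp: finite_length_eq)
    also have "\<dots> = of_int (sign p * sign (inv_into UNIV p)) * T xs"
      using alt_tensors_permute[OF T permutes_inv[OF p] True] by simp
    also have "\<dots> = T xs" using perm by (simp add: sign_inverse)
    finally show "(\<Sum>ys | length ys = k. of_int (sign p) * (T ys * of_bool (ys = map (\<lambda>i. xs ! inv_into UNIV p i) [0..<k]))) = T xs" .
  qed
  also have "\<dots> = fact k * T xs" by (simp add: card_permutations[of "{..<k}" k])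
  finally show ?thesis by simp
qed

section \<open>Singular frames\<close>

text \<open>Storing a frame as the rows of a square matrix makes the set of frames a compact subset
  of a Euclidean space.\<close>

definition orthonormal_rows :: "real^'n^'n \<Rightarrow> bool" where
  "orthonormal_rows V \<longleftrightarrow> (\<forall>i j. V $ i \<bullet> V $ j = of_bool (i = j))"

text \<open>A right inverse of a square matrix is also a left inverse, so orthonormal rows force
  orthonormal columns.\<close>

lemma orthonormal_rows_complete:
  assumes "orthonormal_rows V"
  shows "(\<Sum>c\<in>UNIV. V $ c $ i * V $ c $ j) = of_bool (i = j)"
proof -
  have "V ** Finite_Cartesian_Product.transpose V = mat 1"
    using assms unfolding orthonormal_rows_def
    by (simp add: Finite_Cartesian_Product.vec_eq_iff matrix_matrix_mult_def Finite_Cartesian_Product.transpose_def Finite_Cartesian_Product.mat_def inner_vec_def)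
  then have "Finite_Cartesian_Product.transpose V ** V = mat 1" by (simp add: matrix_left_right_inverse)
  then have "(Finite_Cartesian_Product.transpose V ** V) $ i $ j = mat 1 $ i $ j" by simp
  then show ?thesis by (simp add: matrix_matrix_mult_def Finite_Cartesian_Product.transpose_def Finite_Cartesian_Product.mat_def)
qed

lemma compact_orthonormal_rows: "compact {V :: real^'n::finite^'n. orthonormal_rows V}"
proof -
  have "norm V \<le> CARD('n)" if "orthonormal_rows V" for V :: "real^'n^'n"
  proof -
    have "norm (V $ i) = 1" for i using that by (simp add: orthonormal_rows_def norm_eq_sqrt_inner)
    then show ?thesis unfolding norm_vec_def using L2_set_le_sum[of UNIV "\<lambda>i. norm (V $ i)"]
      by (simp only: \<open>\<And>i. norm (V $ i) = 1\<close>) simp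
  qed
  then have "bounded {V :: real^'n^'n. orthonormal_rows V}" unfolding bounded_iff by blast
  moreover have "closed {V :: real^'n^'n. orthonormal_rows V}"
    unfolding orthonormal_rows_def
    by (intro closed_Collect_all closed_Collect_eq continuous_intros)
  ultimately show ?thesis by (simp add: compact_eq_bounded_closed)
qed

lemma orthonormal_rows_rotate:
  assumes V: "orthonormal_rows V" and ij: "i \<noteq> j"
  shows "orthonormal_rows (\<chi> l. if l = i then cos t *\<^sub>R V $ i + sin t *\<^sub>R V $ j
      else if l = j then (- sin t) *\<^sub>R V $ i + cos t *\<^sub>R V $ j else V $ l)"
proof -
  have v: "V $ l \<bullet> V $ m = (if l = m then 1 else 0)" for l m using V by (simp add: orthonormal_rows_def)
  have "cos t * cos t + sin t * sin t = 1" "sin t * sin t + cos t * cos t = 1"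
    using sin_cos_squared_add[of t] by (simp_all add: power2_eq_square)
  then show ?thesis
    unfolding orthonormal_rows_def using ij by (simp add: inner_add_left inner_add_right inner_diff_left inner_diff_right v)
qed

lemma orthonormal_rows_mat_1: "orthonormal_rows (mat 1 :: real^'n::finite^'n)"
proof -
  have "(mat 1 :: real^'n^'n) $ i = axis i 1" for i by (auto simp: Finite_Cartesian_Product.vec_eq_iff Finite_Cartesian_Product.mat_def axis_def)
  then show ?thesis by (simp add: orthonormal_rows_def inner_axis_axis of_bool_def)
qed

text \<open>The frame maximises \<open>\<Sum>i. c i * |A v i|^2\<close> with pairwise distinct weights \<open>c i\<close>; stationarity under
  the rotation of \<open>v i\<close> and \<open>v j\<close> reads \<open>(c i - c j) (A v i \<bullet> A v j) = 0\<close>.\<close>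

lemma singular_frame_exists:
  fixes A :: "real^'n::finite^'m::finite"
  shows "\<exists>V :: real^'n^'n. orthonormal_rows V \<and> (\<forall>i j. i \<noteq> j \<longrightarrow> (A *v V $ i) \<bullet> (A *v V $ j) = 0)"
proof -
  obtain c0 :: "'n \<Rightarrow> nat" where c0: "inj c0" using finite_imp_inj_to_nat_seg[of "UNIV::'n set"] by auto
  define c where "c i = real (c0 i)" for i
  define F where "F V = (\<Sum>i\<in>UNIV. c i * ((A *v V $ i) \<bullet> (A *v V $ i)))" for V :: "real^'n^'n"
  have "continuous_on UNIV F" unfolding F_def
    by (intro continuous_intros linear_continuous_on_compose[OF _ matrix_vector_mul_linear])
  then have "continuous_on {V. orthonormal_rows V} F" by (rule continuous_on_subset) simp
  moreover have "{V :: real^'n^'n. orthonormal_rows V} \<noteq> {}" using orthonormal_rows_mat_1 by auto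
  ultimately obtain V where V: "orthonormal_rows V" and max: "\<And>W. orthonormal_rows W \<Longrightarrow> F W \<le> F V"
    using continuous_attains_sup[OF compact_orthonormal_rows] by (metis mem_Collect_eq)
  have "(A *v V $ i) \<bullet> (A *v V $ j) = 0" if ij: "i \<noteq> j" for i j
  proof -
    let ?W = "\<lambda>t. \<chi> l. if l = i then cos t *\<^sub>R V $ i + sin t *\<^sub>R V $ j
      else if l = j then (- sin t) *\<^sub>R V $ i + cos t *\<^sub>R V $ j else V $ l"
    let ?a = "A *v V $ i" and ?b = "A *v V $ j"
    have W0: "?W 0 = V" by (auto simp: Finite_Cartesian_Product.vec_eq_iff)
    have deriv: "((\<lambda>t. c l * ((A *v ?W t $ l) \<bullet> (A *v ?W t $ l))) has_real_derivative
        (if l = i then 2 * c i * (?a \<bullet> ?b) else 0) + (if l = j then - 2 * c j * (?a \<bullet> ?b) else 0)) (at 0)" for l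
    proof -
      have e: "A *v (p *\<^sub>R x + q *\<^sub>R y) = p *\<^sub>R (A *v x) + q *\<^sub>R (A *v y)" for p q x y
        by (simp add: matrix_vector_right_distrib matrix_vector_mult_scaleR)
      have q: "(p *\<^sub>R ?a + q *\<^sub>R ?b) \<bullet> (p *\<^sub>R ?a + q *\<^sub>R ?b)
          = p * p * (?a \<bullet> ?a) + 2 * p * q * (?a \<bullet> ?b) + q * q * (?b \<bullet> ?b)" for p q
        by (simp add: inner_add_left inner_add_right inner_commute algebra_simps)
      consider "l = i" | "l = j" | "l \<noteq> i" "l \<noteq> j" by blast
      then show ?thesis
      proof cases
        case 1
        have "((\<lambda>t. c i * (cos t * cos t * (?a \<bullet> ?a) + 2 * cos t * sin t * (?a \<bullet> ?b) + sin t * sin t * (?b \<bullet> ?b)))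
            has_real_derivative 2 * c i * (?a \<bullet> ?b)) (at 0)"
          by (auto intro!: derivative_eq_intros)
        then show ?thesis using 1 ij by (simp add: e q)
      next
        case 2
        have "((\<lambda>t. c j * ((- sin t) * (- sin t) * (?a \<bullet> ?a) + 2 * (- sin t) * cos t * (?a \<bullet> ?b) + cos t * cos t * (?b \<bullet> ?b)))
            has_real_derivative - 2 * c j * (?a \<bullet> ?b)) (at 0)"
          by (auto intro!: derivative_eq_intros)
        then show ?thesis using 2 ij by (simp add: e q del: mult_minus_left mult_minus_right minus_mult_minus scaleR_minus_left)
      next
        case 3
        then show ?thesis by simp
      qed
    qed
    have "((\<lambda>t. F (?W t)) has_real_derivative (\<Sum>l\<in>UNIV. (if l = i then 2 * c i * (?a \<bullet> ?b) else 0)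
        + (if l = j then - 2 * c j * (?a \<bullet> ?b) else 0))) (at 0)"
      unfolding F_def by (intro DERIV_sum deriv)
    then have der: "((\<lambda>t. F (?W t)) has_real_derivative 2 * (c i - c j) * (?a \<bullet> ?b)) (at 0)"
      by (simp add: sum.distrib algebra_simps)
    have le: "F (?W t) \<le> F (?W 0)" for t
      unfolding W0 by (intro max orthonormal_rows_rotate V ij)
    have "2 * (c i - c j) * (?a \<bullet> ?b) = 0"
      by (rule DERIV_local_max[OF der, of 1]) (use le in simp_all)
    then show ?thesis using c0 ij by (simp add: c_def inj_eq)
  qed
  then show ?thesis using V by blast
qed

section \<open>Recovering a matrix from its minors\<close>

text \<open>The increasing enumeration of the indices other than i: row a of a matrix with row i
  deleted was row \<open>skip i a\<close>.\<close>

definition skip :: "nat \<Rightarrow> nat \<Rightarrow> nat" where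
  "skip i a = (if a < i then a else Suc a)"

definition minors :: "nat \<Rightarrow> (nat \<Rightarrow> nat \<Rightarrow> real) \<Rightarrow> nat \<Rightarrow> nat \<Rightarrow> real" where
  "minors k S i j = (-1) ^ (i + j) * pdet k (\<lambda>a b. S (skip i a) (skip j b))"

text \<open>Gives \<open>pdet\<close> access to the adjugate and to multiplicativity for matrices
  whose size is a number.\<close>

lemma det_mat_eq_pdet: "Determinant.det (Matrix.mat k k (\<lambda>(i, j). a i j)) = pdet k a"
proof -
  have "(\<Prod>i = 0..<k. Matrix.mat k k (\<lambda>(i, j). a i j) $$ (i, p i)) = (\<Prod>i<k. a i (p i))"
    if "p permutes {0..<k}" for p
  proof (rule prod.cong)
    fix i assume "i \<in> {..<k}"
    moreover from this have "p i < k" using permutes_in_image[OF that, of i] by simp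
    ultimately show "Matrix.mat k k (\<lambda>(i, j). a i j) $$ (i, p i) = a i (p i)" by simp
  qed auto
  then show ?thesis unfolding Determinant.det_def pdet_def by (auto simp: lessThan_atLeast0 intro!: sum.cong)
qed

text \<open>\<open>minors k S\<close> is the transposed adjugate \<open>B\<^sup>T\<close> of the leading \<open>(k+1)\<close>-block of \<open>S\<close>; then
  \<open>S det B = det S adj B\<close> and \<open>det B = (det S)^k\<close>, so for odd \<open>k\<close> the entries of \<open>S\<close> are functions of \<open>B\<close>.\<close>

lemma entry_from_minors:
  assumes k: "odd k" and d: "pdet (Suc k) (minors k S) \<noteq> 0"
  shows "S 0 0 = root k (pdet (Suc k) (minors k S))
    * pdet k (\<lambda>a b. minors k S (Suc a) (Suc b)) / pdet (Suc k) (minors k S)"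
proof -
  let ?n = "Suc k" and ?C = "minors k S"
  define A where "A = Matrix.mat ?n ?n (\<lambda>(i, j). S i j)"
  define B where "B = adj_mat A"
  define D where "D = Determinant.det A"
  have Ac: "A \<in> carrier_mat ?n ?n" by (simp add: A_def)
  note Bc = adj_mat(1)[OF Ac, folded B_def]
  have "cofactor A i j = ?C i j" if "i < ?n" "j < ?n" for i j
  proof -
    have "mat_delete A i j = Matrix.mat k k (\<lambda>(a, b). S (skip i a) (skip j b))"
      unfolding mat_delete_def A_def using that by (intro eq_matI) (auto simp: skip_def)
    then show ?thesis unfolding cofactor_def minors_def by (simp add: det_mat_eq_pdet)
  qed
  then have B: "B = transpose_mat (Matrix.mat ?n ?n (\<lambda>(i, j). ?C i j))"
    unfolding B_def adj_mat_def using Ac by (intro eq_matI) auto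
  then have dB: "Determinant.det B = pdet ?n ?C"
    by (simp add: det_transpose[of _ ?n] det_mat_eq_pdet)
  have AB: "A * B = D \<cdot>\<^sub>m 1\<^sub>m ?n" unfolding B_def D_def by (rule adj_mat(2)[OF Ac])
  have "D * pdet ?n ?C = D ^ ?n"
    using arg_cong[OF AB, of Determinant.det] by (simp add: det_mult[OF Ac Bc] dB D_def)
  have adjB: "adj_mat B \<in> carrier_mat ?n ?n" "B * adj_mat B = pdet ?n ?C \<cdot>\<^sub>m 1\<^sub>m ?n"
    using adj_mat[OF Bc] by (auto simp: dB)
  have "A * (B * adj_mat B) = (A * B) * adj_mat B" using Ac Bc adjB(1) by (simp add: assoc_mult_mat[of _ ?n ?n _ ?n _ ?n])
  then have "pdet ?n ?C \<cdot>\<^sub>m A = D \<cdot>\<^sub>m adj_mat B"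
    unfolding AB adjB(2) mult_smult_distrib[OF Ac one_carrier_mat] right_mult_one_mat[OF Ac]
      mult_smult_assoc_mat[OF one_carrier_mat adjB(1)] left_mult_one_mat[OF adjB(1)] .
  then have "(pdet ?n ?C \<cdot>\<^sub>m A) $$ (i, j) = (D \<cdot>\<^sub>m adj_mat B) $$ (i, j)" for i j by (simp only:)
  moreover have "A $$ (i, j) = S i j" if "i < ?n" "j < ?n" for i j using that by (simp add: A_def)
  ultimately have e: "pdet ?n ?C * S i j = D * adj_mat B $$ (i, j)" if "i < ?n" "j < ?n" for i j
    using that carrier_matD[OF Ac] carrier_matD[OF adjB(1)] by (metis index_smult_mat(1))
  \<comment> \<open>If D were 0, the identity \<open>e\<close> would force the block of S to vanish,
    hence all its k-minors (k is positive) and with them the determinant assumed nonzero in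
    \<open>d\<close>.\<close>
  have "D \<noteq> 0"
  proof
    assume "D = 0"
    then have z: "S i j = 0" if "i < ?n" "j < ?n" for i j using e[OF that] d by simp
    have "0 < k" using k odd_pos by blast
    have "?C i j = 0" if "i < ?n" "j < ?n" for i j
    proof -
      have "pdet k (\<lambda>a b. S (skip i a) (skip j b)) = 0"
        by (rule pdet_zero_row[OF \<open>0 < k\<close>]) (auto intro!: z simp: skip_def \<open>0 < k\<close>)
      then show ?thesis by (simp add: minors_def)
    qed
    then have "pdet ?n ?C = 0" by (intro pdet_zero_row[of 0]) auto
    with d show False by simp
  qed
  then have "pdet ?n ?C = D ^ k" using \<open>D * pdet ?n ?C = D ^ ?n\<close> by simp
  then have "root k (pdet ?n ?C) = D" using k by (simp add: odd_real_root_power_cancel)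
  \<comment> \<open>Deleting row and column 0 shifts every index by one; transposition does not
    affect the determinant.\<close>
  moreover have "adj_mat B $$ (0, 0) = pdet k (\<lambda>a b. ?C (Suc a) (Suc b))"
  proof -
    have "mat_delete B 0 0 = transpose_mat (Matrix.mat k k (\<lambda>(a, b). ?C (Suc a) (Suc b)))"
      unfolding mat_delete_def B by (intro eq_matI) auto
    then have "cofactor B 0 0 = pdet k (\<lambda>a b. ?C (Suc a) (Suc b))"
      unfolding cofactor_def by (simp add: det_transpose[of _ k] det_mat_eq_pdet)
    then show ?thesis unfolding adj_mat_def using Bc by simp
  qed
  ultimately show ?thesis using e[of 0 0] d by (simp add: field_simps)
qed

section \<open>Ranks of exterior powers\<close>

interpretation fs: vector_space fscale
  by unfold_locales (auto simp: fscale_def fun_eq_iff algebra_simps)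

lemma alt_tensors_subspace: "fs.subspace (alt_tensors k)"
  unfolding fs.subspace_def alt_tensors_def by (auto simp: fscale_def)

lemma is_endo_add: "is_endo (alt_tensors k) L \<Longrightarrow> u \<in> alt_tensors k \<Longrightarrow> v \<in> alt_tensors k \<Longrightarrow> L (u + v) = L u + L v"
  unfolding is_endo_def by (metis fs.scale_one)

lemma is_endo_zero: "is_endo (alt_tensors k) L \<Longrightarrow> L 0 = 0"
  using is_endo_add[of k L 0 0] fs.subspace_0[OF alt_tensors_subspace, of k] by simp

lemma is_endo_scale: "is_endo (alt_tensors k) L \<Longrightarrow> u \<in> alt_tensors k \<Longrightarrow> L (fscale a u) = fscale a (L u)"
  unfolding is_endo_def by (metis add.right_neutral fs.scale_zero_left)

lemma is_endo_sum:
  assumes L: "is_endo (alt_tensors k) L" and W: "\<And>c. c \<in> C \<Longrightarrow> W c \<in> alt_tensors k"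
  shows "L (\<Sum>c\<in>C. fscale (a c) (W c)) = (\<Sum>c\<in>C. fscale (a c) (L (W c)))"
  using W
proof (induction C rule: infinite_finite_induct)
  case (insert c C)
  have "(\<Sum>c\<in>C. fscale (a c) (W c)) \<in> alt_tensors k"
    using insert by (intro fs.subspace_sum fs.subspace_scale alt_tensors_subspace) auto
  moreover have "fscale (a c) (W c) \<in> alt_tensors k"
    using insert by (intro fs.subspace_scale alt_tensors_subspace) auto
  ultimately have "L (fscale (a c) (W c) + (\<Sum>c\<in>C. fscale (a c) (W c)))
      = fscale (a c) (L (W c)) + L (\<Sum>c\<in>C. fscale (a c) (W c))"
    using insert.prems[of c] is_endo_add[OF L] is_endo_scale[OF L] by simp
  then show ?case unfolding sum.insert[OF insert.hyps] using insert by (simp only: insert_iff simp_thms)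
qed (auto simp: is_endo_zero[OF L])

lemma sum_fun_apply: "(\<Sum>c\<in>C. F c) x = (\<Sum>c\<in>C. F c x)" for F :: "'c \<Rightarrow> 'a \<Rightarrow> real"
  by (induction C rule: infinite_finite_induct) auto

lemma is_endo_frame_expansion:
  fixes V :: "real^'n::finite^'n"
  assumes L: "is_endo (alt_tensors k) L" and V: "orthonormal_rows V" and T: "T \<in> alt_tensors k"
  shows "L T = (\<Sum>cs | length cs = k. fscale (tens k (\<lambda>m. V $ (cs ! m)) T / fact k) (L (wedge k (\<lambda>m. V $ (cs ! m)))))"
proof -
  have "T xs = (\<Sum>cs | length cs = k. fscale (tens k (\<lambda>m. V $ (cs ! m)) T / fact k) (wedge k (\<lambda>m. V $ (cs ! m)))) xs" for xs
  proof -
    have "fact k * T xs = (\<Sum>cs | length cs = k. tens k (\<lambda>m. V $ (cs ! m)) T * wedge k (\<lambda>m. V $ (cs ! m)) xs)"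
      by (rule alt_tensor_expansion[OF T orthonormal_rows_complete[OF V]])
    then have "T xs = (\<Sum>cs | length cs = k. tens k (\<lambda>m. V $ (cs ! m)) T * wedge k (\<lambda>m. V $ (cs ! m)) xs) / fact k"
      by (simp add: field_simps)
    then show ?thesis by (simp add: sum_fun_apply fscale_def sum_divide_distrib)
  qed
  then have "T = (\<Sum>cs | length cs = k. fscale (tens k (\<lambda>m. V $ (cs ! m)) T / fact k) (wedge k (\<lambda>m. V $ (cs ! m))))"
    by (rule ext)
  then have "L T = L (\<Sum>cs | length cs = k. fscale (tens k (\<lambda>m. V $ (cs ! m)) T / fact k) (wedge k (\<lambda>m. V $ (cs ! m))))"
    by (rule arg_cong)
  also have "\<dots> = (\<Sum>cs | length cs = k. fscale (tens k (\<lambda>m. V $ (cs ! m)) T / fact k) (L (wedge k (\<lambda>m. V $ (cs ! m)))))"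
    by (rule is_endo_sum[OF L wedge_alt])
  finally show ?thesis .
qed

text \<open>The matrix of L over words; dividing by k! compensates for the summation over all words
  instead of k-subsets. It reduces L to finitely many numbers, which is what lets operator and
  argument vary together in a limit.\<close>

definition kern :: "nat \<Rightarrow> (('n::finite list \<Rightarrow> real) \<Rightarrow> 'n list \<Rightarrow> real) \<Rightarrow> 'n list \<Rightarrow> 'n list \<Rightarrow> real" where
  "kern k L xs ys = L (wedge k (\<lambda>m. axis (ys ! m) 1)) xs / fact k"

lemma is_endo_kern:
  assumes L: "is_endo (alt_tensors k) L" and T: "T \<in> alt_tensors k"
  shows "L T xs = (\<Sum>ys | length ys = k. kern k L xs ys * T ys)"
proof -
  have row: "(mat 1 :: real^'a^'a) $ i = axis i 1" for i by (auto simp: Finite_Cartesian_Product.vec_eq_iff Finite_Cartesian_Product.mat_def axis_def)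
  have "tens k (\<lambda>m. axis (cs ! m) 1) T = T cs" if "length cs = k" for cs
  proof -
    have "(\<Prod>m<k. axis (cs ! m) 1 $ (xs ! m)) * T xs = (if xs = cs then T cs else 0)" if len: "length xs = k" for xs
    proof (cases "xs = cs")
      case False
      then obtain m where "m < k" "xs ! m \<noteq> cs ! m" using len \<open>length cs = k\<close> nth_equalityI[of xs cs] by metis
      then have "(\<Prod>m<k. axis (cs ! m) (1::real) $ (xs ! m)) = 0"
        by (intro prod_zero) (auto simp: axis_def)
      then show ?thesis using False by simp
    qed (simp add: axis_def)
    then have "tens k (\<lambda>m. axis (cs ! m) 1) T = (\<Sum>xs | length xs = k. if xs = cs then T cs else 0)"
      unfolding tens_def by (intro sum.cong) auto
    then show ?thesis using that by (simp add: finite_length_eq sum.delta)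
  qed
  then show ?thesis
    using is_endo_frame_expansion[OF L orthonormal_rows_mat_1 T]
    by (simp add: row sum_fun_apply fscale_def kern_def mult.commute)
qed

section \<open>Wedges of frame vectors and bounds for the rank\<close>

lemma wedge_permute:
  assumes "p permutes {..<k}"
  shows "wedge k (\<lambda>m. u (p m)) = fscale (of_int (sign p)) (wedge k u)"
  unfolding wedge_def fscale_def
  using pdet_permute_cols[OF assms, of "\<lambda>m j. u j $ (_ ! m)"] by (auto simp: fun_eq_iff)

lemma wedge_equal_args: "i < k \<Longrightarrow> j < k \<Longrightarrow> i \<noteq> j \<Longrightarrow> u i = u j \<Longrightarrow> wedge k u = 0"
  using pdet_equal_cols[of i k j] by (auto simp: wedge_def fun_eq_iff)

text \<open>The index type carries no order, so every subset receives an arbitrary fixed listing;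
  another listing changes a wedge only by a sign.\<close>

definition enum :: "'n set \<Rightarrow> 'n list" where
  "enum I = (SOME xs. distinct xs \<and> set xs = I)"

lemma enum: "finite I \<Longrightarrow> distinct (enum I)" "finite I \<Longrightarrow> set (enum I) = I"
  "finite I \<Longrightarrow> length (enum I) = card I"
proof -
  assume "finite I"
  then obtain xs where "distinct xs \<and> set xs = I" using finite_distinct_list by blast
  then have "distinct (enum I) \<and> set (enum I) = I" unfolding enum_def by (rule someI)
  then show "distinct (enum I)" "set (enum I) = I" "length (enum I) = card I"
    using distinct_card by fastforce+
qed

definition frame_wedge :: "nat \<Rightarrow> real^'n::finite^'n \<Rightarrow> 'n set \<Rightarrow> 'n list \<Rightarrow> real" where
  "frame_wedge k V I = wedge k (\<lambda>m. V $ (enum I ! m))"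

lemma wedge_distinct:
  assumes d: "distinct cs" and k: "length cs = k"
  obtains s where "s \<noteq> 0" "wedge k (\<lambda>m. V $ (cs ! m)) = fscale s (frame_wedge k V (set cs))"
proof -
  let ?xs = "enum (set cs)"
  have xs: "distinct ?xs" "set ?xs = set cs" "length ?xs = k"
    using enum[of "set cs"] d k distinct_card[OF d] by auto
  have "mset cs = mset ?xs" using set_eq_iff_mset_eq_distinct[OF d xs(1)] xs(2) by blast
  then obtain p where p: "p permutes {..<length ?xs}" "permute_list p ?xs = cs"
    by (rule mset_eq_permutation)
  have "cs ! m = ?xs ! p m" if "m < k" for m
    using permute_list_nth[OF p(1), of m] p(2) xs(3) that by simp
  then have "wedge k (\<lambda>m. V $ (cs ! m)) = wedge k (\<lambda>m. V $ (?xs ! p m))"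
    unfolding wedge_def by (auto simp: fun_eq_iff intro!: pdet_cong)
  also have "\<dots> = fscale (of_int (sign p)) (frame_wedge k V (set cs))"
    unfolding frame_wedge_def using p xs(3) by (intro wedge_permute) simp
  finally show ?thesis using that[of "of_int (sign p)"] by (simp add: sign_def)
qed

text \<open>In the frame expansion words with a repeated letter give zero wedges, and the others
  reduce up to sign to k-subsets. The image is therefore spanned by the nonzero values of L on frame
  wedges.\<close>

lemma op_rank_le_card:
  fixes V :: "real^'n::finite^'n"
  assumes L: "is_endo (alt_tensors k) L" and V: "orthonormal_rows V"
  shows "L ` alt_tensors k \<subseteq> fs.span (L ` frame_wedge k V ` {I. card I = k \<and> L (frame_wedge k V I) \<noteq> 0})"
    and "op_rank (alt_tensors k) L \<le> card {I. card I = k \<and> L (frame_wedge k V I) \<noteq> 0}"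
proof -
  let ?F = "{I. card I = k \<and> L (frame_wedge k V I) \<noteq> 0}"
  let ?B = "L ` frame_wedge k V ` ?F"
  have w: "L (wedge k (\<lambda>m. V $ (cs ! m))) \<in> fs.span ?B" if len: "length cs = k" for cs
  proof (cases "distinct cs")
    case False
    then obtain i j where "i < k" "j < k" "i \<noteq> j" "cs ! i = cs ! j" using len distinct_conv_nth by blast
    then have "wedge k (\<lambda>m. V $ (cs ! m)) = 0" using wedge_equal_args[of i k j "\<lambda>m. V $ (cs ! m)"] by simp
    then show ?thesis by (simp add: is_endo_zero[OF L] fs.span_zero)
  next
    case True
    then obtain s where s: "wedge k (\<lambda>m. V $ (cs ! m)) = fscale s (frame_wedge k V (set cs))"
      using wedge_distinct[OF True len] by metis
    have "card (set cs) = k" using True len by (simp add: distinct_card)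
    then have "L (frame_wedge k V (set cs)) \<in> fs.span ?B"
      by (cases "L (frame_wedge k V (set cs)) = 0") (auto intro: fs.span_base fs.span_zero)
    then show ?thesis
      unfolding s is_endo_scale[OF L wedge_alt[of k, folded frame_wedge_def]] frame_wedge_def
      by (auto simp: is_endo_scale[OF L wedge_alt] intro: fs.span_scale)
  qed
  show sp: "L ` alt_tensors k \<subseteq> fs.span ?B"
  proof safe
    fix T :: "'n list \<Rightarrow> real" assume "T \<in> alt_tensors k"
    show "L T \<in> fs.span ?B"
      unfolding is_endo_frame_expansion[OF L V \<open>T \<in> alt_tensors k\<close>]
      by (intro fs.span_sum fs.span_scale w) simp
  qed
  have "fs.dim (L ` alt_tensors k) \<le> card ?B" by (rule fs.dim_le_card[OF sp]) simp
  also have "\<dots> \<le> card ?F" by (metis (no_types, lifting) card_image_le finite image_image)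
  finally show "op_rank (alt_tensors k) L \<le> card ?F" unfolding op_rank_def .
qed

text \<open>The ambient function space may have infinite dimension; the finite W ensures that a
  basis of S is finite, so that its cardinality can be compared.\<close>

lemma fs_card_le_dim:
  assumes "B \<subseteq> S" "fs.independent B" "S \<subseteq> fs.span W" "finite W"
  shows "card B \<le> fs.dim S"
proof -
  obtain C where C: "C \<subseteq> S" "fs.independent C" "S \<subseteq> fs.span C" "card C = fs.dim S"
    using fs.basis_exists by blast
  have "finite C" using fs.independent_span_bound[OF assms(4) C(2)] C(1) assms(3) by blast
  then show ?thesis using fs.independent_span_bound[OF _ assms(2)] assms(1) C by (metis subset_trans)
qed

lemma tens_sum_scale: "tens k u (\<Sum>c\<in>C. fscale (a c) (W c)) = (\<Sum>c\<in>C. a c * tens k u (W c))"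
  unfolding tens_def sum_fun_apply fscale_def sum_distrib_left
  by (subst sum.swap) (simp add: mult.left_commute)

text \<open>For a singular frame the images of frame wedges over different k-subsets of nonvanishing
  indices are mutually orthogonal, since their Gram matrix has a zero row, while for equal subsets
  the Gram matrix is diagonal with nonzero squared norms. So they are independent.\<close>

lemma card_le_op_rank:
  fixes V :: "real^'n::finite^'n" and A :: "real^'n^'n"
  assumes L: "is_endo (alt_tensors k) L" and V: "orthonormal_rows V"
    and A: "\<And>T. T \<in> alt_tensors k \<Longrightarrow> L T = ext_pow k A T"
    and orth: "\<And>i j. i \<noteq> j \<Longrightarrow> (A *v V $ i) \<bullet> (A *v V $ j) = 0"
  shows "card {I. card I = k \<and> I \<subseteq> {i. A *v V $ i \<noteq> 0}} \<le> op_rank (alt_tensors k) L"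
proof -
  let ?P = "{I. card I = k \<and> I \<subseteq> {i. A *v V $ i \<noteq> 0}}"
  define W where "W I = L (frame_wedge k V I)" for I
  define \<phi> where "\<phi> I = tens k (\<lambda>m. A *v V $ (enum I ! m))" for I
  have W: "W I = wedge k (\<lambda>m. A *v V $ (enum I ! m))" for I
    unfolding W_def frame_wedge_def A[OF wedge_alt] ext_pow_wedge ..
  have \<phi>W: "\<phi> I (W I') = pdet k (\<lambda>i j. (A *v V $ (enum I ! i)) \<bullet> (A *v V $ (enum I' ! j)))" for I I'
    unfolding \<phi>_def W tens_wedge ..
  have off: "\<phi> I (W I') = 0" if II: "I \<in> ?P" "I' \<in> ?P" "I \<noteq> I'" for I I'
  proof -
    \<comment> \<open>Both sets have k elements, so distinctness yields an index c of I outside I';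
      its row of the Gram matrix is zero.\<close>
    have "\<not> I \<subseteq> I'" using II card_subset_eq[of I' I] by auto
    then obtain c where c: "c \<in> I" "c \<notin> I'" by blast
    then obtain i where i: "i < k" "enum I ! i = c"
      using enum[of I] II by (metis (mono_tags, lifting) finite in_set_conv_nth mem_Collect_eq)
    have "enum I' ! j \<noteq> c" if "j < k" for j
      using c enum[of I'] II that by (metis (mono_tags, lifting) finite nth_mem mem_Collect_eq)
    then show ?thesis unfolding \<phi>W using i orth by (intro pdet_zero_row[of i]) metis+
  qed
  have diag: "\<phi> I (W I) \<noteq> 0" if I: "I \<in> ?P" for I
  proof -
    have inI: "enum I ! i \<in> I" if "i < k" for i
      using enum[of I] I that by (metis (mono_tags, lifting) finite nth_mem mem_Collect_eq)
    have "\<phi> I (W I) = (\<Prod>i<k. (A *v V $ (enum I ! i)) \<bullet> (A *v V $ (enum I ! i)))"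
      unfolding \<phi>W
    proof (rule pdet_diagonal)
      fix i j assume "i < k" "j < k" "i \<noteq> j"
      then have "enum I ! i \<noteq> enum I ! j" using enum[of I] I by (simp add: nth_eq_iff_index_eq)
      then show "(A *v V $ (enum I ! i)) \<bullet> (A *v V $ (enum I ! j)) = 0" by (rule orth)
    qed
    also have "\<dots> \<noteq> 0" using inI I by auto
    finally show ?thesis .
  qed
  have inj: "inj_on W ?P"
  proof (rule inj_onI, rule ccontr)
    fix I I' assume "I \<in> ?P" "I' \<in> ?P" "W I = W I'" "I \<noteq> I'"
    then show False using off[of I I'] diag[of I] by simp
  qed
  have "fs.independent (W ` ?P)"
  proof (rule fs.independent_if_scalars_zero)
    fix c x assume s: "(\<Sum>y\<in>W ` ?P. fscale (c y) y) = 0" and "x \<in> W ` ?P"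
    then obtain I where I: "I \<in> ?P" "x = W I" by blast
    have "(\<Sum>I'\<in>?P. fscale (c (W I')) (W I')) = 0" using s inj by (simp add: sum.reindex)
    then have "(\<Sum>I'\<in>?P. c (W I') * \<phi> I (W I')) = \<phi> I 0"
      unfolding \<phi>_def tens_sum_scale[symmetric] by simp
    also have "\<phi> I 0 = 0" by (simp add: \<phi>_def tens_def)
    also have "(\<Sum>I'\<in>?P. c (W I') * \<phi> I (W I')) = (\<Sum>I'\<in>{I}. c (W I') * \<phi> I (W I'))"
      using I off by (intro sum.mono_neutral_right) auto
    finally show "c x = 0" using diag[OF I(1)] I by simp
  qed simp
  moreover have "W ` ?P \<subseteq> L ` alt_tensors k" unfolding W_def frame_wedge_def using wedge_alt by blast
  ultimately have "card (W ` ?P) \<le> fs.dim (L ` alt_tensors k)"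
    using op_rank_le_card(1)[OF L V] by (intro fs_card_le_dim) auto
  then show ?thesis using inj by (simp add: card_image op_rank_def)
qed

section \<open>Exterior powers of matrices in the limit\<close>

lemma tendsto_wedge:
  assumes "\<And>j. (\<lambda>n. u n j) \<longlonglongrightarrow> u' j"
  shows "(\<lambda>n. wedge k (u n) xs) \<longlonglongrightarrow> wedge k u' xs"
  unfolding wedge_def pdet_def using assms by (auto intro!: tendsto_intros)

lemma tendsto_tens:
  assumes "\<And>j. (\<lambda>n. u n j) \<longlonglongrightarrow> u' j" "\<And>xs. (\<lambda>n. T n xs) \<longlonglongrightarrow> T' xs"
  shows "(\<lambda>n. tens k (u n) (T n)) \<longlonglongrightarrow> tens k u' T'"
  unfolding tens_def using assms by (auto intro!: tendsto_intros)

text \<open>Convergence is given only on fixed tensors, whereas here the argument moves too. The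
  kernel turns the value into a finite sum of products of convergent numbers.\<close>

lemma tendsto_endo_wedge:
  assumes L: "is_endo (alt_tensors k) L" and Lm: "\<And>n. is_endo (alt_tensors k) (Lm n)"
    and conv: "\<And>T xs. T \<in> alt_tensors k \<Longrightarrow> (\<lambda>n. Lm n T xs) \<longlonglongrightarrow> L T xs"
    and u: "\<And>j. (\<lambda>n. u n j) \<longlonglongrightarrow> u' j"
  shows "(\<lambda>n. Lm n (wedge k (u n)) xs) \<longlonglongrightarrow> L (wedge k u') xs"
proof -
  have "(\<lambda>n. kern k (Lm n) xs ys) \<longlonglongrightarrow> kern k L xs ys" for ys
    unfolding kern_def by (intro tendsto_divide conv wedge_alt tendsto_const) simp
  then show ?thesis
    unfolding is_endo_kern[OF L wedge_alt] is_endo_kern[OF Lm wedge_alt]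
    by (intro tendsto_sum tendsto_mult tendsto_wedge u)
qed

lemma skip_neq: "skip i a \<noteq> i"
  by (simp add: skip_def)

lemma skip_inj: "skip i a = skip i b \<longleftrightarrow> a = b"
  by (auto simp: skip_def)

lemma skip_le: "a < k \<Longrightarrow> skip i a \<le> k"
  by (auto simp: skip_def)

lemma skip_surj: "j \<le> k \<Longrightarrow> j \<noteq> i \<Longrightarrow> i \<le> k \<Longrightarrow> \<exists>a<k. skip i a = j"
  by (rule exI[of _ "if j < i then j else j - 1"]) (auto simp: skip_def)

text \<open>With a singular frame \<open>V n\<close> of \<open>A n\<close> and the normalised images \<open>W n\<close>, the minor along \<open>W n\<close>, \<open>V n\<close> of
  a \<open>k\<close>-set \<open>I\<close> is the product of the singular values in \<open>I\<close>. Comparing ranks shows that none of the products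
  that are nonzero for \<open>A n\<close> tends to zero, although the singular values themselves might be unbounded.\<close>

lemma nondegenerate_minors:
  fixes A :: "nat \<Rightarrow> real^'n::finite^'n"
  assumes L: "is_endo (alt_tensors k) L" and Lm: "\<And>n. is_endo (alt_tensors k) (Lm n)"
    and A: "\<And>n T. T \<in> alt_tensors k \<Longrightarrow> Lm n T = ext_pow k (A n) T"
    and conv: "\<And>T xs. T \<in> alt_tensors k \<Longrightarrow> (\<lambda>n. Lm n T xs) \<longlonglongrightarrow> L T xs"
    and rank: "op_rank (alt_tensors k) L = r choose k" "\<And>n. op_rank (alt_tensors k) (Lm n) = r choose k"
    and k: "0 < k" "k < r"
  shows "\<exists>u w. pdet (Suc k) (\<lambda>i j. (-1) ^ (i + j) *
      tens k (\<lambda>a. w (skip i a)) (L (wedge k (\<lambda>b. u (skip j b))))) \<noteq> 0"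
proof -
  have "\<forall>n. \<exists>V. orthonormal_rows V \<and> (\<forall>i j. i \<noteq> j \<longrightarrow> (A n *v V $ i) \<bullet> (A n *v V $ j) = 0)"
    using singular_frame_exists by blast
  then obtain V where V: "\<And>n. orthonormal_rows (V n)"
    and orth: "\<And>n i j. i \<noteq> j \<Longrightarrow> (A n *v V n $ i) \<bullet> (A n *v V n $ j) = 0" by metis
  define \<sigma> where "\<sigma> n i = norm (A n *v V n $ i)" for n i
  define W :: "nat \<Rightarrow> real^'n^'n" where "W n = (\<chi> i. (1 / \<sigma> n i) *\<^sub>R (A n *v V n $ i))" for n
  \<comment> \<open>also valid for \<open>\<sigma> n i = 0\<close>, where \<open>1 / 0 = 0\<close> makes the row of \<open>W n\<close> vanish\<close>
  have AV: "A n *v V n $ i = \<sigma> n i *\<^sub>R W n $ i" for n i by (simp add: W_def \<sigma>_def)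
  have WAV: "W n $ i \<bullet> (A n *v V n $ j) = (if i = j then \<sigma> n i else 0)" for n i j
    using orth[of i j n] by (simp add: W_def \<sigma>_def dot_square_norm power2_eq_square)
  have "norm (W n $ i) \<le> 1" for n i by (simp add: W_def \<sigma>_def)
  then have "norm (W n) \<le> CARD('n)" for n
    unfolding norm_vec_def[of "W n"] using L2_set_le_sum[of UNIV "\<lambda>i. norm (W n $ i)"]
      sum_bounded_above[of UNIV "\<lambda>i. norm (W n $ i)" 1] by fastforce
  then have "(V n, W n) \<in> {V. orthonormal_rows V} \<times> cball 0 CARD('n)" for n using V by auto
  moreover have "seq_compact ({V :: real^'n^'n. orthonormal_rows V} \<times> cball (0 :: real^'n^'n) CARD('n))"
    unfolding compact_eq_seq_compact_metric[symmetric] by (intro compact_Times compact_orthonormal_rows compact_cball)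
  ultimately obtain l s where s: "strict_mono s"
    and l: "l \<in> {V :: real^'n^'n. orthonormal_rows V} \<times> cball (0 :: real^'n^'n) CARD('n)"
    and lim: "((\<lambda>n. (V n, W n)) \<circ> s) \<longlonglongrightarrow> l"
    unfolding seq_compact_def by meson
  define V' W' where "V' = fst l" and "W' = snd l"
  have V': "orthonormal_rows V'" using l by (auto simp: V'_def)
  have "(\<lambda>n. V (s n)) \<longlonglongrightarrow> V'" "(\<lambda>n. W (s n)) \<longlonglongrightarrow> W'"
    using tendsto_fst[OF lim] tendsto_snd[OF lim] by (simp_all add: V'_def W'_def comp_def)
  then have limV: "(\<lambda>n. V (s n) $ c) \<longlonglongrightarrow> V' $ c" and limW: "(\<lambda>n. W (s n) $ c) \<longlonglongrightarrow> W' $ c" for c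
    by (simp_all add: tendsto_vec_nth)
  have limL: "(\<lambda>n. Lm (s n) (wedge k (\<lambda>m. V (s n) $ c m)) xs) \<longlonglongrightarrow> L (wedge k (\<lambda>m. V' $ c m)) xs" for c xs
  proof (rule tendsto_endo_wedge[OF L Lm])
    show "(\<lambda>n. Lm (s n) T xs) \<longlonglongrightarrow> L T xs" if "T \<in> alt_tensors k" for T xs
      using LIMSEQ_subseq_LIMSEQ[OF conv[OF that] s] by (simp add: comp_def)
  qed (rule limV)
  have limT: "(\<lambda>n. tens k (\<lambda>m. W (s n) $ d m) (Lm (s n) (wedge k (\<lambda>m. V (s n) $ c m))))
      \<longlonglongrightarrow> tens k (\<lambda>m. W' $ d m) (L (wedge k (\<lambda>m. V' $ c m)))" for c d
    by (rule tendsto_tens[OF limW limL])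
  have LmV: "Lm n (wedge k (\<lambda>m. V n $ c m)) = wedge k (\<lambda>m. A n *v V n $ c m)" for n c
    by (simp add: A[OF wedge_alt] ext_pow_wedge)
  have tensV: "tens k (\<lambda>m. W n $ d m) (Lm n (wedge k (\<lambda>m. V n $ c m)))
      = pdet k (\<lambda>i j. if d i = c j then \<sigma> n (d i) else 0)" for n c d
    by (simp add: LmV tens_wedge WAV)
  \<comment> \<open>For \<open>A n\<close> the image of the wedge is a scalar times the wedge of
    rows of \<open>W n\<close>, and the scalar is its own pairing with these rows. If the pairing
    tended to 0, the image would too, because the rows converge.\<close>
  have diag: "tens k (\<lambda>m. W' $ c m) (L (wedge k (\<lambda>m. V' $ c m))) \<noteq> 0"
    if nz: "L (wedge k (\<lambda>m. V' $ c m)) \<noteq> 0" and inj: "inj_on c {..<k}" for c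
  proof
    assume z: "tens k (\<lambda>m. W' $ c m) (L (wedge k (\<lambda>m. V' $ c m))) = 0"
    have "L (wedge k (\<lambda>m. V' $ c m)) xs = 0" for xs
    proof -
      have "Lm n (wedge k (\<lambda>m. V n $ c m)) xs
          = tens k (\<lambda>m. W n $ c m) (Lm n (wedge k (\<lambda>m. V n $ c m))) * wedge k (\<lambda>m. W n $ c m) xs" for n
      proof -
        have "tens k (\<lambda>m. W n $ c m) (Lm n (wedge k (\<lambda>m. V n $ c m))) = (\<Prod>m<k. \<sigma> n (c m))"
          unfolding tensV using inj by (subst pdet_diagonal) (auto dest: inj_onD)
        then show ?thesis
          unfolding LmV AV wedge_def using pdet_scale_cols[of k "\<lambda>m. \<sigma> n (c m)" "\<lambda>m j. W n $ c j $ (xs ! m)"]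
          by simp
      qed
      then have "(\<lambda>n. Lm (s n) (wedge k (\<lambda>m. V (s n) $ c m)) xs) \<longlonglongrightarrow> 0 * wedge k (\<lambda>m. W' $ c m) xs"
        using tendsto_mult[OF limT[of c c, unfolded z] tendsto_wedge[of "\<lambda>n m. W (s n) $ c m", OF limW]] by simp
      then show ?thesis using limL[of c xs] LIMSEQ_unique by fastforce
    qed
    then show False using nz by (auto simp: fun_eq_iff)
  qed
  let ?F = "{I. card I = k \<and> L (frame_wedge k V' I) \<noteq> 0}"
  \<comment> \<open>Being nonzero is an open condition and there are finitely many subsets, so one n
    serves them all.\<close>
  have "\<forall>\<^sub>F n in sequentially. \<forall>I\<in>?F. Lm (s n) (frame_wedge k (V (s n)) I) \<noteq> 0"
  proof (rule eventually_ball_finite)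
    show "\<forall>I\<in>?F. \<forall>\<^sub>F n in sequentially. Lm (s n) (frame_wedge k (V (s n)) I) \<noteq> 0"
    proof
      fix I assume "I \<in> ?F"
      then obtain xs where "L (frame_wedge k V' I) xs \<noteq> 0" by (auto simp: fun_eq_iff)
      then have "\<forall>\<^sub>F n in sequentially. Lm (s n) (frame_wedge k (V (s n)) I) xs \<noteq> 0"
        using tendsto_imp_eventually_ne[OF limL[of "\<lambda>m. enum I ! m" xs]] by (simp add: frame_wedge_def)
      then show "\<forall>\<^sub>F n in sequentially. Lm (s n) (frame_wedge k (V (s n)) I) \<noteq> 0"
        by (rule eventually_mono) auto
    qed
  qed simp
  from eventually_happens'[OF sequentially_bot this]
  obtain n where n: "\<And>I. I \<in> ?F \<Longrightarrow> Lm (s n) (frame_wedge k (V (s n)) I) \<noteq> 0" by blast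
  define J where "J = {i. A (s n) *v V (s n) $ i \<noteq> 0}"
  let ?P = "{I. card I = k \<and> I \<subseteq> J}"
  have "?F \<subseteq> ?P"
  proof
    fix I assume "I \<in> ?F"
    then have I: "card I = k" "L (frame_wedge k V' I) \<noteq> 0" by auto
    have "c \<in> J" if c: "c \<in> I" for c
    proof -
      obtain m where m: "m < k" "enum I ! m = c"
        using c enum[OF finite[of I]] I(1) in_set_conv_nth[of c "enum I"] by auto
      show ?thesis
      proof (rule ccontr)
        assume "c \<notin> J"
        then have z: "A (s n) *v V (s n) $ c = 0" by (simp add: J_def)
        have "frame_wedge k (V (s n)) I = wedge k (\<lambda>m. V (s n) $ (enum I ! m))" by (simp add: frame_wedge_def)
        moreover have "wedge k (\<lambda>m. A (s n) *v V (s n) $ (enum I ! m)) = 0"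
        proof -
          have "(\<Prod>j<k. \<sigma> (s n) (enum I ! j)) = 0" using m z by (intro prod_zero) (auto simp: \<sigma>_def)
          then have "pdet k (\<lambda>i j. (A (s n) *v V (s n) $ (enum I ! j)) $ (xs ! i)) = 0" for xs
            unfolding AV using pdet_scale_cols[of k "\<lambda>j. \<sigma> (s n) (enum I ! j)"
                "\<lambda>i j. W (s n) $ (enum I ! j) $ (xs ! i)"] by simp
          then show ?thesis by (auto simp: wedge_def fun_eq_iff)
        qed
        ultimately have "Lm (s n) (frame_wedge k (V (s n)) I) = 0" by (simp add: LmV)
        then show False using n[of I] I by simp
      qed
    qed
    then show "I \<in> ?P" using I(1) by blast
  qed
  \<comment> \<open>Here equality of the two ranks is decisive: together with the inclusion of
    \<open>?F\<close> in \<open>?P\<close> it shows that no nonzero product of k singular values is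
    lost in the limit.\<close>
  moreover have "card ?P \<le> card ?F"
  proof -
    have "card ?P \<le> op_rank (alt_tensors k) (Lm (s n))"
      unfolding J_def using Lm[of "s n"] V[of "s n"] A[of _ "s n"] orth[of _ _ "s n"] by (rule card_le_op_rank)
    also have "\<dots> = op_rank (alt_tensors k) L" by (simp only: rank)
    also have "\<dots> \<le> card ?F" by (rule op_rank_le_card(2)[OF L V'])
    finally show ?thesis .
  qed
  ultimately have FP: "?F = ?P" by (intro card_seteq) auto
  \<comment> \<open>The rank is at least k + 1, hence at least 2, whereas k or fewer nonvanishing
    indices would admit at most one k-subset. This yields k + 1 such indices.\<close>
  have "Suc k choose k \<le> r choose k" using k by (intro binomial_right_mono) auto
  then have "2 \<le> card ?P"
    using op_rank_le_card(2)[OF L V'] k unfolding FP rank(1) by simp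
  also have "card ?P = card J choose k" using n_subsets[of J k] by (simp add: conj_commute)
  finally have "\<not> card J \<le> k" using binomial_eq_0[of "card J" k] by (cases "card J < k") auto
  then obtain I0 where I0: "I0 \<subseteq> J" "card I0 = Suc k" using obtain_subset_with_card_n[of "Suc k" J] by auto
  define e where "e m = enum I0 ! m" for m
  have es: "length (enum I0) = Suc k" "distinct (enum I0)" "set (enum I0) = I0"
    using enum[of I0] I0 by auto
  have e_inj: "e a = e b \<longleftrightarrow> a = b" if "a \<le> k" "b \<le> k" for a b
    unfolding e_def using es that by (simp add: nth_eq_iff_index_eq)
  have e_in: "e a \<in> J" if "a \<le> k" for a
    unfolding e_def using es I0 that nth_mem[of a "enum I0"] by auto
  have nz: "L (wedge k (\<lambda>m. V' $ e (skip i m))) \<noteq> 0" for i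
  proof -
    define cs where "cs = map (\<lambda>m. e (skip i m)) [0..<k]"
    have d: "distinct cs" "length cs = k"
      unfolding cs_def by (auto simp: distinct_map inj_on_def e_inj skip_le skip_inj)
    have "set cs \<in> ?P"
      using d e_in skip_le distinct_card[OF d(1)] by (auto simp: cs_def)
    then have "L (frame_wedge k V' (set cs)) \<noteq> 0" unfolding FP[symmetric] by blast
    obtain t where t: "t \<noteq> 0" "wedge k (\<lambda>m. V' $ (cs ! m)) = fscale t (frame_wedge k V' (set cs))"
      by (rule wedge_distinct[OF d])
    have "L (wedge k (\<lambda>m. V' $ (cs ! m))) = fscale t (L (frame_wedge k V' (set cs)))"
      unfolding t(2) frame_wedge_def by (rule is_endo_scale[OF L wedge_alt])
    then have "L (wedge k (\<lambda>m. V' $ (cs ! m))) \<noteq> 0"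
      using t(1) \<open>L (frame_wedge k V' (set cs)) \<noteq> 0\<close> by simp
    moreover have "wedge k (\<lambda>m. V' $ (cs ! m)) = wedge k (\<lambda>m. V' $ e (skip i m))"
      unfolding wedge_def cs_def by (auto simp: fun_eq_iff intro!: pdet_cong)
    ultimately show ?thesis by simp
  qed
  let ?Q = "\<lambda>i j. tens k (\<lambda>a. W' $ e (skip i a)) (L (wedge k (\<lambda>b. V' $ e (skip j b))))"
  \<comment> \<open>Deleting i from the rows and j from the columns leaves index j among the rows
    only, so the minor of each \<open>A n\<close> has a zero row; the vanishing passes to the
    limit.\<close>
  have "?Q i j = 0" if ij: "i \<le> k" "j \<le> k" "i \<noteq> j" for i j
  proof -
    obtain a where a: "a < k" "skip i a = j" using skip_surj[of j k i] ij by auto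
    have "tens k (\<lambda>a. W n $ e (skip i a)) (Lm n (wedge k (\<lambda>b. V n $ e (skip j b)))) = 0" for n
      unfolding tensV
    proof (rule pdet_zero_row[OF a(1)])
      fix b assume "b < k"
      then show "(if e (skip i a) = e (skip j b) then \<sigma> n (e (skip i a)) else 0) = 0"
        using a ij skip_neq[of j b] skip_le[of b k j] by (simp add: e_inj)
    qed
    then have "(\<lambda>n. 0) \<longlonglongrightarrow> ?Q i j" using limT[of "\<lambda>m. e (skip i m)" "\<lambda>m. e (skip j m)"] by simp
    then show ?thesis by (simp add: LIMSEQ_const_iff)
  qed
  then have "pdet (Suc k) (\<lambda>i j. (-1) ^ (i + j) * ?Q i j) = (\<Prod>i<Suc k. (-1) ^ (i + i) * ?Q i i)"
    by (intro pdet_diagonal) auto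
  moreover have "?Q i i \<noteq> 0" if "i \<le> k" for i
    by (rule diag[OF nz]) (auto simp: inj_on_def e_inj skip_le skip_inj)
  then have "(\<Prod>i<Suc k. (-1) ^ (i + i) * ?Q i i) \<noteq> 0"
    by (auto simp del: prod.lessThan_Suc)
  ultimately have "pdet (Suc k) (\<lambda>i j. (-1) ^ (i + j) * ?Q i j) \<noteq> 0" by (simp only: not_False_eq_True)
  then show ?thesis
    by (intro exI[of _ "\<lambda>m. V' $ e m"] exI[of _ "\<lambda>m. W' $ e m"])
qed

section \<open>Smoothness of the weak Jacobian and of the function\<close>

lemma tendsto_pdet:
  assumes "\<And>i j. (\<lambda>n. a n i j) \<longlonglongrightarrow> a' i j"
  shows "(\<lambda>n. pdet k (a n)) \<longlonglongrightarrow> pdet k a'"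
  unfolding pdet_def by (intro tendsto_sum tendsto_mult tendsto_prod tendsto_const assms)

lemma Ck_on_pdet:
  assumes "\<And>i j. Ck_on n U (\<lambda>x. a x i j)"
  shows "Ck_on n U (\<lambda>x. pdet k (a x))"
  unfolding pdet_def by (intro Ck_on_sum Ck_on_mult Ck_on_prod Ck_on_const assms)

text \<open>The mixed second difference of a bilinear expression removes every term containing w or
  u and leaves t^2 times the coordinate entry.\<close>

lemma matrix_entry_by_perturbation:
  fixes A :: "real^'n::finite^'m::finite"
  assumes "t \<noteq> 0" and E: "\<And>p q. E p q = (w + p *\<^sub>R axis a 1) \<bullet> (A *v (u + q *\<^sub>R axis b 1))"
  shows "A $ a $ b = (E t t - E t 0 - E 0 t + E 0 0) / t\<^sup>2"
proof -
  have "axis a 1 \<bullet> (A *v axis b 1) = A $ a $ b"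
    by (simp add: matrix_vector_mult_basis column_def inner_axis')
  then have "E t t - E t 0 - E 0 t + E 0 0 = t\<^sup>2 * A $ a $ b"
    unfolding E
    by (simp add: matrix_vector_right_distrib matrix_vector_mult_scaleR inner_add_left inner_add_right
        power2_eq_square algebra_simps)
  then show ?thesis using assms by simp
qed

text \<open>The recovery formula is evaluated on \<open>\<Psi>\<close>, not on A, so it gives smooth
  functions near x0. They coincide with entries of compressions of \<open>A x\<close> where
  \<open>\<Psi> x\<close> is the exterior power, that is, almost everywhere.\<close>

lemma local_smooth_entry:
  fixes \<Psi> :: "real^'n::finite \<Rightarrow> ('n list \<Rightarrow> real) \<Rightarrow> 'n list \<Rightarrow> real" and A :: "real^'n \<Rightarrow> real^'n^'n"
  assumes \<Omega>: "open \<Omega>" and k: "odd k" "k < r"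
    and endo: "\<And>x. x \<in> \<Omega> \<Longrightarrow> is_endo (alt_tensors k) (\<Psi> x)"
    and smooth: "\<And>T xs. T \<in> alt_tensors k \<Longrightarrow> Cinf_on \<Omega> (\<lambda>x. \<Psi> x T xs)"
    and ae: "AE x in lebesgue. x \<in> \<Omega> \<longrightarrow> (\<forall>T\<in>alt_tensors k. \<Psi> x T = ext_pow k (A x) T)"
    and rank: "\<And>x. x \<in> \<Omega> \<Longrightarrow> op_rank (alt_tensors k) (\<Psi> x) = r choose k"
    and x0: "x0 \<in> \<Omega>"
  shows "\<exists>U G. open U \<and> x0 \<in> U \<and> U \<subseteq> \<Omega> \<and> Cinf_on U G \<and> (AE x in lebesgue. x \<in> U \<longrightarrow> A x $ a $ b = G x)"
proof -
  have k0: "0 < k" using k(1) odd_pos by blast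
  have smooth': "Ck_on n \<Omega> (\<lambda>x. \<Psi> x T xs)" if "T \<in> alt_tensors k" for T xs n
    using smooth[OF that] by (simp add: Cinf_on_def)
  \<comment> \<open>Where \<open>\<Psi> x\<close> is the exterior power of \<open>A x\<close>, this
    is the array of signed k-minors of the compression with entries
    \<open>w i \<bullet> (A x *v u j)\<close>.\<close>
  define Q where "Q x w u i j = (-1) ^ (i + j) * tens k (\<lambda>a. w (skip i a)) (\<Psi> x (wedge k (\<lambda>b. u (skip j b))))"
    for x w u i j
  have Qsmooth: "Ck_on n \<Omega> (\<lambda>x. Q x w u i j)" for n w u i j
    unfolding Q_def tens_def by (intro Ck_on_mult Ck_on_sum Ck_on_const smooth' wedge_alt)
  have "\<exists>u w. pdet (Suc k) (Q x0 w u) \<noteq> 0"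
  proof -
    \<comment> \<open>The good points have full measure and thus meet every ball about x0; they
      supply matrices whose exterior powers converge to \<open>\<Psi> x0\<close>.\<close>
    have "\<forall>n. \<exists>x. x \<in> \<Omega> \<inter> ball x0 (inverse (Suc n)) \<and> (\<forall>T\<in>alt_tensors k. \<Psi> x T = ext_pow k (A x) T)"
    proof
      fix n
      let ?B = "\<Omega> \<inter> ball x0 (inverse (Suc n))"
      have ob: "open ?B" using \<Omega> by (intro open_Int open_ball)
      have "x0 \<in> ?B" using x0 by simp
      then have ne: "?B \<noteq> {}" by blast
      have aeB: "AE x in lebesgue. x \<in> ?B \<longrightarrow> (\<forall>T\<in>alt_tensors k. \<Psi> x T = ext_pow k (A x) T)"
        using ae by eventually_elim blast
      from AE_in_open_ex[OF ob ne this]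
      show "\<exists>x. x \<in> ?B \<and> (\<forall>T\<in>alt_tensors k. \<Psi> x T = ext_pow k (A x) T)" unfolding Bex_def .
    qed
    from choice[OF this] obtain y where y0: "\<forall>n. y n \<in> \<Omega> \<inter> ball x0 (inverse (Suc n))
        \<and> (\<forall>T\<in>alt_tensors k. \<Psi> (y n) T = ext_pow k (A (y n)) T)" ..
    note yn = spec[OF y0]
    note y = IntD1[OF conjunct1[OF yn]] IntD2[OF conjunct1[OF yn]] bspec[OF conjunct2[OF yn]]
    have "(\<lambda>n. dist (y n) x0) \<longlonglongrightarrow> 0"
      by (rule tendsto_sandwich[OF _ _ tendsto_const LIMSEQ_inverse_real_of_nat])
        (use y(2) in \<open>simp_all add: dist_commute less_imp_le\<close>)
    then have ylim: "y \<longlonglongrightarrow> x0" by (subst tendsto_dist_iff)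
    have conv: "(\<lambda>n. \<Psi> (y n) T xs) \<longlonglongrightarrow> \<Psi> x0 T xs" if "T \<in> alt_tensors k" for T xs
      by (rule continuous_on_tendsto_compose[OF Ck_on_continuous[OF smooth'[OF that, of 0]] ylim x0])
        (intro always_eventually allI y(1))
    show ?thesis
      unfolding Q_def
      by (rule nondegenerate_minors[OF endo[OF x0] endo[OF y(1)] y(3) conv rank[OF x0] rank[OF y(1)] k0 k(2)])
  qed
  then obtain u w where uw: "pdet (Suc k) (Q x0 w u) \<noteq> 0" by blast
  \<comment> \<open>Only the vectors with index 0 move, because the recovery formula returns the
    entry (0, 0) of the compression.\<close>
  define us where "us q = u(0 := u 0 + q *\<^sub>R axis b 1)" for q
  define ws where "ws p = w(0 := w 0 + p *\<^sub>R axis a 1)" for p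
  define D where "D p q x = pdet (Suc k) (Q x (ws p) (us q))" for p q x
  have us0: "us 0 = u" and ws0: "ws 0 = w" by (auto simp: us_def ws_def)
  have Dlim: "(\<lambda>n. D (p n) (q n) x0) \<longlonglongrightarrow> D 0 0 x0" if "p \<longlonglongrightarrow> 0" "q \<longlonglongrightarrow> 0" for p q
  proof -
    have pl: "(\<lambda>n. ws (p n) j) \<longlonglongrightarrow> ws 0 j" for j
      unfolding ws_def by (cases "j = 0") (auto intro!: tendsto_eq_intros that)
    have ql: "(\<lambda>n. us (q n) j) \<longlonglongrightarrow> us 0 j" for j
      unfolding us_def by (cases "j = 0") (auto intro!: tendsto_eq_intros that)
    have el: "(\<lambda>n. \<Psi> x0 (wedge k (\<lambda>b. us (q n) (skip j b))) xs) \<longlonglongrightarrow> \<Psi> x0 (wedge k (\<lambda>b. us 0 (skip j b))) xs" for j xs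
      by (rule tendsto_endo_wedge[OF endo[OF x0] endo[OF x0] tendsto_const ql])
    show ?thesis
      unfolding D_def Q_def
      by (intro tendsto_pdet tendsto_mult tendsto_const tendsto_tens pl el)
  qed
  let ?t = "\<lambda>n. inverse (real (Suc n))"
  have "D 0 0 x0 \<noteq> 0" using uw by (simp add: D_def us0 ws0)
  then have ev: "\<forall>\<^sub>F n in sequentially. D (p n) (q n) x0 \<noteq> 0" if "p \<longlonglongrightarrow> 0" "q \<longlonglongrightarrow> 0" for p q
    using tendsto_imp_eventually_ne[OF Dlim[OF that]] by blast
  \<comment> \<open>One step size t must keep all four corner determinants nonzero at x0; the corner
    (0, 0) is already known.\<close>
  have "\<forall>\<^sub>F n in sequentially. D (?t n) (?t n) x0 \<noteq> 0 \<and> D (?t n) 0 x0 \<noteq> 0 \<and> D 0 (?t n) x0 \<noteq> 0"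
    by (intro eventually_conj ev LIMSEQ_inverse_real_of_nat tendsto_const)
  from eventually_happens'[OF sequentially_bot this] obtain t where t: "t > 0"
    "D t t x0 \<noteq> 0" "D t 0 x0 \<noteq> 0" "D 0 t x0 \<noteq> 0" by (metis of_nat_0_less_iff positive_imp_inverse_positive zero_less_Suc)
  \<comment> \<open>Nonvanishing of the determinant is what both the smoothness of the odd root and
    the division require.\<close>
  define U where "U p q = {x \<in> \<Omega>. D p q x \<noteq> 0}" for p q
  define E where "E p q x = root k (D p q x) * pdet k (\<lambda>i j. Q x (ws p) (us q) (Suc i) (Suc j)) * inverse (D p q x)"
    for p q x
  have Dsmooth: "Ck_on n \<Omega> (D p q)" for n p q unfolding D_def by (intro Ck_on_pdet Qsmooth)
  have openU: "open (U p q)" for p q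
  proof -
    have "U p q = \<Omega> \<inter> D p q -` (- {0})" by (auto simp: U_def)
    then show ?thesis
      using continuous_open_preimage[OF Ck_on_continuous[OF Dsmooth] \<Omega> open_Compl[OF closed_singleton]] by simp
  qed
  have subU: "U p q \<subseteq> \<Omega>" for p q by (auto simp: U_def)
  have Esmooth: "Ck_on n (U p q) (E p q)" for n p q
    unfolding E_def
    by (intro Ck_on_mult Ck_on_inverse Ck_on_odd_root k(1) Ck_on_pdet
        Ck_on_subset[OF Dsmooth subU] Ck_on_subset[OF Qsmooth subU]) (auto simp: U_def)
  have Eae: "E p q x = (w 0 + p *\<^sub>R axis a 1) \<bullet> (A x *v (u 0 + q *\<^sub>R axis b 1))"
    if x: "x \<in> U p q" and eq: "\<And>T. T \<in> alt_tensors k \<Longrightarrow> \<Psi> x T = ext_pow k (A x) T" for x p q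
  proof -
    define S where "S i j = ws p i \<bullet> (A x *v us q j)" for i j
    have "Q x (ws p) (us q) = minors k S"
      unfolding Q_def minors_def S_def eq[OF wedge_alt] ext_pow_wedge tens_wedge by (rule refl)
    then have Qe: "Q x (ws p) (us q) i j = minors k S i j" for i j by simp
    have "D p q x = pdet (Suc k) (minors k S)" unfolding D_def Qe ..
    then have "S 0 0 = E p q x"
      using entry_from_minors[OF k(1), of S] x unfolding E_def U_def Qe by (simp add: divide_inverse)
    then show ?thesis by (simp add: S_def ws_def us_def)
  qed
  define U' where "U' = U t t \<inter> U t 0 \<inter> U 0 t \<inter> U 0 0"
  define G where "G x = (E t t x + (-1) * E t 0 x + (-1) * E 0 t x + E 0 0 x) * inverse (t\<^sup>2)" for x
  have "open U'" unfolding U'_def by (intro open_Int openU)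
  moreover have "x0 \<in> U'" using t x0 \<open>D 0 0 x0 \<noteq> 0\<close> by (simp add: U'_def U_def)
  moreover have "U' \<subseteq> \<Omega>" using subU by (auto simp: U'_def)
  moreover have "Cinf_on U' G"
    unfolding Cinf_on_def G_def
    by (intro allI Ck_on_mult Ck_on_add Ck_on_const Ck_on_subset[OF Esmooth]) (auto simp: U'_def)
  moreover have "AE x in lebesgue. x \<in> U' \<longrightarrow> A x $ a $ b = G x"
    using ae
  proof eventually_elim
    case (elim x)
    show ?case
    proof
      assume x: "x \<in> U'"
      then have eq: "\<Psi> x T = ext_pow k (A x) T" if "T \<in> alt_tensors k" for T
        using elim \<open>U' \<subseteq> \<Omega>\<close> that by blast
      have Ee: "E p q x = (w 0 + p *\<^sub>R axis a 1) \<bullet> (A x *v (u 0 + q *\<^sub>R axis b 1))" if "x \<in> U p q" for p q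
        using that eq by (rule Eae)
      have U: "x \<in> U t t" "x \<in> U t 0" "x \<in> U 0 t" "x \<in> U 0 0" using x by (auto simp: U'_def)
      have "t \<noteq> 0" using t by simp
      from matrix_entry_by_perturbation[OF this refl, of "A x" a b "w 0" "u 0"]
      show "A x $ a $ b = G x"
        unfolding G_def Ee[OF U(1)] Ee[OF U(2)] Ee[OF U(3)] Ee[OF U(4)]
        by (simp add: divide_inverse)
    qed
  qed
  ultimately show ?thesis by blast
qed

section \<open>From Sobolev data on the domain to Borel functions on the whole space\<close>

text \<open>Sobolev functions are Lebesgue measurable on \<open>\<Omega>\<close>, while the
  translation and Fubini arguments live on \<open>lborel\<close>. Cutting off on a compact set gives
  integrability on the whole space, and completion supplies the Borel function.\<close>

lemma Lp_on_borel_representative: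
  fixes F :: "real^'n::finite \<Rightarrow> real^'m::finite"
  assumes F: "Lp_on p \<Omega> F" and p: "p \<ge> 1" and \<Omega>: "open \<Omega>" and S: "compact S" "S \<subseteq> \<Omega>"
  obtains f' where "integrable lborel f'" "AE x in lebesgue. indicator S x * F x $ a = f' x"
proof -
  have "integrable (lebesgue_on \<Omega>) (\<lambda>x. indicator S x *\<^sub>R F x)"
  proof (rule Lp_on_integrable_mult[OF F p \<Omega> S, where B=1])
    show "indicator S \<in> borel_measurable borel" by (intro borel_measurable_indicator borel_compact S(1))
  qed (auto simp: indicator_def)
  then have "integrable (lebesgue_on \<Omega>) (\<lambda>x. (indicator S x *\<^sub>R F x) $ a)"
    by (rule integrable_bounded_linear[OF bounded_linear_vec_nth])
  then have "integrable lebesgue (\<lambda>x. indicator \<Omega> x *\<^sub>R ((indicator S x *\<^sub>R F x) $ a))"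
    using \<Omega> by (subst (asm) integrable_restrict_space) auto
  moreover have "(\<lambda>x. indicator \<Omega> x *\<^sub>R ((indicator S x *\<^sub>R F x) $ a)) = (\<lambda>x. indicator S x * F x $ a)"
    using S(2) by (auto simp: indicator_def fun_eq_iff)
  ultimately have i: "integrable lebesgue (\<lambda>x. indicator S x * F x $ a)" by (simp only:)
  then obtain f' where f': "f' \<in> borel_measurable lborel" "AE x in lborel. indicator S x * F x $ a = f' x"
    using completion_ex_borel_measurable_real[OF borel_measurable_integrable[OF i]] by blast
  have ae: "AE x in lebesgue. indicator S x * F x $ a = f' x" by (rule AE_completion[OF f'(2)])
  have "integrable lebesgue f'"
    by (rule integrable_cong_AE_imp[OF i measurable_completion[OF f'(1)]]) (use ae in auto)
  then show ?thesis using that ae integrable_completion[OF f'(1)] by blast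
qed

text \<open>Converts the vector-valued integrals over \<open>\<Omega>\<close> in the definition of
  weak partials into scalar integrals of the Borel representative.\<close>

lemma Lp_on_pairing_component:
  fixes F :: "real^'n::finite \<Rightarrow> real^'m::finite"
  assumes F: "Lp_on p \<Omega> F" and p: "p \<ge> 1" and \<Omega>: "open \<Omega>" and S: "compact S" "S \<subseteq> \<Omega>"
    and \<psi>: "continuous_on UNIV \<psi>" "\<And>x. x \<notin> S \<Longrightarrow> \<psi> x = 0"
    and f': "f' \<in> borel_measurable borel" "AE x in lebesgue. indicator S x * F x $ a = f' x"
  shows "(\<integral>x. \<psi> x *\<^sub>R F x \<partial>lebesgue_on \<Omega>) $ a = (\<integral>x. \<psi> x * f' x \<partial>lborel)"
proof -
  have \<psi>m: "\<psi> \<in> borel_measurable borel" by (rule borel_measurable_continuous_onI[OF \<psi>(1)])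
  obtain B where B: "\<And>x. \<bar>\<psi> x\<bar> \<le> B" using continuous_vanish_bounded[OF \<psi>(1) S(1) \<psi>(2)] by blast
  have int: "integrable (lebesgue_on \<Omega>) (\<lambda>x. \<psi> x *\<^sub>R F x)"
    by (rule Lp_on_integrable_mult[OF F p \<Omega> S \<psi>m B \<psi>(2)])
  have intc: "integrable (lebesgue_on \<Omega>) (\<lambda>x. (\<psi> x *\<^sub>R F x) $ a)"
    by (rule integrable_bounded_linear[OF bounded_linear_vec_nth int])
  have \<Omega>': "\<Omega> \<inter> space lebesgue \<in> sets lebesgue" using \<Omega> by simp
  have m: "(\<lambda>x. indicator \<Omega> x *\<^sub>R ((\<psi> x *\<^sub>R F x) $ a)) \<in> borel_measurable lebesgue"
    using intc unfolding integrable_restrict_space[OF \<Omega>'] by (rule borel_measurable_integrable)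
  have m': "(\<lambda>x. \<psi> x * f' x) \<in> borel_measurable lborel" using \<psi>m f'(1) by simp
  have "(\<integral>x. \<psi> x *\<^sub>R F x \<partial>lebesgue_on \<Omega>) $ a = (\<integral>x. (\<psi> x *\<^sub>R F x) $ a \<partial>lebesgue_on \<Omega>)"
    by (rule integral_bounded_linear[OF bounded_linear_vec_nth int, symmetric])
  also have "\<dots> = (\<integral>x. indicator \<Omega> x *\<^sub>R ((\<psi> x *\<^sub>R F x) $ a) \<partial>lebesgue)"
    by (rule integral_restrict_space[OF \<Omega>'])
  also have "\<dots> = (\<integral>x. \<psi> x * f' x \<partial>lebesgue)"
  proof (rule integral_cong_AE[OF m measurable_completion[OF m']])
    show "AE x in lebesgue. indicator \<Omega> x *\<^sub>R ((\<psi> x *\<^sub>R F x) $ a) = \<psi> x * f' x"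
      using f'(2)
    proof eventually_elim
      case (elim x)
      show ?case
      proof (cases "x \<in> S")
        case True
        then show ?thesis using elim S(2) by (auto simp: indicator_def)
      qed (simp add: \<psi>(2))
    qed
  qed
  also have "\<dots> = (\<integral>x. \<psi> x * f' x \<partial>lborel)" by (rule integral_completion[OF m'])
  finally show ?thesis .
qed

text \<open>Each component has a representative whose partial derivatives are the smooth functions
  \<open>G a b\<close> themselves, so smoothness of all orders follows at once, without
  bootstrapping.\<close>

lemma weak_gradient_smooth_local:
  fixes f :: "real^'n::finite \<Rightarrow> real^'m::finite"
  assumes sob: "sobolev_W1p p \<Omega> f g" and p: "p \<ge> 1" and \<Omega>: "open \<Omega>"
    and U: "open U" "U \<subseteq> \<Omega>" "x0 \<in> U"
    and G: "\<And>a b. Cinf_on U (G a b)" "\<And>a b. AE x in lebesgue. x \<in> U \<longrightarrow> g b x $ a = G a b x"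
  shows "\<exists>\<delta> h. \<delta> > 0 \<and> Cinf_on (ball x0 \<delta>) h \<and> (AE x in lebesgue. x \<in> ball x0 \<delta> \<longrightarrow> f x = h x)"
proof -
  obtain e where e: "e > 0" "cball x0 e \<subseteq> U" using U open_contains_cball by blast
  \<comment> \<open>The weak equation will be used on the ball of radius 3 \<open>\<rho>\<close>,
    which is to lie in U.\<close>
  define \<rho> where "\<rho> = e / 3"
  define S where "S = cball x0 e"
  have \<rho>: "\<rho> > 0" "3 * \<rho> = e" using e by (auto simp: \<rho>_def)
  have S: "compact S" "S \<subseteq> \<Omega>" "S \<subseteq> U" "ball x0 (3 * \<rho>) \<subseteq> S" using e U \<rho> by (auto simp: S_def)
  let ?B = "ball x0 (\<rho> / 2)"
  have BS: "?B \<subseteq> S" using \<rho> by (auto simp: S_def)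
  \<comment> \<open>Nearest-point projection onto the closed ball extends G continuously to the
    whole space; on the ball itself nothing changes.\<close>
  define G' where "G' a b x = G a b (closest_point S x)" for a b x
  have G'c: "continuous_on UNIV (G' a b)" for a b
  proof -
    have "continuous_on UNIV (closest_point S)"
      using e by (intro continuous_on_closest_point) (auto simp: S_def)
    moreover have "closest_point S x \<in> S" for x
      using e by (intro closest_point_in_set) (auto simp: S_def)
    moreover have "continuous_on S (G a b)"
      using G(1)[of a b] S(3) Ck_on_continuous Ck_on_subset unfolding Cinf_on_def by blast
    ultimately show ?thesis
      unfolding G'_def by (intro continuous_on_compose2[of S "G a b" UNIV "closest_point S"]) auto
  qed
  have G'S: "G' a b x = G a b x" if "x \<in> S" for a b x using that by (simp add: G'_def closest_point_self)
  have "\<exists>h. Cinf_on ?B h \<and> (AE x in lebesgue. x \<in> ?B \<longrightarrow> f x $ a = h x)" for a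
  proof -
    have Lf: "Lp_on p \<Omega> f" and Lg: "\<And>b. Lp_on p \<Omega> (g b)" and w: "\<And>b. weak_partial \<Omega> f b (g b)"
      using sob by (auto simp: sobolev_W1p_def)
    obtain f' where f': "integrable lborel f'" "AE x in lebesgue. indicator S x * f x $ a = f' x"
      using Lp_on_borel_representative[OF Lf p \<Omega> S(1,2)] by blast
    have f'm: "f' \<in> borel_measurable borel" using f'(1) by auto
    have weak: "(\<integral>x. frechet_derivative \<phi> (at x) (axis b 1) * f' x \<partial>lborel) = - (\<integral>x. \<phi> x * G' a b x \<partial>lborel)"
      if t: "test_fun (ball x0 (3 * \<rho>)) \<phi>" for \<phi> b
    proof -
      have cl: "closure {x. \<phi> x \<noteq> 0} \<subseteq> S" using t S(4) unfolding test_fun_def by blast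
      then have t\<Omega>: "test_fun \<Omega> \<phi>" using t S(2) unfolding test_fun_def by blast
      have z: "\<phi> x = 0" if "x \<notin> S" for x using cl closure_subset[of "{x. \<phi> x \<noteq> 0}"] that by blast
      have "(\<integral>x. frechet_derivative \<phi> (at x) (axis b 1) * f' x \<partial>lborel)
          = (\<integral>x. frechet_derivative \<phi> (at x) (axis b 1) *\<^sub>R f x \<partial>lebesgue_on \<Omega>) $ a"
        by (rule Lp_on_pairing_component[OF Lf p \<Omega> S(1,2) _ _ f'm f'(2), symmetric])
          (use test_fun_derivative(2,3)[OF t] cl in blast)+
      also have "\<dots> = - (\<integral>x. \<phi> x *\<^sub>R g b x \<partial>lebesgue_on \<Omega>) $ a"
        using w[of b] t\<Omega> unfolding weak_partial_def by simp
      \<comment> \<open>The factor \<open>indicator S\<close> puts the continuous extension into the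
        form of a representative of the cut-off weak partial; it disappears again because \<phi>
        vanishes outside S.\<close>
      also have "(\<integral>x. \<phi> x *\<^sub>R g b x \<partial>lebesgue_on \<Omega>) $ a = (\<integral>x. \<phi> x * (indicator S x * G' a b x) \<partial>lborel)"
      proof (rule Lp_on_pairing_component[OF Lg p \<Omega> S(1,2) test_fun_continuous[OF t] z])
        show "(\<lambda>x. indicator S x * G' a b x) \<in> borel_measurable borel"
          using S(1) borel_compact borel_measurable_continuous_onI[OF G'c]
          by (intro borel_measurable_times borel_measurable_indicator) auto
        show "AE x in lebesgue. indicator S x * g b x $ a = indicator S x * G' a b x"
          using G(2)[of b a] by eventually_elim (use S(3) G'S in \<open>auto simp: indicator_def\<close>)
      qed
      also have "(\<lambda>x. \<phi> x * (indicator S x * G' a b x)) = (\<lambda>x. \<phi> x * G' a b x)"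
        using z by (auto simp: indicator_def fun_eq_iff)
      finally show ?thesis .
    qed
    obtain h where h: "\<And>y. y \<in> ?B \<Longrightarrow> (h has_derivative (\<lambda>v. \<Sum>i\<in>UNIV. v $ i * G' a i y)) (at y)"
      "AE y in lborel. y \<in> ?B \<longrightarrow> f' y = h y"
      using weak_gradient_C1_ball[OF f'(1) G'c weak \<rho>(1)] by blast
    have "Ck_on (Suc n) ?B h" for n
    proof (rule Ck_on_SucI[OF h(1)])
      fix i :: "real^'n" assume "i \<in> Basis"
      have "Ck_on n ?B (G' a b)" for b
      proof (rule Ck_on_cong[OF open_ball])
        show "Ck_on n ?B (G a b)"
          using G(1)[of a b] BS S(3) Ck_on_subset unfolding Cinf_on_def by blast
      qed (use BS G'S in auto)
      then show "Ck_on n ?B (\<lambda>x. \<Sum>b\<in>UNIV. i $ b * G' a b x)"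
        by (intro Ck_on_sum Ck_on_cmult)
    qed
    then have "Cinf_on ?B h" unfolding Cinf_on_def using Ck_on_SucD by blast
    moreover have "AE x in lebesgue. x \<in> ?B \<longrightarrow> f x $ a = h x"
      using AE_completion[OF h(2)] f'(2)
    proof eventually_elim
      case (elim x)
      show ?case
      proof
        assume x: "x \<in> ?B"
        then have "indicator S x = (1::real)" using BS by auto
        then show "f x $ a = h x" using elim x by simp
      qed
    qed
    ultimately show ?thesis by blast
  qed
  then have "\<forall>a. \<exists>h. Cinf_on ?B h \<and> (AE x in lebesgue. x \<in> ?B \<longrightarrow> f x $ a = h x)" by blast
  from choice[OF this] obtain h where h: "\<forall>a. Cinf_on ?B (h a) \<and> (AE x in lebesgue. x \<in> ?B \<longrightarrow> f x $ a = h a x)" ..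
  let ?h = "\<lambda>x. \<chi> a. h a x"
  have "Cinf_on ?B ?h"
    unfolding Cinf_on_def by (intro allI Ck_on_vec) (use h in \<open>simp add: Cinf_on_def\<close>)
  moreover have "AE x in lebesgue. \<forall>a\<in>UNIV. x \<in> ?B \<longrightarrow> f x $ a = h a x"
    by (subst AE_ball_countable) (use h in auto)
  then have "AE x in lebesgue. x \<in> ?B \<longrightarrow> f x = ?h x"
    by eventually_elim (simp add: Finite_Cartesian_Product.vec_eq_iff)
  ultimately show ?thesis using \<rho>(1) by (intro exI[of _ "\<rho> / 2"] exI[of _ ?h]) simp
qed

text \<open>Membership of f in the Sobolev space is a statement up to null sets, so smoothness of f
  means equality almost everywhere with a smooth h. Smoothness of the endomorphism-valued map
  \<open>\<Psi>\<close> is expressed through its coordinates on every fixed alternating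
  tensor.\<close>

theorem mainTheorem13:
  fixes \<Omega> :: "(real^'d::finite) set"
    and f :: "real^'d \<Rightarrow> real^'d"
    and g :: "'d \<Rightarrow> real^'d \<Rightarrow> real^'d"
    and \<Psi> :: "real^'d \<Rightarrow> ('d list \<Rightarrow> real) \<Rightarrow> ('d list \<Rightarrow> real)"
    and k r :: nat and p :: real
  assumes "CARD('d) > 2"
    and "open \<Omega>"
    and "odd k" and "2 \<le> k" and "k \<le> CARD('d) - 1"
    and "p \<ge> 1"
    and "k < r" and "r \<le> CARD('d)"
    and "sobolev_W1p p \<Omega> f g"
    and "\<forall>x\<in>\<Omega>. is_endo (alt_tensors k) (\<Psi> x)"
    and "\<forall>T\<in>alt_tensors k. \<forall>xs. Cinf_on \<Omega> (\<lambda>x. \<Psi> x T xs)"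
    and "AE x in lebesgue. x \<in> \<Omega> \<longrightarrow>
           (\<forall>T\<in>alt_tensors k. \<Psi> x T = ext_pow k (weak_jacobian g x) T)"
    and "\<forall>x\<in>\<Omega>. op_rank (alt_tensors k) (\<Psi> x) = r choose k"
  shows "\<exists>h :: real^'d \<Rightarrow> real^'d. Cinf_on \<Omega> h \<and> (AE x in lebesgue. x \<in> \<Omega> \<longrightarrow> f x = h x)"
proof (rule glue_local_representatives[OF assms(2)])
  fix x0 assume x0: "x0 \<in> \<Omega>"
  have "\<forall>ab. \<exists>UG. open (fst UG) \<and> x0 \<in> fst UG \<and> fst UG \<subseteq> \<Omega> \<and> Cinf_on (fst UG) (snd UG)
      \<and> (AE x in lebesgue. x \<in> fst UG \<longrightarrow> weak_jacobian g x $ fst ab $ snd ab = snd UG x)"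
  proof
    fix ab :: "'d \<times> 'd"
    have "\<exists>U G. open U \<and> x0 \<in> U \<and> U \<subseteq> \<Omega> \<and> Cinf_on U G
        \<and> (AE x in lebesgue. x \<in> U \<longrightarrow> weak_jacobian g x $ fst ab $ snd ab = G x)"
      by (rule local_smooth_entry[OF assms(2,3,7) _ _ assms(12) _ x0]) (use assms(10,11,13) in auto)
    then show "\<exists>UG. open (fst UG) \<and> x0 \<in> fst UG \<and> fst UG \<subseteq> \<Omega> \<and> Cinf_on (fst UG) (snd UG)
        \<and> (AE x in lebesgue. x \<in> fst UG \<longrightarrow> weak_jacobian g x $ fst ab $ snd ab = snd UG x)"
      by simp
  qed
  from choice[OF this] obtain N where N: "\<forall>ab. open (fst (N ab)) \<and> x0 \<in> fst (N ab) \<and> fst (N ab) \<subseteq> \<Omega>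
      \<and> Cinf_on (fst (N ab)) (snd (N ab))
      \<and> (AE x in lebesgue. x \<in> fst (N ab) \<longrightarrow> weak_jacobian g x $ fst ab $ snd ab = snd (N ab) x)" ..
  \<comment> \<open>There are finitely many entries, so the neighbourhoods found for them separately
    have an open intersection.\<close>
  define U where "U = (\<Inter>ab. fst (N ab))"
  have UN: "U \<subseteq> fst (N ab)" for ab by (auto simp: U_def)
  show "\<exists>\<delta> h. \<delta> > 0 \<and> Cinf_on (ball x0 \<delta>) h \<and> (AE x in lebesgue. x \<in> ball x0 \<delta> \<longrightarrow> f x = h x)"
  proof (rule weak_gradient_smooth_local[where G="\<lambda>a b. snd (N (a, b))"])
    show "sobolev_W1p p \<Omega> f g" "p \<ge> 1" "open \<Omega>" by fact+
    show "open U" unfolding U_def using N by (intro open_INT) auto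
    show "U \<subseteq> \<Omega>" using N UN by blast
    show "x0 \<in> U" using N by (simp add: U_def)
    show "Cinf_on U (snd (N (a, b)))" for a b
      using N UN Ck_on_subset unfolding Cinf_on_def by blast
    show "AE x in lebesgue. x \<in> U \<longrightarrow> g b x $ a = snd (N (a, b)) x" for a b
    proof -
      have "AE x in lebesgue. x \<in> fst (N (a, b)) \<longrightarrow> weak_jacobian g x $ a $ b = snd (N (a, b)) x"
        using spec[OF N, of "(a, b)"] by simp
      then show ?thesis by eventually_elim (use UN in \<open>auto simp: weak_jacobian_def\<close>)
    qed
  qed
qed

end
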